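(* Let $p\in[1,\infty]$, $\eta=\min(\alpha-1,\beta,\gamma)$ and $C_{\rm i}>0$. There exists $T_{\rm m}\in(0,+\infty]$ such that for all $T\in(0,T_{\rm m})$ there exist $\tilde\varepsilon_T>0$ and $\tilde C_T\ge C_{\rm i}$ such that the following holds. For all $X^\ast=(x^\ast,y^\ast)^T\in\ell_p^2$ such that $0<\varepsilon:=\|X^\ast\|_p\le\tilde\varepsilon_T$, and for all $X^0\in\ell_p^2$ satisfying $\|X^0-X^\ast\|_p\le C_{\rm i}\,\varepsilon^{1+\eta}$, the solution $X(t)\in\ell_p^2$ of $\dot X=JX+G(X)$ with $X(0)=X^0$ is defined at least for $t\in[0,T\varepsilon^{1-\alpha}]$ and satisfies $$\|X(t)-X_A(t)\|_p\le\tilde C_T\,\varepsilon^{1+\eta}\quad\text{for all }t\in[0,T\varepsilon^{1-\alpha}],$$ where $$X_A(t)=\frac1{\sqrt2}A(t)\,e^{it}\begin{pmatrix}1\\ i\end{pmatrix}+\mathrm{c.c.}$$ and $A\in C^2([0,T\varepsilon^{1-\alpha}],\ell_p(\mathbb Z,\mathbb C))$ is the solution of the amplitude equation $i\,\dot A=\delta^+f(\delta^-A)$ with initial condition $A(0)=(x^\ast-i\,y^\ast)/\sqrt2$. Moreover, if $p\in[1,1+\alpha]$ then one can take $T_{\rm m}=+\infty$.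
   Context: **Lattice model.** Fix $\alpha>1$, real $(k_-,k_+)\ne(0,0)$ and $\beta,\gamma>0$. Let $V\in C^2(\mathbb R,\mathbb R)$, $V=V_\alpha+W$, where $V_\alpha(r)=\frac{k_-}{1+\alpha}|r|^{\alpha+1}$ for $r\le0$, $V_\alpha(r)=\frac{k_+}{1+\alpha}r^{\alpha+1}$ for $r\ge0$, and $W'(0)=0$, $W''(r)=O(|r|^{\alpha-1+\beta})$ as $r\to0$. Let $\phi\in C^2(\mathbb R,\mathbb R)$ with $\phi'(0)=0$, $\phi''(x)=O(|x|^{\alpha-1+\gamma})$ as $x\to0$. For sequences, $(\delta^+x)_n=x_{n+1}-x_n$, $(\delta^-x)_n=x_n-x_{n-1}$, and scalar functions act componentwise. Set $F(x)=\delta^+V'(\delta^-x)-\phi'(x)$. The lattice $\ddot x_n+x_n=F(x)_n$, $n\in\mathbb Z$, is written for $X=(x,\dot x)^T\in\ell_p^2=\ell_p(\mathbb Z,\mathbb R)^2$ as $\dot X=JX+G(X)$, with $J=\begin{pmatrix}0&\mathrm{Id}\\-\mathrm{Id}&0\end{pmatrix}$ and $G(X_1,X_2)=(0,F(X_1))^T$. Norms on $\ell_p^2$: for $X=(x,y)^T$, $\|X\|_p=\big(\sum_n(x_n^2+y_n^2)^{p/2}\big)^{1/p}$ if $p<\infty$, and $\|X\|_\infty=\sup_n(x_n^2+y_n^2)^{1/2}$. **Amplitude equation.** For $a\in\ell_p(\mathbb Z,\mathbb C)$, $(f(a))_n=\omega_0\,a_n|a_n|^{\alpha-1}$ with $$\omega_0=(k_-+k_+)\,2^{\frac{\alpha-3}{2}}\,\frac{\alpha\,\Gamma(\alpha/2)}{\sqrt\pi\,(\alpha+1)\,\Gamma((\alpha+1)/2)}.$$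 **Notation.** "c.c." is the complex conjugate of the preceding term; for $a\in\ell_p(\mathbb Z,\mathbb C)$ and $(z_1,z_2)^T\in\mathbb C^2$, $a\,(z_1,z_2)^T$ is the pair of sequences $(z_1a,z_2a)^T$. The constants may depend on $p$ and on the model data; part of the claim is that the solution $A$ exists on $[0,T\varepsilon^{1-\alpha}]$. *)

theory Defs
  imports "HOL-Analysis.Analysis" "HOL-Library.Landau_Symbols"
begin

section \<open>The sequence spaces \<open>\<ell>\<^sub>p(\<int>)\<close>\<close>

text \<open>
  The exponent is an extended real \<open>1 \<le> p \<le> \<infinity>\<close>. A pair of real sequences \<open>(x, y)\<close> in
  \<open>\<ell>\<^sub>p(\<int>, \<real>)\<^sup>2\<close> is represented by the single sequence \<open>n \<mapsto> (x\<^sub>n, y\<^sub>n)\<close> in \<open>\<real> \<times> \<real>\<close>. As the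
  norm of \<open>\<real> \<times> \<real>\<close> is the Euclidean one, \<open>lp_norm\<close> is then the norm
  \<open>(\<Sum>n. (x\<^sub>n\<^sup>2 + y\<^sub>n\<^sup>2) powr (p/2)) powr (1/p)\<close>, resp. \<open>sup\<^sub>n (x\<^sub>n\<^sup>2 + y\<^sub>n\<^sup>2) powr (1/2)\<close>.
\<close>

definition lp :: "ereal \<Rightarrow> (int \<Rightarrow> 'a::real_normed_vector) set" where
  "lp p = (if p = \<infinity> then {u. bounded (range u)}
           else {u. (\<lambda>n. norm (u n) powr real_of_ereal p) summable_on UNIV})"

definition lp_norm :: "ereal \<Rightarrow> (int \<Rightarrow> 'a::real_normed_vector) \<Rightarrow> real" where
  "lp_norm p u = (if p = \<infinity> then (SUP n. norm (u n))
     else (\<Sum>\<^sub>\<infinity>n. norm (u n) powr real_of_ereal p) powr (1 / real_of_ereal p))"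

text \<open>
  Differentiability and continuity of curves are meant in the norm of \<open>\<ell>\<^sub>p\<close>, not componentwise;
  at the end points of an interval \<open>S\<close> the derivative is one-sided.
\<close>

definition has_lp_derivative ::
  "ereal \<Rightarrow> (real \<Rightarrow> int \<Rightarrow> 'a::real_normed_vector) \<Rightarrow> (int \<Rightarrow> 'a) \<Rightarrow> real \<Rightarrow> real set \<Rightarrow> bool" where
  "has_lp_derivative p u v t S \<longleftrightarrow> (\<forall>s\<in>S. u s \<in> lp p) \<and> v \<in> lp p \<and>
     ((\<lambda>s. lp_norm p (\<lambda>n. (u s n - u t n) /\<^sub>R (s - t) - v n)) \<longlongrightarrow> 0) (at t within S)"

definition lp_continuous_on ::
  "ereal \<Rightarrow> real set \<Rightarrow> (real \<Rightarrow> int \<Rightarrow> 'a::real_normed_vector) \<Rightarrow> bool" where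
  "lp_continuous_on p S u \<longleftrightarrow> (\<forall>s\<in>S. u s \<in> lp p) \<and>
     (\<forall>t\<in>S. ((\<lambda>s. lp_norm p (\<lambda>n. u s n - u t n)) \<longlongrightarrow> 0) (at t within S))"

definition lp_C2_on ::
  "ereal \<Rightarrow> real set \<Rightarrow> (real \<Rightarrow> int \<Rightarrow> 'a::real_normed_vector) \<Rightarrow> bool" where
  "lp_C2_on p S u \<longleftrightarrow> (\<exists>u' u''. (\<forall>t\<in>S. has_lp_derivative p u (u' t) t S) \<and>
     (\<forall>t\<in>S. has_lp_derivative p u' (u'' t) t S) \<and> lp_continuous_on p S u'')"

definition solves_ivp ::
  "ereal \<Rightarrow> ((int \<Rightarrow> 'a::real_normed_vector) \<Rightarrow> int \<Rightarrow> 'a) \<Rightarrow> (int \<Rightarrow> 'a) \<Rightarrow> real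
     \<Rightarrow> (real \<Rightarrow> int \<Rightarrow> 'a) \<Rightarrow> bool" where
  "solves_ivp p \<Phi> u0 \<tau> u \<longleftrightarrow> u 0 = u0 \<and>
     (\<forall>t\<in>{0..\<tau>}. has_lp_derivative p u (\<Phi> (u t)) t {0..\<tau>})"

text \<open>
  ``The solution'' of the initial value problem, defined at least on \<open>[0, \<tau>]\<close>: every solution on a
  shorter interval \<open>[0, \<sigma>]\<close> is a restriction of it. Values of \<open>u\<close> outside \<open>[0, \<tau>]\<close> are irrelevant.
\<close>

definition is_the_solution ::
  "ereal \<Rightarrow> ((int \<Rightarrow> 'a::real_normed_vector) \<Rightarrow> int \<Rightarrow> 'a) \<Rightarrow> (int \<Rightarrow> 'a) \<Rightarrow> real
     \<Rightarrow> (real \<Rightarrow> int \<Rightarrow> 'a) \<Rightarrow> bool" where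
  "is_the_solution p \<Phi> u0 \<tau> u \<longleftrightarrow> solves_ivp p \<Phi> u0 \<tau> u \<and>
     (\<forall>\<sigma>\<in>{0..\<tau>}. \<forall>v. solves_ivp p \<Phi> u0 \<sigma> v \<longrightarrow> (\<forall>t\<in>{0..\<sigma>}. v t = u t))"


section \<open>The lattice\<close>

definition C2_real :: "(real \<Rightarrow> real) \<Rightarrow> bool" where
  "C2_real f \<longleftrightarrow> (\<forall>x. f field_differentiable at x) \<and> (\<forall>x. deriv f field_differentiable at x) \<and>
     continuous_on UNIV (deriv (deriv f))"

definition V_alpha :: "real \<Rightarrow> real \<Rightarrow> real \<Rightarrow> real \<Rightarrow> real" where
  "V_alpha \<alpha> km kp r = (if r \<le> 0 then km / (1 + \<alpha>) * \<bar>r\<bar> powr (\<alpha> + 1)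
                         else kp / (1 + \<alpha>) * r powr (\<alpha> + 1))"

definition delta_plus :: "(int \<Rightarrow> 'a::real_normed_vector) \<Rightarrow> int \<Rightarrow> 'a" where
  "delta_plus x n = x (n + 1) - x n"

definition delta_minus :: "(int \<Rightarrow> 'a::real_normed_vector) \<Rightarrow> int \<Rightarrow> 'a" where
  "delta_minus x n = x n - x (n - 1)"

definition lattice_F :: "(real \<Rightarrow> real) \<Rightarrow> (real \<Rightarrow> real) \<Rightarrow> (int \<Rightarrow> real) \<Rightarrow> int \<Rightarrow> real" where
  "lattice_F V \<phi> x n = delta_plus (\<lambda>m. deriv V (delta_minus x m)) n - deriv \<phi> (x n)"

definition lattice_J :: "(int \<Rightarrow> real \<times> real) \<Rightarrow> int \<Rightarrow> real \<times> real" where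
  "lattice_J X n = (snd (X n), - fst (X n))"

definition lattice_G ::
  "(real \<Rightarrow> real) \<Rightarrow> (real \<Rightarrow> real) \<Rightarrow> (int \<Rightarrow> real \<times> real) \<Rightarrow> int \<Rightarrow> real \<times> real" where
  "lattice_G V \<phi> X n = (0, lattice_F V \<phi> (\<lambda>m. fst (X m)) n)"

definition lattice_field ::
  "(real \<Rightarrow> real) \<Rightarrow> (real \<Rightarrow> real) \<Rightarrow> (int \<Rightarrow> real \<times> real) \<Rightarrow> int \<Rightarrow> real \<times> real" where
  "lattice_field V \<phi> X n = lattice_J X n + lattice_G V \<phi> X n"


section \<open>The amplitude equation\<close>

definition omega0 :: "real \<Rightarrow> real \<Rightarrow> real \<Rightarrow> real" where
  "omega0 \<alpha> km kp = (km + kp) * 2 powr ((\<alpha> - 3) / 2) *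
     (\<alpha> * Gamma (\<alpha> / 2) / (sqrt pi * (\<alpha> + 1) * Gamma ((\<alpha> + 1) / 2)))"

definition amplitude_f :: "real \<Rightarrow> real \<Rightarrow> real \<Rightarrow> (int \<Rightarrow> complex) \<Rightarrow> int \<Rightarrow> complex" where
  "amplitude_f \<alpha> km kp a n =
     complex_of_real (omega0 \<alpha> km kp) * a n * complex_of_real (norm (a n) powr (\<alpha> - 1))"

text \<open>The right-hand side of \<open>\<i> A' = \<delta>\<^sup>+ f(\<delta>\<^sup>- A)\<close> solved for \<open>A'\<close>.\<close>

definition amplitude_field :: "real \<Rightarrow> real \<Rightarrow> real \<Rightarrow> (int \<Rightarrow> complex) \<Rightarrow> int \<Rightarrow> complex" where
  "amplitude_field \<alpha> km kp a n = delta_plus (amplitude_f \<alpha> km kp (delta_minus a)) n / \<i>"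

definition amplitude_init :: "(int \<Rightarrow> real \<times> real) \<Rightarrow> int \<Rightarrow> complex" where
  "amplitude_init X n =
     (complex_of_real (fst (X n)) - \<i> * complex_of_real (snd (X n))) / complex_of_real (sqrt 2)"

text \<open>
  \<open>X\<^sub>A\<close>. Both components \<open>z + cnj z\<close> are real complex numbers; \<open>Re\<close> only changes their type.
\<close>

definition X_ansatz :: "(real \<Rightarrow> int \<Rightarrow> complex) \<Rightarrow> real \<Rightarrow> int \<Rightarrow> real \<times> real" where
  "X_ansatz A t n =
     (let z = 1 / complex_of_real (sqrt 2) * A t n * exp (\<i> * complex_of_real t)
      in (Re (z * 1 + cnj (z * 1)), Re (z * \<i> + cnj (z * \<i>))))"

end

theory Submission
  imports Defs
begin

text \<open>
  Write \<open>x\<^sub>n = \<surd>2 Re (a\<^sub>n e\<^sup>i\<^sup>t)\<close>, \<open>x\<^sub>n' = -\<surd>2 Im (a\<^sub>n e\<^sup>i\<^sup>t)\<close>. In the coordinates \<open>a\<close> the linear part of the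
  lattice disappears and the lattice reads \<open>a' = N(t, a)\<close>, where \<open>N\<close> consists of the contribution of
  \<open>V\<^sub>\<alpha>\<close>, which is \<open>2\<pi>\<close>-periodic in \<open>t\<close> and positively homogeneous of degree \<open>\<alpha>\<close>, and of contributions of \<open>W\<close> and
  \<open>\<phi>\<close> of higher order. The mean value of the periodic part over a period is the right-hand side of
  the amplitude equation (\<open>has_integral_averaged_oscillation\<close>; the constant \<open>\<omega>\<^sub>0\<close> is a Beta integral).
  The theorem is thus an averaging theorem on the time scale \<open>\<epsilon>\<^sup>1\<^sup>-\<^sup>\<alpha>\<close>, with three sources of error:

  \<^item> The difference of the two initial data is \<open>O(\<epsilon>\<^sup>1\<^sup>+\<^sup>\<eta>)\<close> by assumption.
  \<^item> The forces of \<open>W\<close> and \<open>\<phi>\<close> have size \<open>\<epsilon>\<close> to the power \<open>\<alpha> + min \<beta> \<gamma>\<close>; integrated over the time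
    \<open>\<epsilon>\<^sup>1\<^sup>-\<^sup>\<alpha>\<close> they contribute \<open>\<epsilon>\<close> to the power \<open>1 + min \<beta> \<gamma>\<close>.
  \<^item> The oscillating remainder has mean zero over each period as long as \<open>A\<close> is frozen. Since \<open>A\<close> moves by
    \<open>O(\<epsilon>\<^sup>\<alpha>)\<close> in a period, a period contributes \<open>O(\<epsilon>\<^sup>2\<^sup>\<alpha>\<^sup>-\<^sup>1)\<close>; the number of periods is \<open>O(\<epsilon>\<^sup>1\<^sup>-\<^sup>\<alpha>)\<close>,
    and the total is \<open>O(\<epsilon>\<^sup>\<alpha>)\<close> (\<open>lp_le_averaging\<close>).

  The nonlinearity has Lipschitz constant \<open>O(\<epsilon>\<^sup>\<alpha>\<^sup>-\<^sup>1)\<close> on sequences of size \<open>O(\<epsilon>)\<close>, so Gronwall's lemma multiplies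
  the sum of the errors by a constant only (\<open>amplitude_approximation\<close>).

  All nonlinearities are cut off at a multiple of \<open>\<epsilon>\<close>. The resulting fields are globally Lipschitz, hence Picard
  iteration gives solutions on the whole time interval, and the a priori bounds show afterwards that
  the cutoff is never active. For the amplitude equation such a bound is an exponential one which forces \<open>T\<close> to be
  small. If \<open>p \<le> 1 + \<alpha>\<close>, however, \<open>\<ell>\<^sub>p\<close> is contained in \<open>\<ell>\<^sub>1\<^sub>+\<^sub>\<alpha>\<close>, where the energy \<open>\<Sum>\<^sub>n |A\<^sub>n - A\<^sub>n\<^sub>-\<^sub>1|\<^sup>1\<^sup>+\<^sup>\<alpha>\<close> is
  conserved; it controls the supremum of the differences for all times (\<open>energy_bound\<close>), and \<open>T\<close> is
  arbitrary.

  As \<open>p\<close> is a variable of the statement, \<open>\<ell>\<^sub>p\<close> is a set of sequences rather than a type of class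
  \<open>banach\<close>. Integration is therefore done componentwise, and Minkowski's inequality for integrals (\<open>lp_le_integral\<close>) turns the results into statements about the norm.
\<close>

section \<open>The norms of sequences, by upper bounds\<close>

text \<open>
  Membership and an upper bound in one predicate: \<open>lp_norm\<close> has no meaning outside \<open>lp p\<close>, and all estimates below are
  upper bounds. The elementary properties of this predicate hide the difference between \<open>p = \<infinity>\<close> and \<open>p < \<infinity>\<close>
  from the analysis built on them.
\<close>

definition lp_le :: "ereal \<Rightarrow> (int \<Rightarrow> 'a::real_normed_vector) \<Rightarrow> real \<Rightarrow> bool" where
  "lp_le p u M \<longleftrightarrow> u \<in> lp p \<and> lp_norm p u \<le> M"

lemma lp_exponent_cases:
  assumes "1 \<le> (p::ereal)"
  obtains "p = \<infinity>" | q where "p = ereal q" "1 \<le> q"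
  using assms by (cases p) auto

lemma lp_norm_nonneg: "1 \<le> p \<Longrightarrow> 0 \<le> lp_norm p u" if "u \<in> lp p" for u :: "int \<Rightarrow> 'a::real_normed_vector"
proof (cases "p = \<infinity>")
  case True
  then have "bdd_above (range (\<lambda>n. norm (u n)))"
    using that by (auto simp: lp_def bounded_iff bdd_above_def)
  then have "norm (u 0) \<le> (SUP n. norm (u n))"
    by (rule cSUP_upper[OF UNIV_I])
  then show ?thesis using True by (simp add: lp_norm_def order_trans[OF norm_ge_zero])
qed (simp add: lp_norm_def)

lemma lp_le_nonneg: "1 \<le> p \<Longrightarrow> lp_le p u M \<Longrightarrow> 0 \<le> M"
  using lp_norm_nonneg[of u p] by (simp add: lp_le_def)

lemma lp_le_lp_norm: "u \<in> lp p \<Longrightarrow> lp_le p u (lp_norm p u)"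
  by (simp add: lp_le_def)

lemma lp_le_mono: "lp_le p u M \<Longrightarrow> M \<le> N \<Longrightarrow> lp_le p u N"
  by (simp add: lp_le_def)

lemma lp_le_epsilon: "(\<And>e. e > 0 \<Longrightarrow> lp_le p u (M + e)) \<Longrightarrow> lp_le p u M"
  unfolding lp_le_def by (metis field_le_epsilon zero_less_one)

lemma lp_le_infinity_iff: "lp_le \<infinity> u M \<longleftrightarrow> (\<forall>n. norm (u n) \<le> M)"
proof
  assume *: "lp_le \<infinity> u M"
  then have "bdd_above (range (\<lambda>n. norm (u n)))"
    by (auto simp: lp_le_def lp_def bounded_iff bdd_above_def)
  then have "norm (u n) \<le> (SUP n. norm (u n))" for n
    by (rule cSUP_upper[OF UNIV_I])
  with * show "\<forall>n. norm (u n) \<le> M"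
    by (auto simp: lp_le_def lp_norm_def intro: order_trans)
next
  assume *: "\<forall>n. norm (u n) \<le> M"
  then have "(SUP n. norm (u n)) \<le> M" by (intro cSUP_least) auto
  with * show "lp_le \<infinity> u M"
    by (auto simp: lp_le_def lp_norm_def lp_def bounded_iff)
qed

text \<open>
  Finite partial sums characterise the bound, so that summability never has to be argued separately
  and limits and integrals can be exchanged with sums.
\<close>

lemma lp_le_finite_iff:
  assumes q: "1 \<le> q" and M: "0 \<le> M"
  shows "lp_le (ereal q) u M \<longleftrightarrow> (\<forall>S. finite S \<longrightarrow> (\<Sum>n\<in>S. norm (u n) powr q) \<le> M powr q)"
proof
  assume *: "lp_le (ereal q) u M"
  let ?f = "\<lambda>n. norm (u n) powr q"
  have s: "?f summable_on UNIV" and n: "(\<Sum>\<^sub>\<infinity>n. ?f n) powr (1 / q) \<le> M"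
    using * by (auto simp: lp_le_def lp_norm_def lp_def)
  have "(\<Sum>\<^sub>\<infinity>n. ?f n) \<ge> 0" by (intro infsum_nonneg) auto
  then have "(\<Sum>\<^sub>\<infinity>n. ?f n) = ((\<Sum>\<^sub>\<infinity>n. ?f n) powr (1 / q)) powr q"
    using q by (simp add: powr_powr)
  also have "\<dots> \<le> M powr q" using n q by (intro powr_mono2) auto
  finally have le: "(\<Sum>\<^sub>\<infinity>n. ?f n) \<le> M powr q" .
  show "\<forall>S. finite S \<longrightarrow> (\<Sum>n\<in>S. ?f n) \<le> M powr q"
    using finite_sum_le_infsum[OF s] le by (auto intro: order_trans)
next
  assume *: "\<forall>S. finite S \<longrightarrow> (\<Sum>n\<in>S. norm (u n) powr q) \<le> M powr q"
  let ?f = "\<lambda>n. norm (u n) powr q"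
  have s: "?f summable_on UNIV"
    by (intro nonneg_bdd_above_summable_on) (use * in \<open>auto simp: bdd_above_def\<close>)
  have "(\<Sum>\<^sub>\<infinity>n. ?f n) \<le> M powr q"
    by (rule infsum_le_finite_sums[OF s]) (use * in auto)
  then have "(\<Sum>\<^sub>\<infinity>n. ?f n) powr (1 / q) \<le> (M powr q) powr (1 / q)"
    using q by (intro powr_mono2 infsum_nonneg) auto
  also have "\<dots> = M" using q M by (simp add: powr_powr)
  finally show "lp_le (ereal q) u M"
    using s by (simp add: lp_le_def lp_norm_def lp_def)
qed

lemma lp_le_dominated:
  fixes u :: "int \<Rightarrow> 'a::real_normed_vector" and v :: "int \<Rightarrow> 'b::real_normed_vector"
  assumes p: "1 \<le> p" and v: "lp_le p v M" and le: "\<And>n. norm (u n) \<le> norm (v n)"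
  shows "lp_le p u M"
proof -
  have M: "0 \<le> M" using lp_le_nonneg[OF p v] .
  from p show ?thesis
  proof (cases rule: lp_exponent_cases)
    case 1
    then show ?thesis using v le by (auto simp: lp_le_infinity_iff intro: order_trans)
  next
    case (2 q)
    have "(\<Sum>n\<in>S. norm (u n) powr q) \<le> (\<Sum>n\<in>S. norm (v n) powr q)" for S
      using 2 le by (intro sum_mono powr_mono2) auto
    then show ?thesis using v M 2 by (auto simp: lp_le_finite_iff intro: order_trans)
  qed
qed

lemma lp_le_shift:
  assumes p: "1 \<le> p" and u: "lp_le p u M"
  shows "lp_le p (\<lambda>n. u (n + k)) M"
proof -
  have M: "0 \<le> M" using lp_le_nonneg[OF p u] .
  from p show ?thesis
  proof (cases rule: lp_exponent_cases)
    case 1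
    then show ?thesis using u by (auto simp: lp_le_infinity_iff)
  next
    case (2 q)
    have "(\<Sum>n\<in>S. norm (u (n + k)) powr q) = (\<Sum>n\<in>(\<lambda>n. n + k) ` S. norm (u n) powr q)" for S
      by (subst sum.reindex) auto
    then show ?thesis using u M 2 by (auto simp: lp_le_finite_iff)
  qed
qed

lemma lp_le_component:
  assumes p: "1 \<le> p" and u: "lp_le p u M"
  shows "norm (u n) \<le> M"
proof -
  have M: "0 \<le> M" using lp_le_nonneg[OF p u] .
  from p show ?thesis
  proof (cases rule: lp_exponent_cases)
    case 1
    then show ?thesis using u by (auto simp: lp_le_infinity_iff)
  next
    case (2 q)
    then have "norm (u n) powr q \<le> M powr q"
      using u M lp_le_finite_iff[of q M u] by (auto dest: spec[of _ "{n}"])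
    then show ?thesis using 2 M powr_less_mono2[of q M "norm (u n)"] by fastforce
  qed
qed

text \<open>
  A convex function lies above its tangent at \<open>m\<close>. Averaging this inequality with \<open>m\<close> the mean of \<open>y\<close> makes the
  linear term vanish; Minkowski's inequality follows in this way for two summands as well as for integrals.
\<close>

lemma powr_above_tangent:
  fixes y m q :: real
  assumes "1 \<le> q" "0 \<le> y" "0 \<le> m"
  shows "m powr q + q * m powr (q - 1) * (y - m) \<le> y powr q"
proof (cases "q = 1 \<or> m = 0")
  case True
  then show ?thesis using assms by (cases "m = 0") auto
next
  case False
  with assms have q: "q > 1" and m: "m > 0" by auto
  define r where "r = q / (q - 1)"
  have "y * m powr (q - 1) \<le> y powr q / q + (m powr (q - 1)) powr r / r"
    using q m assms by (intro Youngs_inequality) (auto simp: r_def field_simps)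
  also have "(m powr (q - 1)) powr r = m powr q"
    using q by (simp add: powr_powr r_def)
  also have "m powr q / r = m powr q * (q - 1) / q"
    by (simp add: r_def)
  finally have "q * (y * m powr (q - 1)) \<le> y powr q + m powr q * (q - 1)"
    using q by (simp add: field_simps)
  moreover have "m powr (q - 1) * m = m powr q"
    using m by (simp add: powr_diff)
  ultimately show ?thesis
    by (simp add: algebra_simps)
qed

lemma lp_le_add:
  fixes u v :: "int \<Rightarrow> 'a::real_normed_vector"
  assumes p: "1 \<le> p" and u: "lp_le p u M" and v: "lp_le p v N"
  shows "lp_le p (\<lambda>n. u n + v n) (M + N)"
proof -
  have pos: "lp_le p (\<lambda>n. u n + v n) (M + N)"
    if M: "0 < M" and N: "0 < N" and u: "lp_le p u M" and v: "lp_le p v N" for M N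
    using p
  proof (cases rule: lp_exponent_cases)
    case 1
    then show ?thesis using u v
      by (auto simp: lp_le_infinity_iff intro: norm_triangle_le add_mono)
  next
    case (2 q)
    have conv: "((x + y) / (M + N)) powr q \<le> (M / (M + N)) * (x / M) powr q + (N / (M + N)) * (y / N) powr q"
      if "0 \<le> x" "0 \<le> y" for x y
    proof -
      define m where "m = (x + y) / (M + N)"
      have m0: "0 \<le> m" using that M N by (simp add: m_def)
      have a: "M / (M + N) * (m powr q + q * m powr (q - 1) * (x / M - m)) \<le> M / (M + N) * (x / M) powr q"
        using powr_above_tangent[of q "x / M" m] that M N m0 2 by (intro mult_left_mono) auto
      have b: "N / (M + N) * (m powr q + q * m powr (q - 1) * (y / N - m)) \<le> N / (M + N) * (y / N) powr q"
        using powr_above_tangent[of q "y / N" m] that M N m0 2 by (intro mult_left_mono) auto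
      have s: "M / (M + N) + N / (M + N) = 1" using M N by (simp add: add_divide_distrib[symmetric])
      have "M / (M + N) * (x / M - m) + N / (M + N) * (y / N - m)
          = (M / (M + N) * (x / M) + N / (M + N) * (y / N)) - (M / (M + N) + N / (M + N)) * m"
        by (simp only: algebra_simps)
      also have "M / (M + N) * (x / M) + N / (M + N) * (y / N) = (x + y) / (M + N)"
        using M N by (simp add: add_divide_distrib)
      also have "(x + y) / (M + N) - (M / (M + N) + N / (M + N)) * m = (x + y) / (M + N) - m"
        by (simp only: s mult_1)
      also have "\<dots> = 0" by (simp add: m_def)
      finally have z: "M / (M + N) * (x / M - m) + N / (M + N) * (y / N - m) = 0" .
      have comb: "l * (P + Q * a) + k * (P + Q * b) = (l + k) * P + Q * (l * a + k * b)"
        for l k P Q a b :: real by (simp add: algebra_simps)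
      have "M / (M + N) * (m powr q + q * m powr (q - 1) * (x / M - m))
          + N / (M + N) * (m powr q + q * m powr (q - 1) * (y / N - m))
        = (M / (M + N) + N / (M + N)) * m powr q
          + q * m powr (q - 1) * (M / (M + N) * (x / M - m) + N / (M + N) * (y / N - m))"
        by (rule comb)
      also have "\<dots> = m powr q" by (simp only: s z)
      finally show ?thesis using a b by (simp add: m_def)
    qed
    have "(\<Sum>n\<in>S. norm (u n + v n) powr q) \<le> (M + N) powr q" if S: "finite S" for S
    proof -
      have U: "(\<Sum>n\<in>S. norm (u n) powr q) \<le> M powr q" and V: "(\<Sum>n\<in>S. norm (v n) powr q) \<le> N powr q"
        using u v S 2 M N by (auto simp: lp_le_finite_iff)
      have "(\<Sum>n\<in>S. norm (u n + v n) powr q)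
          \<le> (\<Sum>n\<in>S. (M + N) powr q * ((norm (u n) + norm (v n)) / (M + N)) powr q)"
        using 2 M N by (intro sum_mono) (auto simp: powr_divide intro!: powr_mono2 norm_triangle_ineq)
      also have "\<dots> \<le> (\<Sum>n\<in>S. (M + N) powr q *
          ((M / (M + N)) * (norm (u n) / M) powr q + (N / (M + N)) * (norm (v n) / N) powr q))"
        by (intro sum_mono mult_left_mono conv) auto
      also have "\<dots> = (M + N) powr q * ((M / (M + N)) * ((\<Sum>n\<in>S. norm (u n) powr q) / M powr q)
          + (N / (M + N)) * ((\<Sum>n\<in>S. norm (v n) powr q) / N powr q))"
        using M N by (simp add: sum_distrib_left sum_divide_distrib powr_divide sum.distrib algebra_simps)
      also have "\<dots> \<le> (M + N) powr q * ((M / (M + N)) * 1 + (N / (M + N)) * 1)"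
        using M N U V by (intro mult_left_mono add_mono) auto
      also have "\<dots> = (M + N) powr q"
        using M N by (simp add: add_divide_distrib[symmetric])
      finally show ?thesis .
    qed
    then show ?thesis using 2 M N by (auto simp: lp_le_finite_iff)
  qed
  have M: "0 \<le> M" and N: "0 \<le> N" using lp_le_nonneg[OF p] u v by auto
  show ?thesis
  proof (rule lp_le_epsilon)
    fix e :: real assume e: "e > 0"
    have "lp_le p (\<lambda>n. u n + v n) ((M + e / 2) + (N + e / 2))"
      using M N e by (intro pos lp_le_mono[OF u] lp_le_mono[OF v]) auto
    then show "lp_le p (\<lambda>n. u n + v n) (M + N + e)" by (simp add: algebra_simps)
  qed
qed

lemma lp_le_cmult:
  fixes u :: "int \<Rightarrow> 'a::real_normed_vector"
  assumes p: "1 \<le> p" and u: "lp_le p u M" and le: "\<And>n. norm (w n) \<le> c * norm (u n)" and c: "0 \<le> c"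
  shows "lp_le p w (c * M)"
proof -
  have M: "0 \<le> M" using lp_le_nonneg[OF p u] .
  from p show ?thesis
  proof (cases rule: lp_exponent_cases)
    case 1
    then have "c * norm (u n) \<le> c * M" for n using u c by (auto simp: lp_le_infinity_iff intro: mult_left_mono)
    then show ?thesis using 1 le by (auto simp: lp_le_infinity_iff intro: order_trans)
  next
    case (2 q)
    have "(\<Sum>n\<in>S. norm (w n) powr q) \<le> (c * M) powr q" if "finite S" for S
    proof -
      have "(\<Sum>n\<in>S. norm (w n) powr q) \<le> (\<Sum>n\<in>S. c powr q * norm (u n) powr q)"
        using 2 le c by (intro sum_mono) (auto simp: powr_mult[symmetric] intro!: powr_mono2)
      also have "\<dots> = c powr q * (\<Sum>n\<in>S. norm (u n) powr q)" by (simp add: sum_distrib_left)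
      also have "\<dots> \<le> c powr q * M powr q"
        using u that 2 M by (intro mult_left_mono) (auto simp: lp_le_finite_iff)
      finally show ?thesis using c M by (simp add: powr_mult)
    qed
    then show ?thesis using 2 M c by (auto simp: lp_le_finite_iff)
  qed
qed

lemma lp_le_scaleR:
  "1 \<le> p \<Longrightarrow> lp_le p u M \<Longrightarrow> lp_le p (\<lambda>n. c *\<^sub>R u n) (\<bar>c\<bar> * M)"
  by (rule lp_le_cmult[where u = u]) auto

lemma lp_le_diff:
  fixes u v :: "int \<Rightarrow> 'a::real_normed_vector"
  assumes p: "1 \<le> p" and u: "lp_le p u M" and v: "lp_le p v N"
  shows "lp_le p (\<lambda>n. u n - v n) (M + N)"
  using lp_le_add[OF p u lp_le_dominated[OF p v, of "\<lambda>n. - v n"]] by simp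

lemma lp_le_minus_commute:
  fixes u v :: "int \<Rightarrow> 'a::real_normed_vector"
  shows "1 \<le> p \<Longrightarrow> lp_le p (\<lambda>n. u n - v n) M \<Longrightarrow> lp_le p (\<lambda>n. v n - u n) M"
  by (erule lp_le_dominated) (auto simp: norm_minus_commute)

text \<open>
  Both evolution equations couple a site to its two neighbours only. Shifts are isometries of \<open>\<ell>\<^sub>p\<close>, whence
  the same pointwise estimate serves every \<open>p\<close>.
\<close>

lemma lp_le_nearest_neighbour:
  fixes d :: "int \<Rightarrow> 'a::real_normed_vector" and w :: "int \<Rightarrow> 'b::real_normed_vector"
  assumes p: "1 \<le> p" and d: "lp_le p d M" and c: "0 \<le> c"
    and le: "\<And>n. norm (w n) \<le> c * (norm (d (n - 1)) + norm (d n) + norm (d (n + 1)))"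
  shows "lp_le p w (3 * c * M)"
proof -
  have N: "lp_le p (\<lambda>n. norm (d n)) M" by (rule lp_le_dominated[OF p d]) auto
  have "lp_le p (\<lambda>n. norm (d (n - 1)) + norm (d n) + norm (d (n + 1))) (M + M + M)"
    using lp_le_add[OF p lp_le_add[OF p lp_le_shift[OF p N, of "-1"] N] lp_le_shift[OF p N, of 1]] by simp
  from lp_le_cmult[OF p this, of w c] le c show ?thesis by (simp add: algebra_simps)
qed

lemma lp_le_limit:
  assumes p: "1 \<le> p" and u: "\<And>k::nat. lp_le p (u k) M" and lim: "\<And>n. (\<lambda>k. u k n) \<longlonglongrightarrow> v n"
  shows "lp_le p v M"
proof -
  have M: "0 \<le> M" using lp_le_nonneg[OF p u] .
  from p show ?thesis
  proof (cases rule: lp_exponent_cases)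
    case 1
    then have "norm (v n) \<le> M" for n using u
      by (intro Lim_bounded[OF tendsto_norm[OF lim]]) (auto simp: lp_le_infinity_iff)
    then show ?thesis using 1 by (auto simp: lp_le_infinity_iff)
  next
    case (2 q)
    have "(\<Sum>n\<in>S. norm (v n) powr q) \<le> M powr q" if "finite S" for S
    proof (rule Lim_bounded)
      show "(\<lambda>k. \<Sum>n\<in>S. norm (u k n) powr q) \<longlonglongrightarrow> (\<Sum>n\<in>S. norm (v n) powr q)"
        using 2 by (intro tendsto_sum tendsto_powr2 tendsto_norm lim tendsto_const) auto
      show "\<forall>k\<ge>0. (\<Sum>n\<in>S. norm (u k n) powr q) \<le> M powr q"
        using u M 2 that by (auto simp: lp_le_finite_iff)
    qed
    then show ?thesis using 2 M by (auto simp: lp_le_finite_iff)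
  qed
qed

text \<open>
  Minkowski's inequality for integrals with a continuous majorant \<open>g\<close> of the norms, whose measurability is thus
  not in question. For \<open>p < \<infinity>\<close> it is Jensen's inequality with respect to the weight \<open>g / \<integral>g\<close>, summed over the sites:
  \<open>|\<integral>v\<^sub>n|\<^sup>p \<le> (\<integral>g)\<^sup>p\<^sup>-\<^sup>1 \<integral>|v\<^sub>n / g|\<^sup>p g\<close>, and \<open>\<Sum>\<^sub>n |v\<^sub>n|\<^sup>p \<le> g\<^sup>p\<close>.
\<close>

lemma lp_le_integral:
  fixes v :: "real \<Rightarrow> int \<Rightarrow> 'a::euclidean_space"
  assumes p: "1 \<le> p" and ab: "a \<le> b"
    and cont: "\<And>n. continuous_on {a..b} (\<lambda>s. v s n)"
    and g: "continuous_on {a..b} g"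
    and le: "\<And>s. s \<in> {a..b} \<Longrightarrow> lp_le p (v s) (g s)"
  shows "lp_le p (\<lambda>n. integral {a..b} (\<lambda>s. v s n)) (integral {a..b} g)"
proof -
  have pos: "lp_le p (\<lambda>n. integral {a..b} (\<lambda>s. v s n)) (integral {a..b} g)"
    if g: "continuous_on {a..b} g" and g0: "\<And>s. s \<in> {a..b} \<Longrightarrow> 0 < g s" and ab: "a < b"
      and le: "\<And>s. s \<in> {a..b} \<Longrightarrow> lp_le p (v s) (g s)" for g
    using p
  proof (cases rule: lp_exponent_cases)
    case 1
    have "norm (integral {a..b} (\<lambda>s. v s n)) \<le> integral {a..b} g" for n
      using le 1 by (intro integral_norm_bound_integral integrable_continuous_real cont g)
          (auto simp: lp_le_infinity_iff)
    then show ?thesis using 1 by (auto simp: lp_le_infinity_iff)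
  next
    case (2 q)
    define G where "G = integral {a..b} g"
    have gi: "g integrable_on {a..b}" using g by (rule integrable_continuous_real)
    have G: "0 < G"
    proof -
      obtain x where x: "x \<in> {a..b}" "\<And>y. y \<in> {a..b} \<Longrightarrow> g x \<le> g y"
        using continuous_attains_inf[of "{a..b}" g] g ab by auto
      have "integral {a..b} (\<lambda>_. g x) \<le> G" unfolding G_def
        using x gi by (intro integral_le) auto
      moreover have "0 < (b - a) * g x" using ab g0[OF x(1)] by simp
      ultimately show ?thesis using ab by simp
    qed
    have ci: "continuous_on {a..b} (\<lambda>s. (norm (v s n) / g s) powr q * g s)" for n
      using g0 2 by (intro continuous_intros cont g continuous_on_powr') (auto simp: less_imp_neq dest: g0)
    have ii: "(\<lambda>s. (norm (v s n) / g s) powr q * g s) integrable_on {a..b}" for n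
      using ci by (rule integrable_continuous_real)
    have one: "norm (integral {a..b} (\<lambda>s. v s n)) powr q
        \<le> G powr (q - 1) * integral {a..b} (\<lambda>s. (norm (v s n) / g s) powr q * g s)" for n
    proof -
      define J where "J = integral {a..b} (\<lambda>s. norm (v s n))"
      define m where "m = J / G"
      have nvi: "(\<lambda>s. norm (v s n)) integrable_on {a..b}"
        by (intro integrable_continuous_real continuous_intros cont)
      have mgi: "(\<lambda>s. m * g s) integrable_on {a..b}"
        by (intro integrable_continuous_real continuous_intros g)
      have J0: "0 \<le> J" unfolding J_def by (intro integral_nonneg nvi) auto
      have m0: "0 \<le> m" using J0 G by (simp add: m_def)
      have "integral {a..b} (\<lambda>s. m powr q * g s + q * m powr (q - 1) * (norm (v s n) - m * g s))
          \<le> integral {a..b} (\<lambda>s. (norm (v s n) / g s) powr q * g s)"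
      proof (rule integral_le)
        show "(\<lambda>s. m powr q * g s + q * m powr (q - 1) * (norm (v s n) - m * g s)) integrable_on {a..b}"
          by (intro integrable_continuous_real continuous_intros cont g)
        fix s assume s: "s \<in> {a..b}"
        have "(m powr q + q * m powr (q - 1) * (norm (v s n) / g s - m)) * g s
            \<le> (norm (v s n) / g s) powr q * g s"
          using g0[OF s] 2 m0 by (intro mult_right_mono powr_above_tangent) auto
        then show "m powr q * g s + q * m powr (q - 1) * (norm (v s n) - m * g s)
            \<le> (norm (v s n) / g s) powr q * g s"
          using g0[OF s] by (simp add: algebra_simps)
      qed (rule ii)
      also have "integral {a..b} (\<lambda>s. m powr q * g s + q * m powr (q - 1) * (norm (v s n) - m * g s))
          = m powr q * G + q * m powr (q - 1) * (J - m * G)"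
        unfolding G_def J_def
        by (subst integral_add, (intro integrable_continuous_real continuous_intros cont g)+)
          (simp add: integral_diff gi nvi mgi)
      finally have *: "m powr q * G \<le> integral {a..b} (\<lambda>s. (norm (v s n) / g s) powr q * g s)"
        using G by (simp add: m_def)
      have "norm (integral {a..b} (\<lambda>s. v s n)) \<le> J" unfolding J_def
        by (intro integral_norm_bound_integral integrable_continuous_real continuous_intros cont nvi) auto
      then have "norm (integral {a..b} (\<lambda>s. v s n)) powr q \<le> J powr q"
        using 2 by (intro powr_mono2) auto
      also have "J powr q = G powr (q - 1) * (m powr q * G)"
        using G J0 by (simp add: m_def powr_divide powr_diff)
      also have "\<dots> \<le> G powr (q - 1) * integral {a..b} (\<lambda>s. (norm (v s n) / g s) powr q * g s)"
        using * by (intro mult_left_mono) auto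
      finally show ?thesis .
    qed
    have "(\<Sum>n\<in>S. norm (integral {a..b} (\<lambda>s. v s n)) powr q) \<le> G powr q" if S: "finite S" for S
    proof -
      have "(\<Sum>n\<in>S. norm (integral {a..b} (\<lambda>s. v s n)) powr q)
          \<le> (\<Sum>n\<in>S. G powr (q - 1) * integral {a..b} (\<lambda>s. (norm (v s n) / g s) powr q * g s))"
        by (intro sum_mono one)
      also have "\<dots> = G powr (q - 1) * integral {a..b} (\<lambda>s. \<Sum>n\<in>S. (norm (v s n) / g s) powr q * g s)"
        using S by (simp add: sum_distrib_left[symmetric] integral_sum ii)
      also have "\<dots> \<le> G powr (q - 1) * integral {a..b} g"
      proof (intro mult_left_mono integral_le gi)
        show "(\<lambda>s. \<Sum>n\<in>S. (norm (v s n) / g s) powr q * g s) integrable_on {a..b}"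
          using S by (intro integrable_sum ii)
        fix s assume s: "s \<in> {a..b}"
        have "(\<Sum>n\<in>S. norm (v s n) powr q) \<le> g s powr q"
          using le[OF s] 2 S g0[OF s] by (auto simp: lp_le_finite_iff)
        then have "(\<Sum>n\<in>S. (norm (v s n) / g s) powr q) \<le> 1"
          using g0[OF s] by (simp add: powr_divide sum_divide_distrib[symmetric])
        then have "(\<Sum>n\<in>S. (norm (v s n) / g s) powr q) * g s \<le> 1 * g s"
          using g0[OF s] by (intro mult_right_mono) auto
        then show "(\<Sum>n\<in>S. (norm (v s n) / g s) powr q * g s) \<le> g s"
          by (simp add: sum_distrib_right)
      qed auto
      also have "\<dots> = G powr q" using G by (simp add: G_def[symmetric] powr_diff)
      finally show ?thesis .
    qed
    then show ?thesis using 2 G by (auto simp: lp_le_finite_iff G_def)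
  qed
  have g0: "0 \<le> g s" if "s \<in> {a..b}" for s
    using lp_le_nonneg[OF p le[OF that]] .
  show ?thesis
  proof (cases "a < b")
    case True
    show ?thesis
    proof (rule lp_le_epsilon)
      fix e :: real assume e: "e > 0"
      define d where "d = e / (b - a)"
      have d: "d > 0" using e True by (simp add: d_def)
      have "lp_le p (\<lambda>n. integral {a..b} (\<lambda>s. v s n)) (integral {a..b} (\<lambda>s. g s + d))"
        using d by (intro pos True continuous_intros g) (auto intro!: add_nonneg_pos g0 intro: lp_le_mono[OF le])
      also have "integral {a..b} (\<lambda>s. g s + d) = integral {a..b} g + e"
        using True g by (subst integral_add) (auto simp: d_def integrable_continuous_real)
      finally show "lp_le p (\<lambda>n. integral {a..b} (\<lambda>s. v s n)) (integral {a..b} g + e)" .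
    qed
  next
    case False
    with ab have "a = b" by simp
    have "lp_le p (\<lambda>n. 0 *\<^sub>R v a n) (\<bar>0\<bar> * g a)"
      using ab by (intro lp_le_scaleR p le) auto
    then show ?thesis using \<open>a = b\<close> by simp
  qed
qed

section \<open>Calculus for curves of sequences\<close>

lemma lp_0: "1 \<le> p \<Longrightarrow> lp_le p (\<lambda>n. 0) 0"
  by (erule lp_exponent_cases) (auto simp: lp_le_infinity_iff lp_le_finite_iff)

lemma lp_le_bound_limit: "(\<And>k::nat. lp_le p u (M k)) \<Longrightarrow> M \<longlonglongrightarrow> M' \<Longrightarrow> lp_le p u M'"
  unfolding lp_le_def by (auto intro: LIMSEQ_le_const)

lemma lp_leD: "lp_le p u M \<Longrightarrow> u \<in> lp p" "lp_le p u M \<Longrightarrow> lp_norm p u \<le> M"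
  by (auto simp: lp_le_def)

lemma lp_diff: "1 \<le> p \<Longrightarrow> u \<in> lp p \<Longrightarrow> v \<in> lp p \<Longrightarrow> (\<lambda>n. u n - v n) \<in> lp p"
  using lp_leD(1)[OF lp_le_diff[OF _ lp_le_lp_norm lp_le_lp_norm]] .

lemma lp_scaleR: "1 \<le> p \<Longrightarrow> u \<in> lp p \<Longrightarrow> (\<lambda>n. c *\<^sub>R u n) \<in> lp p"
  using lp_leD(1)[OF lp_le_scaleR[OF _ lp_le_lp_norm]] .

lemma norm_le_lp_norm: "1 \<le> p \<Longrightarrow> u \<in> lp p \<Longrightarrow> norm (u n) \<le> lp_norm p u"
  by (rule lp_le_component[OF _ lp_le_lp_norm])

lemma lp_norm_abs_le: "1 \<le> p \<Longrightarrow> lp_le p u M \<Longrightarrow> \<bar>lp_norm p u\<bar> \<le> M"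
  using lp_norm_nonneg[OF lp_leD(1), of p u M] by (simp add: lp_le_def)

lemma lp_le_eq_0: "1 \<le> p \<Longrightarrow> lp_le p u 0 \<Longrightarrow> u n = 0"
  using lp_le_component[of p u 0 n] by simp

lemma lp_le_integral_const:
  fixes v :: "real \<Rightarrow> int \<Rightarrow> 'a::euclidean_space"
  assumes p: "1 \<le> p" and ab: "a \<le> b"
    and cont: "\<And>n. continuous_on {a..b} (\<lambda>s. v s n)"
    and le: "\<And>s. s \<in> {a..b} \<Longrightarrow> lp_le p (v s) B"
  shows "lp_le p (\<lambda>n. integral {a..b} (\<lambda>s. v s n)) ((b - a) * B)"
  using lp_le_integral[OF p ab cont _ le] ab by simp

lemma lp_continuous_on_component:
  assumes p: "1 \<le> p" and u: "lp_continuous_on p S u"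
  shows "continuous_on S (\<lambda>s. u s n)"
  unfolding continuous_on_def
proof
  fix t assume t: "t \<in> S"
  have "((\<lambda>s. u s n - u t n) \<longlongrightarrow> 0) (at t within S)"
  proof (rule Lim_null_comparison)
    show "\<forall>\<^sub>F s in at t within S. norm (u s n - u t n) \<le> lp_norm p (\<lambda>n. u s n - u t n)"
      unfolding eventually_at_filter
    proof (intro always_eventually allI impI)
      fix s assume "s \<in> S"
      then have "(\<lambda>n. u s n - u t n) \<in> lp p"
        using u t by (auto simp: lp_continuous_on_def intro!: lp_diff p)
      from norm_le_lp_norm[OF p this] show "norm (u s n - u t n) \<le> lp_norm p (\<lambda>n. u s n - u t n)" .
    qed
    show "((\<lambda>s. lp_norm p (\<lambda>n. u s n - u t n)) \<longlongrightarrow> 0) (at t within S)"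
      using u t by (auto simp: lp_continuous_on_def)
  qed
  then show "((\<lambda>s. u s n) \<longlongrightarrow> u t n) (at t within S)" by (rule LIM_zero_cancel)
qed

lemma has_lp_derivative_component:
  assumes p: "1 \<le> p" and u: "has_lp_derivative p u v t S" and t: "t \<in> S"
  shows "((\<lambda>s. u s n) has_vector_derivative v n) (at t within S)"
proof -
  have in_lp: "(\<lambda>n. (u s n - u t n) /\<^sub>R (s - t) - v n) \<in> lp p" if "s \<in> S" for s
    using u t that by (auto simp: has_lp_derivative_def intro!: lp_diff lp_scaleR p)
  have "((\<lambda>s. ((u s n - u t n) - (s - t) *\<^sub>R v n) /\<^sub>R norm (s - t)) \<longlongrightarrow> 0) (at t within S)"
  proof (rule Lim_null_comparison)
    show "((\<lambda>s. lp_norm p (\<lambda>n. (u s n - u t n) /\<^sub>R (s - t) - v n)) \<longlongrightarrow> 0) (at t within S)"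
      using u by (simp add: has_lp_derivative_def)
    show "\<forall>\<^sub>F s in at t within S. norm (((u s n - u t n) - (s - t) *\<^sub>R v n) /\<^sub>R norm (s - t))
        \<le> lp_norm p (\<lambda>n. (u s n - u t n) /\<^sub>R (s - t) - v n)"
      unfolding eventually_at_filter
    proof (intro always_eventually allI impI)
      fix s assume s: "s \<noteq> t" "s \<in> S"
      have "(u s n - u t n) - (s - t) *\<^sub>R v n = (s - t) *\<^sub>R ((u s n - u t n) /\<^sub>R (s - t) - v n)"
        using s by (simp add: scaleR_diff_right)
      then have "norm (((u s n - u t n) - (s - t) *\<^sub>R v n) /\<^sub>R norm (s - t))
          = norm ((u s n - u t n) /\<^sub>R (s - t) - v n)" using s by (simp add: abs_mult)
      also have "\<dots> \<le> lp_norm p (\<lambda>n. (u s n - u t n) /\<^sub>R (s - t) - v n)"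
        by (rule norm_le_lp_norm[OF p in_lp[OF s(2)]])
      finally show "norm (((u s n - u t n) - (s - t) *\<^sub>R v n) /\<^sub>R norm (s - t))
        \<le> lp_norm p (\<lambda>n. (u s n - u t n) /\<^sub>R (s - t) - v n)" .
    qed
  qed
  then show ?thesis
    by (simp add: has_vector_derivative_def has_derivative_at_within bounded_linear_scaleR_left)
qed

lemma has_lp_derivative_imp_lp_continuous_on:
  assumes p: "1 \<le> p" and u: "\<And>t. t \<in> S \<Longrightarrow> has_lp_derivative p u (u' t) t S"
  shows "lp_continuous_on p S u"
  unfolding lp_continuous_on_def
proof (intro conjI ballI)
  show in_lp: "u s \<in> lp p" if "s \<in> S" for s using u[OF that] that by (simp add: has_lp_derivative_def)
  fix t assume t: "t \<in> S"
  let ?q = "\<lambda>s n. (u s n - u t n) /\<^sub>R (s - t) - u' t n"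
  have q: "((\<lambda>s. lp_norm p (?q s)) \<longlongrightarrow> 0) (at t within S)" and u't: "u' t \<in> lp p"
    using u[OF t] by (auto simp: has_lp_derivative_def)
  show "((\<lambda>s. lp_norm p (\<lambda>n. u s n - u t n)) \<longlongrightarrow> 0) (at t within S)"
  proof (rule Lim_null_comparison)
    have "((\<lambda>s. \<bar>s - t\<bar> * (lp_norm p (?q s) + lp_norm p (u' t))) \<longlongrightarrow> \<bar>t - t\<bar> * (0 + lp_norm p (u' t))) (at t within S)"
      by (intro tendsto_intros q)
    then show "((\<lambda>s. \<bar>s - t\<bar> * (lp_norm p (?q s) + lp_norm p (u' t))) \<longlongrightarrow> 0) (at t within S)" by simp
    show "\<forall>\<^sub>F s in at t within S. norm (lp_norm p (\<lambda>n. u s n - u t n))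
        \<le> \<bar>s - t\<bar> * (lp_norm p (?q s) + lp_norm p (u' t))"
      unfolding eventually_at_filter
    proof (intro always_eventually allI impI)
      fix s assume s: "s \<noteq> t" "s \<in> S"
      have qs: "?q s \<in> lp p" using in_lp[OF s(2)] in_lp[OF t] u't by (auto intro!: lp_diff lp_scaleR p)
      have "lp_le p (\<lambda>n. (s - t) *\<^sub>R (?q s n + u' t n)) (\<bar>s - t\<bar> * (lp_norm p (?q s) + lp_norm p (u' t)))"
        by (intro lp_le_scaleR lp_le_add lp_le_lp_norm p qs u't)
      then have "lp_le p (\<lambda>n. u s n - u t n) (\<bar>s - t\<bar> * (lp_norm p (?q s) + lp_norm p (u' t)))"
        using s by simp
      then show "norm (lp_norm p (\<lambda>n. u s n - u t n)) \<le> \<bar>s - t\<bar> * (lp_norm p (?q s) + lp_norm p (u' t))"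
        using lp_norm_abs_le[OF p] by simp
    qed
  qed
qed

lemma lp_continuous_on_bounded:
  assumes p: "1 \<le> p" and u: "lp_continuous_on p S u" and S: "compact S"
  obtains B where "\<And>s. s \<in> S \<Longrightarrow> lp_le p (u s) B"
proof -
  have in_lp: "u s \<in> lp p" if "s \<in> S" for s using u that by (simp add: lp_continuous_on_def)
  have "continuous_on S (\<lambda>s. lp_norm p (u s))"
    unfolding continuous_on_def
  proof
    fix t assume t: "t \<in> S"
    have "((\<lambda>s. lp_norm p (u s) - lp_norm p (u t)) \<longlongrightarrow> 0) (at t within S)"
    proof (rule Lim_null_comparison)
      show "((\<lambda>s. lp_norm p (\<lambda>n. u s n - u t n)) \<longlongrightarrow> 0) (at t within S)"
        using u t by (auto simp: lp_continuous_on_def)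
      show "\<forall>\<^sub>F s in at t within S. norm (lp_norm p (u s) - lp_norm p (u t)) \<le> lp_norm p (\<lambda>n. u s n - u t n)"
        unfolding eventually_at_filter
      proof (intro always_eventually allI impI)
        fix s assume s: "s \<in> S"
        let ?N = "lp_norm p (\<lambda>n. u s n - u t n)"
        have d: "lp_le p (\<lambda>n. u s n - u t n) ?N"
          using in_lp s t by (intro lp_le_lp_norm lp_diff p) auto
        have "lp_le p (\<lambda>n. (u s n - u t n) + u t n) (?N + lp_norm p (u t))"
          using in_lp t by (intro lp_le_add p d lp_le_lp_norm) auto
        moreover have "lp_le p (\<lambda>n. (u t n - u s n) + u s n) (?N + lp_norm p (u s))"
          using in_lp s by (intro lp_le_add p lp_le_minus_commute[OF p d] lp_le_lp_norm) auto
        ultimately show "norm (lp_norm p (u s) - lp_norm p (u t)) \<le> ?N"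
          by (auto simp: lp_le_def)
      qed
    qed
    then show "((\<lambda>s. lp_norm p (u s)) \<longlongrightarrow> lp_norm p (u t)) (at t within S)" by (rule LIM_zero_cancel)
  qed
  then have "bounded ((\<lambda>s. lp_norm p (u s)) ` S)"
    using S by (intro compact_imp_bounded compact_continuous_image)
  then obtain B where "\<forall>s\<in>S. \<bar>lp_norm p (u s)\<bar> \<le> B" by (auto simp: bounded_iff)
  then have "lp_le p (u s) B" if "s \<in> S" for s
    unfolding lp_le_def using in_lp[OF that] abs_le_D1 that by blast
  then show ?thesis by (rule that)
qed

text \<open>
  Passage from the componentwise integral equation back to a derivative in the norm of \<open>\<ell>\<^sub>p\<close>: the difference quotient
  minus \<open>v t\<close> is the mean value of \<open>v r - v t\<close> over a short interval.
\<close>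

lemma lp_fundamental_theorem_of_calculus:
  fixes u :: "real \<Rightarrow> int \<Rightarrow> 'a::euclidean_space"
  assumes p: "1 \<le> p" and v: "lp_continuous_on p {0..\<tau>} v" and u0: "u0 \<in> lp p"
    and u: "\<And>t n. t \<in> {0..\<tau>} \<Longrightarrow> u t n = u0 n + integral {0..t} (\<lambda>s. v s n)"
    and t: "t \<in> {0..\<tau>}"
  shows "has_lp_derivative p u (v t) t {0..\<tau>}"
  unfolding has_lp_derivative_def
proof (intro conjI ballI)
  note cont = lp_continuous_on_component[OF p v]
  obtain B where B: "\<And>s. s \<in> {0..\<tau>} \<Longrightarrow> lp_le p (v s) B"
    using lp_continuous_on_bounded[OF p v] by auto
  show "u s \<in> lp p" if s: "s \<in> {0..\<tau>}" for s
  proof -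
    have "lp_le p (\<lambda>n. integral {0..s} (\<lambda>r. v r n)) ((s - 0) * B)"
      using s by (intro lp_le_integral_const p B) (auto intro: continuous_on_subset[OF cont])
    from lp_leD(1)[OF lp_le_add[OF p lp_le_lp_norm[OF u0] this]]
    have "(\<lambda>n. u0 n + integral {0..s} (\<lambda>r. v r n)) \<in> lp p" .
    also have "(\<lambda>n. u0 n + integral {0..s} (\<lambda>r. v r n)) = u s" using u[OF s] by auto
    finally show ?thesis .
  qed
  show "v t \<in> lp p" using B[OF t] by (rule lp_leD)
  show "((\<lambda>s. lp_norm p (\<lambda>n. (u s n - u t n) /\<^sub>R (s - t) - v t n)) \<longlongrightarrow> 0) (at t within {0..\<tau>})"
  proof (rule tendstoI)
    fix e :: real assume e: "0 < e"
    have "((\<lambda>s. lp_norm p (\<lambda>n. v s n - v t n)) \<longlongrightarrow> 0) (at t within {0..\<tau>})"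
      using v t by (auto simp: lp_continuous_on_def)
    from tendstoD[OF this, of "e / 2"] e obtain d where d: "d > 0"
      and dd: "\<And>s. s \<in> {0..\<tau>} \<Longrightarrow> s \<noteq> t \<Longrightarrow> dist s t < d \<Longrightarrow> \<bar>lp_norm p (\<lambda>n. v s n - v t n)\<bar> < e / 2"
      unfolding eventually_at by (auto simp: dist_real_def)
    have vd: "lp_le p (\<lambda>n. v s n - v t n) (e / 2)" if "s \<in> {0..\<tau>}" "dist s t < d" for s
    proof (cases "s = t")
      case True
      then show ?thesis using lp_le_mono[OF lp_0[OF p], of "e / 2"] e by simp
    next
      case False
      then show ?thesis using dd[OF that(1) False that(2)] B[OF that(1)] B[OF t]
        by (auto simp: lp_le_def intro!: lp_diff p)
    qed
    have diff: "u b n - u a n = integral {a..b} (\<lambda>r. v r n)" if "0 \<le> a" "a \<le> b" "b \<le> \<tau>" for a b n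
    proof -
      have "(\<lambda>r. v r n) integrable_on {0..b}"
        using that by (intro integrable_continuous_real continuous_on_subset[OF cont]) auto
      from Henstock_Kurzweil_Integration.integral_combine[OF that(1,2) this, symmetric]
      show ?thesis using u[of a n] u[of b n] that by (simp only: atLeastAtMost_iff) simp
    qed
    have key: "lp_le p (\<lambda>n. (u s n - u t n) /\<^sub>R (s - t) - v t n) (e / 2)"
      if s: "s \<in> {0..\<tau>}" "s \<noteq> t" "dist s t < d" for s
    proof -
      define a b where "a = min s t" and "b = max s t"
      have ab: "0 \<le> a" "a < b" "b \<le> \<tau>" using s t by (auto simp: a_def b_def)
      have near: "dist r t < d" if "r \<in> {a..b}" for r
        using that s by (auto simp: a_def b_def dist_real_def)
      have "lp_le p (\<lambda>n. integral {a..b} (\<lambda>r. v r n - v t n)) ((b - a) * (e / 2))"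
        using ab near by (intro lp_le_integral_const p vd continuous_intros continuous_on_subset[OF cont]) auto
      from lp_le_scaleR[OF p this, of "1 / (b - a)"]
      have "lp_le p (\<lambda>n. (1 / (b - a)) *\<^sub>R integral {a..b} (\<lambda>r. v r n - v t n)) (e / 2)"
        using ab by simp
      moreover have "(1 / (b - a)) *\<^sub>R integral {a..b} (\<lambda>r. v r n - v t n) = (u s n - u t n) /\<^sub>R (s - t) - v t n" for n
      proof -
        have "(\<lambda>r. v r n) integrable_on {a..b}"
          using ab by (intro integrable_continuous_real continuous_on_subset[OF cont]) auto
        then have "integral {a..b} (\<lambda>r. v r n - v t n) = (u b n - u a n) - (b - a) *\<^sub>R v t n"
          using ab diff[of a b n] by (subst integral_diff) auto
        then have "(1 / (b - a)) *\<^sub>R integral {a..b} (\<lambda>r. v r n - v t n) = (1 / (b - a)) *\<^sub>R (u b n - u a n) - v t n"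
          using ab by (simp add: scaleR_diff_right)
        also have "(1 / (b - a)) *\<^sub>R (u b n - u a n) = (u s n - u t n) /\<^sub>R (s - t)"
        proof (cases "s < t")
          case True
          then have "(1 / (b - a)) *\<^sub>R (u b n - u a n) = (- (1 / (t - s))) *\<^sub>R (u s n - u t n)"
            by (simp add: a_def b_def algebra_simps)
          also have "- (1 / (t - s)) = inverse (s - t)" using True by (simp add: field_simps)
          finally show ?thesis .
        qed (use s in \<open>auto simp: a_def b_def inverse_eq_divide\<close>)
        finally show ?thesis .
      qed
      ultimately show ?thesis by simp
    qed
    show "\<forall>\<^sub>F s in at t within {0..\<tau>}. dist (lp_norm p (\<lambda>n. (u s n - u t n) /\<^sub>R (s - t) - v t n)) 0 < e"
      unfolding eventually_at
    proof (intro exI[of _ d] conjI d ballI impI)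
      fix s assume "s \<in> {0..\<tau>}" "s \<noteq> t \<and> dist s t < d"
      then have k: "lp_le p (\<lambda>n. (u s n - u t n) /\<^sub>R (s - t) - v t n) (e / 2)" using key by auto
      then show "dist (lp_norm p (\<lambda>n. (u s n - u t n) /\<^sub>R (s - t) - v t n)) 0 < e"
        using lp_norm_nonneg[OF lp_leD(1)[OF k] p] e by (simp add: lp_le_def)
    qed
  qed
qed

text \<open>
  Gronwall's lemma without an integral inequality for the norm, which would need the norm to be
  measurable in time. A bound \<open>m exp (2 L t)\<close> improves to \<open>(K + m / 2) exp (2 L t)\<close>, because
  \<open>\<integral>\<^sub>0\<^sup>t L exp (2 L s) ds \<le> exp (2 L t) / 2\<close>; iteration drives \<open>m\<close> down to \<open>2 K\<close>.
\<close>

lemma lp_gronwall: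
  fixes D :: "real \<Rightarrow> int \<Rightarrow> 'a::euclidean_space"
  assumes p: "1 \<le> p" and L: "0 < L"
    and D: "\<And>t n. t \<in> {0..\<tau>} \<Longrightarrow> D t n = r t n + integral {0..t} (\<lambda>s. v s n)"
    and r: "\<And>t. t \<in> {0..\<tau>} \<Longrightarrow> lp_le p (r t) K"
    and cont: "\<And>n. continuous_on {0..\<tau>} (\<lambda>s. v s n)"
    and B: "\<And>t. t \<in> {0..\<tau>} \<Longrightarrow> lp_le p (D t) B"
    and v: "\<And>s m. s \<in> {0..\<tau>} \<Longrightarrow> lp_le p (D s) m \<Longrightarrow> lp_le p (v s) (L * m)"
    and t: "t \<in> {0..\<tau>}"
  shows "lp_le p (D t) (2 * K * exp (2 * L * t))"
proof -
  have K0: "0 \<le> K" and B0: "0 \<le> B" using lp_le_nonneg[OF p r[OF t]] lp_le_nonneg[OF p B[OF t]] .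
  have "lp_le p (D t) ((2 * K + B / 2 ^ k) * exp (2 * L * t))" if t: "t \<in> {0..\<tau>}" for k t
    using t
  proof (induction k arbitrary: t)
    case 0
    have "B * 1 \<le> (2 * K + B) * exp (2 * L * t)"
      using 0 K0 B0 L by (intro mult_mono) auto
    then show ?case using lp_le_mono[OF B[OF 0]] by simp
  next
    case (Suc k)
    define m where "m = 2 * K + B / 2 ^ k"
    have m: "0 \<le> m" using K0 B0 by (simp add: m_def)
    have I: "((\<lambda>s. L * (m * exp (2 * L * s))) has_integral (m / 2 * exp (2 * L * t) - m / 2 * exp (2 * L * 0))) {0..t}"
      using Suc.prems L by (intro fundamental_theorem_of_calculus)
        (auto intro!: derivative_eq_intros simp flip: has_real_derivative_iff_has_vector_derivative)
    have "lp_le p (\<lambda>n. integral {0..t} (\<lambda>s. v s n)) (integral {0..t} (\<lambda>s. L * (m * exp (2 * L * s))))"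
      using Suc.prems Suc.IH
      by (intro lp_le_integral p v continuous_on_subset[OF cont] continuous_intros) (auto simp: m_def)
    then have "lp_le p (\<lambda>n. integral {0..t} (\<lambda>s. v s n)) (m / 2 * exp (2 * L * t))"
      unfolding integral_unique[OF I] by (rule lp_le_mono) (use m in simp)
    from lp_le_add[OF p r[OF Suc.prems] this]
    have "lp_le p (\<lambda>n. r t n + integral {0..t} (\<lambda>s. v s n)) (K + m / 2 * exp (2 * L * t))" .
    also have "(\<lambda>n. r t n + integral {0..t} (\<lambda>s. v s n)) = D t" using D[OF Suc.prems] by auto
    finally have *: "lp_le p (D t) (K + m / 2 * exp (2 * L * t))" .
    have m2: "m / 2 = K + B / 2 ^ Suc k" by (simp add: m_def field_simps)
    have "K * 1 \<le> K * exp (2 * L * t)" using K0 L Suc.prems by (intro mult_left_mono) auto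
    then have "K + (K + B / 2 ^ Suc k) * exp (2 * L * t) \<le> (2 * K + B / 2 ^ Suc k) * exp (2 * L * t)"
      by (simp add: algebra_simps)
    then have "K + m / 2 * exp (2 * L * t) \<le> (2 * K + B / 2 ^ Suc k) * exp (2 * L * t)"
      by (simp only: m2)
    then show ?case by (rule lp_le_mono[OF *])
  qed
  note this[OF t]
  moreover have "(\<lambda>k. (2 * K + B / 2 ^ k) * exp (2 * L * t)) \<longlonglongrightarrow> (2 * K + 0) * exp (2 * L * t)"
    by (intro tendsto_intros LIMSEQ_divide_realpow_zero) auto
  ultimately show ?thesis using lp_le_bound_limit by fastforce
qed

section \<open>Ordinary differential equations with nearest-neighbour fields\<close>

text \<open>
  Lipschitz continuity with nearest-neighbour range (\<open>nn\<close>), for sequences with values in \<open>B\<close>. The condition is pointwise in \<open>n\<close>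
  and hence independent of \<open>p\<close>.
\<close>

definition nn_lipschitz_on ::
  "'a::real_normed_vector set \<Rightarrow> real \<Rightarrow> ((int \<Rightarrow> 'a) \<Rightarrow> int \<Rightarrow> 'b::real_normed_vector) \<Rightarrow> bool" where
  "nn_lipschitz_on B c \<Phi> \<longleftrightarrow> 0 \<le> c \<and> (\<forall>u v. (\<forall>n. u n \<in> B) \<longrightarrow> (\<forall>n. v n \<in> B) \<longrightarrow> (\<forall>n.
     norm (\<Phi> u n - \<Phi> v n) \<le> c * (norm (u (n - 1) - v (n - 1)) + norm (u n - v n) + norm (u (n + 1) - v (n + 1)))))"

lemma nn_lipschitz_on_subset: "nn_lipschitz_on B c \<Phi> \<Longrightarrow> A \<subseteq> B \<Longrightarrow> nn_lipschitz_on A c \<Phi>"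
  unfolding nn_lipschitz_on_def by blast

lemma nn_lipschitz_on_lp_le:
  assumes p: "1 \<le> p" and \<Phi>: "nn_lipschitz_on B c \<Phi>" and "\<And>n. u n \<in> B" "\<And>n. v n \<in> B"
    and d: "lp_le p (\<lambda>n. u n - v n) M"
  shows "lp_le p (\<lambda>n. \<Phi> u n - \<Phi> v n) (3 * c * M)"
  using \<Phi> assms(3,4) unfolding nn_lipschitz_on_def
  by (intro lp_le_nearest_neighbour[OF p d]) blast+

lemma nn_lipschitz_on_continuous_on:
  assumes \<Phi>: "nn_lipschitz_on B c \<Phi>" and cont: "\<And>m. continuous_on S (\<lambda>s. w s m)"
    and B: "\<And>s m. s \<in> S \<Longrightarrow> w s m \<in> B"
  shows "continuous_on S (\<lambda>s. \<Phi> (w s) n)"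
  unfolding continuous_on_def
proof
  fix t assume t: "t \<in> S"
  have w: "((\<lambda>s. w s m) \<longlongrightarrow> w t m) (at t within S)" for m
    using cont t by (auto simp: continuous_on_def)
  have "((\<lambda>s. \<Phi> (w s) n - \<Phi> (w t) n) \<longlongrightarrow> 0) (at t within S)"
  proof (rule Lim_null_comparison)
    let ?b = "\<lambda>s. c * (norm (w s (n - 1) - w t (n - 1)) + norm (w s n - w t n) + norm (w s (n + 1) - w t (n + 1)))"
    have "(?b \<longlongrightarrow> ?b t) (at t within S)" by (intro tendsto_intros w)
    then show "(?b \<longlongrightarrow> 0) (at t within S)" by simp
    show "\<forall>\<^sub>F s in at t within S. norm (\<Phi> (w s) n - \<Phi> (w t) n) \<le> ?b s"
      unfolding eventually_at_filter using \<Phi> B t unfolding nn_lipschitz_on_def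
      by (intro always_eventually allI impI) blast
  qed
  then show "((\<lambda>s. \<Phi> (w s) n) \<longlongrightarrow> \<Phi> (w t) n) (at t within S)" by (rule LIM_zero_cancel)
qed

lemma lp_le_time_lipschitz:
  fixes u :: "real \<Rightarrow> int \<Rightarrow> 'a::euclidean_space"
  assumes p: "1 \<le> p" and cont: "\<And>n. continuous_on {0..\<tau>} (\<lambda>s. v s n)"
    and v: "\<And>t. t \<in> {0..\<tau>} \<Longrightarrow> lp_le p (v t) K"
    and u: "\<And>t n. t \<in> {0..\<tau>} \<Longrightarrow> u t n = u0 n + integral {0..t} (\<lambda>s. v s n)"
    and s: "s \<in> {0..\<tau>}" and t: "t \<in> {0..\<tau>}"
  shows "lp_le p (\<lambda>n. u t n - u s n) (K * \<bar>t - s\<bar>)"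
proof -
  have *: "lp_le p (\<lambda>n. u t n - u s n) (K * \<bar>t - s\<bar>)"
    if s: "s \<in> {0..\<tau>}" and t: "t \<in> {0..\<tau>}" and "s \<le> t" for s t
  proof -
    have "u t n - u s n = integral {s..t} (\<lambda>r. v r n)" for n
    proof -
      have "(\<lambda>r. v r n) integrable_on {0..t}"
        using that by (intro integrable_continuous_real continuous_on_subset[OF cont]) auto
      from Henstock_Kurzweil_Integration.integral_combine[OF _ \<open>s \<le> t\<close> this, symmetric]
      show ?thesis using u[of s n] u[of t n] that by (simp only: atLeastAtMost_iff) simp
    qed
    moreover have "lp_le p (\<lambda>n. integral {s..t} (\<lambda>r. v r n)) ((t - s) * K)"
      using that by (intro lp_le_integral_const p v continuous_on_subset[OF cont]) auto
    ultimately show ?thesis using that by (simp add: mult.commute)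
  qed
  show ?thesis
    using *[OF s t] lp_le_minus_commute[OF p *[OF t s]] by (cases "s \<le> t") (auto simp: abs_minus_commute)
qed

text \<open>
  Together with \<open>solves_ivpE\<close> this makes solutions in \<open>\<ell>\<^sub>p\<close> the same as bounded componentwise solutions of the
  integral equation.
\<close>

lemma solves_ivpI:
  fixes u :: "real \<Rightarrow> int \<Rightarrow> 'a::euclidean_space"
  assumes p: "1 \<le> p" and \<tau>: "0 \<le> \<tau>" and \<Phi>: "nn_lipschitz_on B c \<Phi>" and u0: "u0 \<in> lp p"
    and uB: "\<And>t n. t \<in> {0..\<tau>} \<Longrightarrow> u t n \<in> B" and cont: "\<And>n. continuous_on {0..\<tau>} (\<lambda>s. u s n)"
    and K: "\<And>t. t \<in> {0..\<tau>} \<Longrightarrow> lp_le p (\<Phi> (u t)) K"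
    and u: "\<And>t n. t \<in> {0..\<tau>} \<Longrightarrow> u t n = u0 n + integral {0..t} (\<lambda>s. \<Phi> (u s) n)"
  shows "solves_ivp p \<Phi> u0 \<tau> u"
proof -
  have cont\<Phi>: "continuous_on {0..\<tau>} (\<lambda>s. \<Phi> (u s) n)" for n
    by (rule nn_lipschitz_on_continuous_on[OF \<Phi> cont uB])
  have "lp_continuous_on p {0..\<tau>} (\<lambda>s. \<Phi> (u s))"
    unfolding lp_continuous_on_def
  proof (intro conjI ballI)
    show "\<Phi> (u s) \<in> lp p" if "s \<in> {0..\<tau>}" for s using K[OF that] by (rule lp_leD)
    fix t assume t: "t \<in> {0..\<tau>}"
    show "((\<lambda>s. lp_norm p (\<lambda>n. \<Phi> (u s) n - \<Phi> (u t) n)) \<longlongrightarrow> 0) (at t within {0..\<tau>})"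
    proof (rule Lim_null_comparison)
      have "((\<lambda>s. 3 * c * (K * \<bar>s - t\<bar>)) \<longlongrightarrow> 3 * c * (K * \<bar>t - t\<bar>)) (at t within {0..\<tau>})"
        by (intro tendsto_intros)
      then show "((\<lambda>s. 3 * c * (K * \<bar>s - t\<bar>)) \<longlongrightarrow> 0) (at t within {0..\<tau>})" by simp
      show "\<forall>\<^sub>F s in at t within {0..\<tau>}. norm (lp_norm p (\<lambda>n. \<Phi> (u s) n - \<Phi> (u t) n)) \<le> 3 * c * (K * \<bar>s - t\<bar>)"
        unfolding eventually_at_filter
      proof (intro always_eventually allI impI)
        fix s assume s: "s \<in> {0..\<tau>}"
        have "lp_le p (\<lambda>n. \<Phi> (u s) n - \<Phi> (u t) n) (3 * c * (K * \<bar>s - t\<bar>))"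
          by (intro nn_lipschitz_on_lp_le[OF p \<Phi>] uB s t lp_le_time_lipschitz[OF p cont\<Phi> K u]) auto
        then show "norm (lp_norm p (\<lambda>n. \<Phi> (u s) n - \<Phi> (u t) n)) \<le> 3 * c * (K * \<bar>s - t\<bar>)"
          using lp_norm_nonneg[OF lp_leD(1) p] by (fastforce simp: lp_le_def)
      qed
    qed
  qed
  from lp_fundamental_theorem_of_calculus[OF p this u0 u] have "\<forall>t\<in>{0..\<tau>}. has_lp_derivative p u (\<Phi> (u t)) t {0..\<tau>}"
    by auto
  moreover have "u 0 = u0" using u[of 0] \<tau> by auto
  ultimately show ?thesis by (simp add: solves_ivp_def)
qed

lemma solves_ivpE:
  fixes u :: "real \<Rightarrow> int \<Rightarrow> 'a::euclidean_space"
  assumes p: "1 \<le> p" and \<Phi>: "\<And>R. \<exists>c. nn_lipschitz_on (cball 0 R) c \<Phi>" and u: "solves_ivp p \<Phi> u0 \<tau> u"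
  obtains B where "\<And>t. t \<in> {0..\<tau>} \<Longrightarrow> lp_le p (u t) B"
    "\<And>n. continuous_on {0..\<tau>} (\<lambda>s. u s n)" "\<And>n. continuous_on {0..\<tau>} (\<lambda>s. \<Phi> (u s) n)"
    "\<And>t n. t \<in> {0..\<tau>} \<Longrightarrow> u t n = u0 n + integral {0..t} (\<lambda>s. \<Phi> (u s) n)"
proof -
  have der: "has_lp_derivative p u (\<Phi> (u t)) t {0..\<tau>}" if "t \<in> {0..\<tau>}" for t
    using u that by (simp add: solves_ivp_def)
  have lpc: "lp_continuous_on p {0..\<tau>} u" by (rule has_lp_derivative_imp_lp_continuous_on[OF p der])
  obtain B where B: "\<And>s. s \<in> {0..\<tau>} \<Longrightarrow> lp_le p (u s) B"
    using lp_continuous_on_bounded[OF p lpc] by auto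
  have uB: "u s n \<in> cball 0 B" if "s \<in> {0..\<tau>}" for s n using lp_le_component[OF p B[OF that]] by simp
  note cont = lp_continuous_on_component[OF p lpc]
  obtain c where c: "nn_lipschitz_on (cball 0 B) c \<Phi>" using \<Phi> by blast
  have cont\<Phi>: "continuous_on {0..\<tau>} (\<lambda>s. \<Phi> (u s) n)" for n
    by (rule nn_lipschitz_on_continuous_on[OF c cont uB])
  have "u t n = u0 n + integral {0..t} (\<lambda>s. \<Phi> (u s) n)" if t: "t \<in> {0..\<tau>}" for t n
  proof -
    have "((\<lambda>s. \<Phi> (u s) n) has_integral (u t n - u 0 n)) {0..t}"
    proof (rule fundamental_theorem_of_calculus)
      fix s assume s: "s \<in> {0..t}"
      then have "((\<lambda>s. u s n) has_vector_derivative \<Phi> (u s) n) (at s within {0..\<tau>})"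
        using t by (intro has_lp_derivative_component[OF p der]) auto
      then show "((\<lambda>s. u s n) has_vector_derivative \<Phi> (u s) n) (at s within {0..t})"
        by (rule has_vector_derivative_within_subset) (use t in auto)
    qed (use t in auto)
    moreover have "u 0 = u0" using u by (simp add: solves_ivp_def)
    ultimately show ?thesis by (simp add: integral_unique)
  qed
  with B cont cont\<Phi> that show ?thesis by blast
qed

lemma solves_ivp_unique:
  fixes u v :: "real \<Rightarrow> int \<Rightarrow> 'a::euclidean_space"
  assumes p: "1 \<le> p" and \<Phi>: "\<And>R. \<exists>c. nn_lipschitz_on (cball 0 R) c \<Phi>"
    and u: "solves_ivp p \<Phi> u0 \<tau> u" and v: "solves_ivp p \<Phi> u0 \<sigma> v" and \<sigma>: "\<sigma> \<le> \<tau>" and t: "t \<in> {0..\<sigma>}"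
  shows "v t = u t"
proof -
  obtain B where B: "\<And>t. t \<in> {0..\<tau>} \<Longrightarrow> lp_le p (u t) B"
    and cu: "\<And>n. continuous_on {0..\<tau>} (\<lambda>s. \<Phi> (u s) n)"
    and eu: "\<And>t n. t \<in> {0..\<tau>} \<Longrightarrow> u t n = u0 n + integral {0..t} (\<lambda>s. \<Phi> (u s) n)"
    using solves_ivpE[OF p \<Phi> u] by metis
  obtain C where C: "\<And>t. t \<in> {0..\<sigma>} \<Longrightarrow> lp_le p (v t) C"
    and cv: "\<And>n. continuous_on {0..\<sigma>} (\<lambda>s. \<Phi> (v s) n)"
    and ev: "\<And>t n. t \<in> {0..\<sigma>} \<Longrightarrow> v t n = u0 n + integral {0..t} (\<lambda>s. \<Phi> (v s) n)"
    using solves_ivpE[OF p \<Phi> v] by metis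
  define R where "R = max B C"
  have uR: "u s n \<in> cball 0 R" if "s \<in> {0..\<sigma>}" for s n
    using lp_le_component[OF p B, of s n] that \<sigma> by (auto simp: R_def)
  have vR: "v s n \<in> cball 0 R" if "s \<in> {0..\<sigma>}" for s n
    using lp_le_component[OF p C, of s n] that by (auto simp: R_def)
  obtain c where c: "nn_lipschitz_on (cball 0 R) c \<Phi>" using \<Phi> by blast
  have c0: "0 \<le> c" using c by (simp add: nn_lipschitz_on_def)
  have "lp_le p (\<lambda>n. v t n - u t n) (2 * 0 * exp (2 * (3 * c + 1) * t))"
  proof (rule lp_gronwall[OF p, where \<tau> = \<sigma> and v = "\<lambda>s n. \<Phi> (v s) n - \<Phi> (u s) n" and r = "\<lambda>_ _. 0" and B = "C + B"])
    show "v t n - u t n = 0 + integral {0..t} (\<lambda>s. \<Phi> (v s) n - \<Phi> (u s) n)" if "t \<in> {0..\<sigma>}" for t n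
      using that \<sigma> eu[of t n] ev[of t n]
      by (subst integral_diff)
        (auto intro!: integrable_continuous_real continuous_on_subset[OF cu] continuous_on_subset[OF cv])
    show "continuous_on {0..\<sigma>} (\<lambda>s. \<Phi> (v s) n - \<Phi> (u s) n)" for n
      using \<sigma> by (intro continuous_intros continuous_on_subset[OF cu] cv) auto
    show "lp_le p (\<lambda>n. v t n - u t n) (C + B)" if "t \<in> {0..\<sigma>}" for t
      using that \<sigma> by (intro lp_le_diff p B C) auto
    show "lp_le p (\<lambda>n. \<Phi> (v s) n - \<Phi> (u s) n) ((3 * c + 1) * m)"
      if s: "s \<in> {0..\<sigma>}" and m: "lp_le p (\<lambda>n. v s n - u s n) m" for s m
      using lp_le_nonneg[OF p m] c0
      by (intro lp_le_mono[OF nn_lipschitz_on_lp_le[OF p c vR uR m]] s) (simp add: algebra_simps)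
  qed (use c0 t in \<open>auto intro: lp_0 p\<close>)
  then have "lp_le p (\<lambda>n. v t n - u t n) 0" by simp
  from lp_le_eq_0[OF p this] show ?thesis by auto
qed

lemma solves_ivp_is_the_solution:
  fixes u :: "real \<Rightarrow> int \<Rightarrow> 'a::euclidean_space"
  assumes "1 \<le> p" and "\<And>R. \<exists>c. nn_lipschitz_on (cball 0 R) c \<Phi>" and "solves_ivp p \<Phi> u0 \<tau> u"
  shows "is_the_solution p \<Phi> u0 \<tau> u"
  unfolding is_the_solution_def
  by (intro conjI ballI allI impI assms(3) solves_ivp_unique[OF assms]) auto

text \<open>
  Picard iteration on the whole interval at once. In the weighted norm \<open>sup\<^sub>t exp (-2 L t) \<parallel>u t\<parallel>\<close> the Picard map is a
  contraction with factor \<open>1/2\<close> whatever the length of the interval.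
\<close>

theorem picard_existence:
  fixes u0 :: "int \<Rightarrow> 'a::euclidean_space"
  assumes p: "1 \<le> p" and \<tau>: "0 \<le> \<tau>" and \<Phi>: "nn_lipschitz_on UNIV c \<Phi>" and \<Phi>0: "\<Phi> (\<lambda>_. 0) = (\<lambda>_. 0)"
    and u0: "u0 \<in> lp p"
  obtains u where "solves_ivp p \<Phi> u0 \<tau> u"
proof -
  have c0: "0 \<le> c" using \<Phi> by (simp add: nn_lipschitz_on_def)
  define L where "L = 3 * c + 1"
  have L: "0 < L" using c0 by (simp add: L_def)
  have lip: "lp_le p (\<lambda>n. \<Phi> u n - \<Phi> v n) (L * M)" if "lp_le p (\<lambda>n. u n - v n) M" for u v M
    using lp_le_nonneg[OF p that] by (intro lp_le_mono[OF nn_lipschitz_on_lp_le[OF p \<Phi> _ _ that]]) (auto simp: L_def algebra_simps)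
  have lip0: "lp_le p (\<Phi> u) (L * M)" if "lp_le p u M" for u M
    using lip[of u "\<lambda>_. 0" M] that by (simp add: \<Phi>0)
  define U :: "nat \<Rightarrow> real \<Rightarrow> int \<Rightarrow> 'a" where "U = rec_nat (\<lambda>t n. u0 n) (\<lambda>k w t n. u0 n + integral {0..t} (\<lambda>s. \<Phi> (w s) n))"
  have U0: "U 0 = (\<lambda>t n. u0 n)" and US: "U (Suc k) = (\<lambda>t n. u0 n + integral {0..t} (\<lambda>s. \<Phi> (U k s) n))" for k
    by (auto simp: U_def)
  have cont: "continuous_on {0..\<tau>} (\<lambda>s. U k s n)" for k n
  proof (induction k arbitrary: n)
    case (Suc k)
    show ?case unfolding US
      by (intro continuous_intros indefinite_integral_continuous_1 integrable_continuous_real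
          nn_lipschitz_on_continuous_on[OF \<Phi> Suc]) auto
  qed (simp add: U0)
  have cont\<Phi>: "continuous_on {0..\<tau>} (\<lambda>s. \<Phi> (U k s) n)" for k n
    by (rule nn_lipschitz_on_continuous_on[OF \<Phi> cont UNIV_I])
  define N where "N = lp_norm p u0"
  have N: "0 \<le> N" using lp_norm_nonneg[OF u0 p] by (simp add: N_def)
  have step: "lp_le p (\<lambda>n. U (Suc k) t n - U k t n) (N / 2 ^ k * exp (2 * L * t))" if "t \<in> {0..\<tau>}" for k t
    using that
  proof (induction k arbitrary: t)
    case 0
    have "lp_le p (\<lambda>n. integral {0..t} (\<lambda>s. \<Phi> u0 n)) ((t - 0) * (L * N))"
      using 0 by (intro lp_le_integral_const p lip0) (auto simp: N_def intro: lp_le_lp_norm u0)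
    moreover have "0 \<le> L * t" using L 0 by simp
    then have "L * t \<le> exp (2 * L * t)" using exp_ge_add_one_self[of "2 * L * t"] by linarith
    then have "N * (L * t) \<le> N * exp (2 * L * t)" using N by (rule mult_left_mono)
    then have "(t - 0) * (L * N) \<le> N * exp (2 * L * t)" by (simp add: algebra_simps)
    ultimately show ?case by (auto simp: U0 US intro: lp_le_mono)
  next
    case (Suc k)
    let ?m = "N / 2 ^ k"
    have I: "((\<lambda>s. L * (?m * exp (2 * L * s))) has_integral (?m / 2 * exp (2 * L * t) - ?m / 2 * exp (2 * L * 0))) {0..t}"
      using Suc.prems L by (intro fundamental_theorem_of_calculus)
        (auto intro!: derivative_eq_intros simp flip: has_real_derivative_iff_has_vector_derivative)
    have "lp_le p (\<lambda>n. integral {0..t} (\<lambda>s. \<Phi> (U (Suc k) s) n - \<Phi> (U k s) n)) (integral {0..t} (\<lambda>s. L * (?m * exp (2 * L * s))))"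
      using Suc.prems
      by (intro lp_le_integral p lip Suc.IH continuous_intros continuous_on_subset[OF cont\<Phi>]) auto
    then have "lp_le p (\<lambda>n. integral {0..t} (\<lambda>s. \<Phi> (U (Suc k) s) n - \<Phi> (U k s) n)) (?m / 2 * exp (2 * L * t))"
      unfolding integral_unique[OF I] by (rule lp_le_mono) (use N in simp)
    moreover have "integral {0..t} (\<lambda>s. \<Phi> (U (Suc k) s) n - \<Phi> (U k s) n) = U (Suc (Suc k)) t n - U (Suc k) t n" for n
      unfolding US[of "Suc k"] US[of k, THEN fun_cong, THEN fun_cong, of t n]
      using Suc.prems by (subst integral_diff) (auto intro!: integrable_continuous_real continuous_on_subset[OF cont\<Phi>])
    ultimately show ?case by (simp add: field_simps)
  qed
  have sums: "lp_le p (\<lambda>n. U (k + j) t n - U k t n) (2 * N / 2 ^ k * exp (2 * L * t))" if t: "t \<in> {0..\<tau>}" for k j t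
  proof -
    have "lp_le p (\<lambda>n. U (k + j) t n - U k t n) (2 * N / 2 ^ k * (1 - 1 / 2 ^ j) * exp (2 * L * t))"
    proof (induction j)
      case (Suc j)
      have "lp_le p (\<lambda>n. (U (Suc (k + j)) t n - U (k + j) t n) + (U (k + j) t n - U k t n))
         (N / 2 ^ (k + j) * exp (2 * L * t) + 2 * N / 2 ^ k * (1 - 1 / 2 ^ j) * exp (2 * L * t))"
        by (intro lp_le_add p step Suc.IH t)
      then show ?case by (rule_tac lp_le_mono) (auto simp: power_add field_simps)
    qed (simp add: lp_0 p)
    moreover have "2 * N / 2 ^ k * (1 - 1 / 2 ^ j) \<le> 2 * N / 2 ^ k" using N by (intro mult_left_le) auto
    from mult_right_mono[OF this, of "exp (2 * L * t)"]
    have "2 * N / 2 ^ k * (1 - 1 / 2 ^ j) * exp (2 * L * t) \<le> 2 * N / 2 ^ k * exp (2 * L * t)" by simp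
    ultimately show ?thesis by (rule lp_le_mono)
  qed
  have null: "(\<lambda>k. 2 * N / 2 ^ k * exp (2 * L * t)) \<longlonglongrightarrow> 0" for t
  proof -
    have "(\<lambda>k. 2 * N / 2 ^ k * exp (2 * L * t)) \<longlonglongrightarrow> 0 * exp (2 * L * t)"
      by (intro tendsto_intros LIMSEQ_divide_realpow_zero) auto
    then show ?thesis by simp
  qed
  have "convergent (\<lambda>k. U k t n)" if t: "t \<in> {0..\<tau>}" for t n
  proof (rule Cauchy_convergent, rule CauchyI)
    fix e :: real assume e: "0 < e"
    from null[of t] e have "\<forall>\<^sub>F k in sequentially. 2 * N / 2 ^ k * exp (2 * L * t) < e / 2"
      by (intro order_tendstoD) auto
    then obtain k where k: "2 * N / 2 ^ k * exp (2 * L * t) < e / 2" by (auto simp: eventually_sequentially)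
    have near: "norm (U j t n - U k t n) < e / 2" if "j \<ge> k" for j
      using lp_le_component[OF p sums[OF t, of k "j - k"], of n] k that by auto
    have "norm (U i t n - U j t n) < e" if "i \<ge> k" "j \<ge> k" for i j
      using near[OF that(1)] near[OF that(2)] by (smt (verit) field_sum_of_halves norm_diff_triangle_less norm_minus_commute)
    then show "\<exists>M. \<forall>m\<ge>M. \<forall>na\<ge>M. norm (U m t n - U na t n) < e" by blast
  qed
  then have lim: "(\<lambda>k. U k t n) \<longlonglongrightarrow> lim (\<lambda>k. U k t n)" if "t \<in> {0..\<tau>}" for t n
    using that by (simp add: convergent_LIMSEQ_iff)
  define u where "u = (\<lambda>t n. lim (\<lambda>k. U k t n))"
  note lim = lim[folded u_def]
  have near: "lp_le p (\<lambda>n. u t n - U k t n) (2 * N / 2 ^ k * exp (2 * L * t))" if t: "t \<in> {0..\<tau>}" for t k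
  proof (rule lp_le_limit[OF p, where u = "\<lambda>j n. U (k + j) t n - U k t n"])
    show "(\<lambda>j. U (k + j) t n - U k t n) \<longlonglongrightarrow> u t n - U k t n" for n
      using LIMSEQ_ignore_initial_segment[OF lim[OF t, of n], of k]
      by (intro tendsto_intros) (simp add: add.commute u_def)
  qed (rule sums[OF t])
  have ucont: "continuous_on {0..\<tau>} (\<lambda>s. u s n)" for n
  proof (rule uniform_limit_theorem)
    show "\<forall>\<^sub>F k in sequentially. continuous_on {0..\<tau>} (\<lambda>s. U k s n)" using cont by simp
    show "uniform_limit {0..\<tau>} (\<lambda>k s. U k s n) (\<lambda>s. u s n) sequentially"
    proof (rule uniform_limitI)
      fix e :: real assume e: "0 < e"
      have "\<forall>\<^sub>F k in sequentially. 2 * N / 2 ^ k * exp (2 * L * \<tau>) < e"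
        using null[of \<tau>] e by (intro order_tendstoD) auto
      then show "\<forall>\<^sub>F k in sequentially. \<forall>s\<in>{0..\<tau>}. dist (U k s n) (u s n) < e"
      proof (rule eventually_mono, intro ballI)
        fix k s assume k: "2 * N / 2 ^ k * exp (2 * L * \<tau>) < e" and s: "s \<in> {0..\<tau>}"
        have "2 * N / 2 ^ k * exp (2 * L * s) \<le> 2 * N / 2 ^ k * exp (2 * L * \<tau>)"
          using s L N by (intro mult_left_mono) auto
        then show "dist (U k s n) (u s n) < e"
          using lp_le_component[OF p near[OF s, of k], of n] k by (simp add: dist_norm norm_minus_commute)
      qed
    qed
  qed auto
  have ucont\<Phi>: "continuous_on {0..\<tau>} (\<lambda>s. \<Phi> (u s) n)" for n
    by (rule nn_lipschitz_on_continuous_on[OF \<Phi> ucont UNIV_I])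
  have eq: "u t n = u0 n + integral {0..t} (\<lambda>s. \<Phi> (u s) n)" if t: "t \<in> {0..\<tau>}" for t n
  proof (rule LIMSEQ_unique)
    show "(\<lambda>k. U (Suc k) t n) \<longlonglongrightarrow> u t n" using LIMSEQ_Suc[OF lim[OF t, of n]] by (simp add: u_def)
    show "(\<lambda>k. U (Suc k) t n) \<longlonglongrightarrow> u0 n + integral {0..t} (\<lambda>s. \<Phi> (u s) n)"
    proof (rule LIM_zero_cancel, rule Lim_null_comparison)
      have "(\<lambda>k. t * (L * (2 * N / 2 ^ k * exp (2 * L * t)))) \<longlonglongrightarrow> t * (L * 0)"
        by (intro tendsto_intros null)
      then show "(\<lambda>k. t * (L * (2 * N / 2 ^ k * exp (2 * L * t)))) \<longlonglongrightarrow> 0" by simp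
      show "\<forall>\<^sub>F k in sequentially. norm (U (Suc k) t n - (u0 n + integral {0..t} (\<lambda>s. \<Phi> (u s) n)))
          \<le> t * (L * (2 * N / 2 ^ k * exp (2 * L * t)))"
      proof (intro always_eventually allI)
        fix k
        have "lp_le p (\<lambda>n. integral {0..t} (\<lambda>s. \<Phi> (u s) n - \<Phi> (U k s) n)) ((t - 0) * (L * (2 * N / 2 ^ k * exp (2 * L * t))))"
        proof (intro lp_le_integral_const p lip)
          fix s assume s: "s \<in> {0..t}"
          have "2 * N / 2 ^ k * exp (2 * L * s) \<le> 2 * N / 2 ^ k * exp (2 * L * t)"
            using s L N by (intro mult_left_mono) auto
          then show "lp_le p (\<lambda>n. u s n - U k s n) (2 * N / 2 ^ k * exp (2 * L * t))"
            using s t by (intro lp_le_mono[OF near]) auto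
        qed (use t in \<open>auto intro!: continuous_intros continuous_on_subset[OF cont\<Phi>] continuous_on_subset[OF ucont\<Phi>]\<close>)
        from lp_le_component[OF p this, of n]
        show "norm (U (Suc k) t n - (u0 n + integral {0..t} (\<lambda>s. \<Phi> (u s) n)))
          \<le> t * (L * (2 * N / 2 ^ k * exp (2 * L * t)))"
          using t by (subst (asm) integral_diff)
            (auto intro!: integrable_continuous_real continuous_on_subset[OF cont\<Phi>] continuous_on_subset[OF ucont\<Phi>]
              simp: US norm_minus_commute)
      qed
    qed
  qed
  have "solves_ivp p \<Phi> u0 \<tau> u"
  proof (rule solves_ivpI[OF p \<tau> \<Phi> u0 _ ucont _ eq])
    fix t assume t: "t \<in> {0..\<tau>}"
    have "lp_le p (\<lambda>n. (u t n - U 0 t n) + u0 n) (2 * N / 2 ^ 0 * exp (2 * L * t) + N)"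
      by (intro lp_le_add p near t) (simp add: N_def lp_le_lp_norm u0)
    then have "lp_le p (u t) (2 * N / 2 ^ 0 * exp (2 * L * t) + N)" by (simp add: U0)
    moreover have "2 * N / 2 ^ 0 * exp (2 * L * t) + N \<le> 2 * N * exp (2 * L * \<tau>) + N"
      using t L N by (auto intro!: mult_left_mono)
    ultimately show "lp_le p (\<Phi> (u t)) (L * (2 * N * exp (2 * L * \<tau>) + N))"
      by (intro lip0) (rule lp_le_mono)
  qed auto
  then show ?thesis using that by blast
qed

lemma solves_ivp_lp_le:
  fixes u0 :: "int \<Rightarrow> 'a::euclidean_space"
  assumes p: "1 \<le> p" and \<Phi>: "nn_lipschitz_on UNIV c \<Phi>" and \<Phi>0: "\<Phi> (\<lambda>_. 0) = (\<lambda>_. 0)" and c: "0 < c"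
    and u0: "lp_le p u0 N" and u: "solves_ivp p \<Phi> u0 \<tau> u" and t: "t \<in> {0..\<tau>}"
  shows "lp_le p (u t) (2 * N * exp (6 * c * t))"
proof -
  have "\<exists>c. nn_lipschitz_on (cball 0 R) c \<Phi>" for R using nn_lipschitz_on_subset[OF \<Phi>] by blast
  from solves_ivpE[OF p this u] obtain B where B: "\<And>t. t \<in> {0..\<tau>} \<Longrightarrow> lp_le p (u t) B"
    and c\<Phi>: "\<And>n. continuous_on {0..\<tau>} (\<lambda>s. \<Phi> (u s) n)"
    and eu: "\<And>t n. t \<in> {0..\<tau>} \<Longrightarrow> u t n = u0 n + integral {0..t} (\<lambda>s. \<Phi> (u s) n)"
    by metis
  have "lp_le p (u t) (2 * N * exp (2 * (3 * c) * t))"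
  proof (rule lp_gronwall[OF p _ eu _ c\<Phi> B _ t])
    show "lp_le p (\<Phi> (u s)) (3 * c * m)" if "lp_le p (u s) m" for s m
      using nn_lipschitz_on_lp_le[OF p \<Phi>, of "u s" "\<lambda>_. 0" m] that by (simp add: \<Phi>0)
  qed (use c u0 in auto)
  then show ?thesis by (simp add: algebra_simps)
qed

section \<open>The mean value of the force\<close>

text \<open>
  The functions that are multiples of \<open>|r|\<^sup>q\<close> on either side of the origin: \<open>V_alpha\<close>, its derivative
  \<open>half_powers \<alpha> (-km) kp\<close> and its second derivative all have this form. Writing them with \<open>max\<close> makes
  continuity at the origin evident for \<open>q > 0\<close>.
\<close>

definition half_powers :: "real \<Rightarrow> real \<Rightarrow> real \<Rightarrow> real \<Rightarrow> real" where
  "half_powers q a b r = a * max 0 (- r) powr q + b * max 0 r powr q"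

lemma half_powers_0 [simp]: "half_powers q a b 0 = 0"
  by (simp add: half_powers_def)

lemma continuous_on_half_powers [continuous_intros]:
  "0 < q \<Longrightarrow> continuous_on S g \<Longrightarrow> continuous_on S (\<lambda>x. half_powers q a b (g x))"
  unfolding half_powers_def by (intro continuous_intros continuous_on_powr') auto

lemma abs_half_powers_le: "\<bar>half_powers q a b r\<bar> \<le> (\<bar>a\<bar> + \<bar>b\<bar>) * \<bar>r\<bar> powr q"
  by (cases "r \<le> 0") (auto simp: half_powers_def max_def abs_mult algebra_simps)

lemma half_powers_mult: "0 \<le> c \<Longrightarrow> half_powers q a b (c * r) = c powr q * half_powers q a b r"
proof -
  assume c: "0 \<le> c"
  have "max 0 (- (c * r)) = c * max 0 (- r)" "max 0 (c * r) = c * max 0 r"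
    using c by (auto simp: max_mult_distrib_left)
  then show ?thesis using c by (simp add: half_powers_def powr_mult algebra_simps)
qed

lemma has_real_derivative_half_powers:
  assumes q: "1 < q"
  shows "(half_powers q a b has_real_derivative half_powers (q - 1) (- a * q) (b * q) r) (at r)"
proof -
  consider "r < 0" | "r = 0" | "r > 0" by linarith
  then show ?thesis
  proof cases
    case 1
    have "((\<lambda>r. a * (- r) powr q) has_real_derivative half_powers (q - 1) (- a * q) (b * q) r) (at r)"
      using 1 by (auto intro!: derivative_eq_intros simp: half_powers_def)
    then show ?thesis
      by (rule has_field_derivative_transform_within_open[where S = "{..<0}"])
        (use 1 in \<open>auto simp: half_powers_def\<close>)
  next
    case 3
    have "((\<lambda>r. b * r powr q) has_real_derivative half_powers (q - 1) (- a * q) (b * q) r) (at r)"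
      using 3 by (auto intro!: derivative_eq_intros simp: half_powers_def)
    then show ?thesis
      by (rule has_field_derivative_transform_within_open[where S = "{0<..}"])
        (use 3 in \<open>auto simp: half_powers_def\<close>)
  next
    case 2
    have "((\<lambda>h. half_powers q a b h / h) \<longlongrightarrow> 0) (at 0)"
    proof (rule Lim_null_comparison)
      have "((\<lambda>h. (\<bar>a\<bar> + \<bar>b\<bar>) * \<bar>h\<bar> powr (q - 1)) \<longlongrightarrow> (\<bar>a\<bar> + \<bar>b\<bar>) * \<bar>0\<bar> powr (q - 1)) (at (0::real))"
        using q by (intro tendsto_intros tendsto_powr') auto
      then show "((\<lambda>h. (\<bar>a\<bar> + \<bar>b\<bar>) * \<bar>h\<bar> powr (q - 1)) \<longlongrightarrow> 0) (at (0::real))" by simp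
      show "\<forall>\<^sub>F h in at 0. norm (half_powers q a b h / h) \<le> (\<bar>a\<bar> + \<bar>b\<bar>) * \<bar>h\<bar> powr (q - 1)"
        unfolding eventually_at_filter
      proof (intro always_eventually allI impI)
        fix h :: real assume h: "h \<noteq> 0"
        have "norm (half_powers q a b h / h) \<le> (\<bar>a\<bar> + \<bar>b\<bar>) * \<bar>h\<bar> powr q / \<bar>h\<bar>"
          using abs_half_powers_le[of q a b h] by (simp add: divide_right_mono)
        also have "\<bar>h\<bar> powr q / \<bar>h\<bar> = \<bar>h\<bar> powr (q - 1)" using h by (simp add: powr_diff)
        then have "(\<bar>a\<bar> + \<bar>b\<bar>) * \<bar>h\<bar> powr q / \<bar>h\<bar> = (\<bar>a\<bar> + \<bar>b\<bar>) * \<bar>h\<bar> powr (q - 1)"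
          by (metis times_divide_eq_right)
        finally show "norm (half_powers q a b h / h) \<le> (\<bar>a\<bar> + \<bar>b\<bar>) * \<bar>h\<bar> powr (q - 1)" .
      qed
    qed
    then show ?thesis using 2 by (simp add: DERIV_def)
  qed
qed

lemma V_alpha_eq: "V_alpha \<alpha> km kp = half_powers (\<alpha> + 1) (km / (1 + \<alpha>)) (kp / (1 + \<alpha>))"
  by (auto simp: fun_eq_iff V_alpha_def half_powers_def)

lemma deriv_power_lipschitz:
  fixes h h' :: "real \<Rightarrow> real"
  assumes h: "\<And>x. (h has_real_derivative h' x) (at x)"
    and le: "\<And>x. \<bar>x\<bar> \<le> r0 \<Longrightarrow> \<bar>h' x\<bar> \<le> C * \<bar>x\<bar> powr q"
    and q: "0 \<le> q" and C: "0 \<le> C" and R: "R \<le> r0" and x: "\<bar>x\<bar> \<le> R" and y: "\<bar>y\<bar> \<le> R"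
  shows "\<bar>h x - h y\<bar> \<le> C * R powr q * \<bar>x - y\<bar>"
proof -
  have "norm (h x - h y) \<le> C * R powr q * norm (x - y)"
  proof (rule field_differentiable_bound[of "cball 0 R"])
    fix z :: real assume z: "z \<in> cball 0 R"
    have "norm (h' z) \<le> C * \<bar>z\<bar> powr q" using le[of z] z R by simp
    also have "\<dots> \<le> C * R powr q" using z q C by (intro mult_left_mono powr_mono2) auto
    finally show "norm (h' z) \<le> C * R powr q" .
  qed (use h x y in \<open>auto intro: has_field_derivative_at_within\<close>)
  then show ?thesis by simp
qed

text \<open>
  The growth condition excludes the point \<open>0\<close> itself; continuity supplies the value there.
\<close>

lemma bigo_power_bound:
  fixes f :: "real \<Rightarrow> real"
  assumes f: "f \<in> O[at 0](\<lambda>r. \<bar>r\<bar> powr q)" and cont: "isCont f 0" and q: "0 < q"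
  obtains C r0 where "0 < C" "0 < r0" "r0 \<le> 1" "\<And>x. \<bar>x\<bar> \<le> r0 \<Longrightarrow> \<bar>f x\<bar> \<le> C * \<bar>x\<bar> powr q"
proof -
  obtain C where C: "0 < C" and ev: "\<forall>\<^sub>F x in at 0. norm (f x) \<le> C * norm (\<bar>x\<bar> powr q)"
    using f by (auto elim: landau_o.bigE)
  have "(f \<longlongrightarrow> 0) (at 0)"
  proof (rule Lim_null_comparison[OF ev])
    have "((\<lambda>x. C * norm (\<bar>x\<bar> powr q)) \<longlongrightarrow> C * norm (\<bar>0::real\<bar> powr q)) (at (0::real))"
      using q by (intro tendsto_intros tendsto_powr') auto
    then show "((\<lambda>x. C * norm (\<bar>x\<bar> powr q)) \<longlongrightarrow> 0) (at (0::real))" by simp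
  qed
  then have f0: "f 0 = 0" using cont by (auto simp: isCont_def intro: tendsto_unique[of "at (0::real)" f])
  obtain d where d: "d > 0" and dd: "\<And>x. x \<noteq> 0 \<Longrightarrow> dist x 0 < d \<Longrightarrow> norm (f x) \<le> C * norm (\<bar>x\<bar> powr q)"
    using ev unfolding eventually_at by auto
  show ?thesis
  proof (rule that[of C "min 1 (d / 2)"])
    fix x :: real assume "\<bar>x\<bar> \<le> min 1 (d / 2)"
    then show "\<bar>f x\<bar> \<le> C * \<bar>x\<bar> powr q" using dd[of x] d f0 by (cases "x = 0") auto
  qed (use C d in auto)
qed

lemma integral_shift_real:
  fixes f :: "real \<Rightarrow> 'a::euclidean_space"
  assumes "continuous_on {a + c..b + c} f"
  shows "integral {a..b} (\<lambda>x. f (x + c)) = integral {a + c..b + c} f"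
  using integral_shift[OF assms] by (simp add: o_def)

lemma integral_periodic_shift:
  fixes G :: "real \<Rightarrow> 'a::euclidean_space"
  assumes cont: "continuous_on UNIV G" and per: "\<And>x. G (x + T) = G x" and a: "0 \<le> a" "a \<le> T"
  shows "integral {0..T} (\<lambda>x. G (x + a)) = integral {0..T} G"
proof -
  have int: "G integrable_on {x..y}" for x y
    by (intro integrable_continuous_real continuous_on_subset[OF cont]) auto
  have "integral {0..T} (\<lambda>x. G (x + a)) = integral {a..T + a} G"
    using integral_shift_real[OF continuous_on_subset[OF cont], of 0 a T] by simp
  also have "\<dots> = integral {a..T} G + integral {T..T + a} G"
    using a by (intro Henstock_Kurzweil_Integration.integral_combine[symmetric] int) auto
  also have "integral {T..T + a} G = integral {0..a} (\<lambda>x. G (x + T))"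
    using integral_shift_real[OF continuous_on_subset[OF cont], of 0 T a] by (simp add: add.commute)
  also have "\<dots> = integral {0..a} G" by (simp add: per)
  also have "integral {a..T} G + integral {0..a} G = integral {0..T} G"
    using Henstock_Kurzweil_Integration.integral_combine[OF a int] by (simp add: add.commute)
  finally show ?thesis .
qed

text \<open>
  The value of the Wallis integral of \<open>cos\<^sup>\<alpha>\<^sup>+\<^sup>1\<close> over a half period on which the cosine is positive. The factor of
  \<open>omega0\<close> with the Gamma functions is this value divided by \<open>pi\<close>.
\<close>

definition cos_integral :: "real \<Rightarrow> real" where
  "cos_integral \<alpha> = sqrt pi * (\<alpha> * Gamma (\<alpha> / 2) / ((\<alpha> + 1) * Gamma ((\<alpha> + 1) / 2)))"

text \<open>
  The substitution \<open>t = (1 + sin s) / 2\<close> leads to a Beta integral with two equal exponents above \<open>0\<close>, whose integrand is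
  continuous up to the end points, unlike the one obtained from \<open>t = sin\<^sup>2 s\<close>. Legendre's duplication formula
  then removes \<open>Gamma (2 a)\<close>.
\<close>

lemma has_integral_cos_power:
  assumes \<alpha>: "0 < \<alpha>"
  shows "((\<lambda>s. max 0 (cos s) powr (\<alpha> + 1)) has_integral cos_integral \<alpha>) {3 * pi / 2..5 * pi / 2}"
proof -
  define a where "a = \<alpha> / 2 + 1"
  have a: "a > 1" using \<alpha> by (simp add: a_def)
  define F where "F = (\<lambda>t::real. t powr (a - 1) * (1 - t) powr (a - 1))"
  define g where "g = (\<lambda>s::real. (1 + sin s) / 2)"
  have s3: "sin (3 * pi / 2) = -1" using sin_3over2_pi by simp
  have s5: "sin (5 * pi / 2) = 1"
  proof -
    have "sin (5 * pi / 2) = sin (pi / 2 + 2 * pi)" by (intro arg_cong[of _ _ sin]) simp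
    also have "\<dots> = 1" by (simp only: sin_periodic) simp
    finally show ?thesis .
  qed
  have cos0: "cos s \<ge> 0" if "s \<in> {3 * pi / 2..5 * pi / 2}" for s
  proof -
    have "cos (s - 2 * pi) \<ge> 0" using that by (intro cos_ge_zero) auto
    then show ?thesis by (simp add: cos_diff)
  qed
  have "((\<lambda>s. (cos s / 2) *\<^sub>R F (g s)) has_integral integral {g (3 * pi / 2)..g (5 * pi / 2)} F) {3 * pi / 2..5 * pi / 2}"
  proof (rule has_integral_substitution[where c = 0 and d = 1])
    show "g (3 * pi / 2) \<le> g (5 * pi / 2)" by (simp add: g_def s3 s5)
    show "g ` {3 * pi / 2..5 * pi / 2} \<subseteq> {0..1}"
      using sin_ge_minus_one sin_le_one by (auto simp: g_def intro: add_nonneg_nonneg) (smt (verit) sin_ge_minus_one)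
    show "continuous_on {0..1} F" unfolding F_def using a
      by (intro continuous_intros continuous_on_powr') auto
  qed (auto simp: g_def intro!: derivative_eq_intros)
  also have "integral {g (3 * pi / 2)..g (5 * pi / 2)} F = Beta a a"
    using has_integral_Beta_real[of a a] a by (simp add: g_def s3 s5 F_def integral_unique)
  finally have I: "((\<lambda>s. (cos s / 2) *\<^sub>R F (g s)) has_integral Beta a a) {3 * pi / 2..5 * pi / 2}" .
  have "((\<lambda>s. 2 powr (2 * a - 1) * ((cos s / 2) *\<^sub>R F (g s))) has_integral 2 powr (2 * a - 1) * Beta a a) {3 * pi / 2..5 * pi / 2}"
    by (rule has_integral_mult_right[OF I])
  then have J: "((\<lambda>s. max 0 (cos s) powr (\<alpha> + 1)) has_integral 2 powr (2 * a - 1) * Beta a a) {3 * pi / 2..5 * pi / 2}"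
  proof (rule has_integral_eq[rotated])
    fix s assume s: "s \<in> {3 * pi / 2..5 * pi / 2}"
    note c = cos0[OF s]
    have "F (g s) = (g s * (1 - g s)) powr (a - 1)"
      unfolding F_def g_def using sin_ge_minus_one[of s] sin_le_one[of s] by (subst powr_mult) auto
    also have "g s * (1 - g s) = (cos s / 2) powr 2"
    proof -
      have "g s * (1 - g s) = (1 - (sin s)\<^sup>2) / 4" by (simp add: g_def power2_eq_square field_simps)
      also have "\<dots> = (cos s / 2)\<^sup>2" by (simp add: cos_squared_eq power_divide)
      finally show ?thesis using c by simp
    qed
    also have "(\<dots>) powr (a - 1) = (cos s / 2) powr (2 * a - 2)"
      by (simp add: powr_powr algebra_simps)
    finally have "(cos s / 2) * F (g s) = (cos s / 2) powr (2 * a - 1)"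
      using powr_mult_base[of "cos s / 2" "2 * a - 2"] c by simp
    also have "\<dots> = cos s powr (2 * a - 1) / 2 powr (2 * a - 1)" using c by (simp add: powr_divide)
    finally show "2 powr (2 * a - 1) * ((cos s / 2) *\<^sub>R F (g s)) = max 0 (cos s) powr (\<alpha> + 1)"
      using c by (simp add: a_def max_def add.commute)
  qed
  have "2 powr (2 * a - 1) * Beta a a = cos_integral \<alpha>"
  proof -
    have npos: "x \<notin> \<int>\<^sub>\<le>\<^sub>0" if "x > 0" for x :: real
      using that nonpos_Ints_nonpos[of x] by linarith
    have nz: "Gamma a \<noteq> 0" "Gamma (2 * a) \<noteq> 0" "Gamma (a + 1 / 2) \<noteq> 0"
      using a Gamma_real_pos[of a] Gamma_real_pos[of "2 * a"] Gamma_real_pos[of "a + 1 / 2"] by linarith+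
    have D: "Gamma a * Gamma (a + 1 / 2) = exp ((1 - 2 * a) * ln 2) * sqrt pi * Gamma (2 * a)"
    proof -
      have nonpos: "complex_of_real x \<notin> \<int>\<^sub>\<le>\<^sub>0" if "x > 0" for x
        using that nonpos_Ints_nonpos[of x] by (auto simp: of_real_in_nonpos_Ints_iff)
      have "Gamma (complex_of_real a) * Gamma (complex_of_real a + 1 / 2)
          = exp ((1 - 2 * complex_of_real a) * of_real (ln 2)) * of_real (sqrt pi) * Gamma (2 * complex_of_real a)"
        using a nonpos[of a] nonpos[of "a + 1 / 2"] by (intro Gamma_legendre_duplication) auto
      also have "complex_of_real a + 1 / 2 = of_real (a + 1 / 2)" by simp
      also have "2 * complex_of_real a = of_real (2 * a)" by simp
      also have "exp ((1 - of_real (2 * a)) * of_real (ln 2)) = complex_of_real (exp ((1 - 2 * a) * ln 2))"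
        by (simp flip: exp_of_real)
      finally show ?thesis
        unfolding Gamma_complex_of_real of_real_mult[symmetric] of_real_eq_iff .
    qed
    also have "exp ((1 - 2 * a) * ln 2) = inverse (2 powr (2 * a - 1))"
      by (simp add: powr_def flip: exp_minus) (simp add: algebra_simps)
    finally have "2 powr (2 * a - 1) = sqrt pi * Gamma (2 * a) / (Gamma a * Gamma (a + 1 / 2))"
      using nz by (simp add: divide_simps mult_ac)
    then have "2 powr (2 * a - 1) * Beta a a = sqrt pi * Gamma a / Gamma (a + 1 / 2)"
      using nz by (simp add: Beta_def flip: mult_2)
    also have "Gamma a = (\<alpha> / 2) * Gamma (\<alpha> / 2)"
      using Gamma_plus1[of "\<alpha> / 2"] npos[of "\<alpha> / 2"] \<alpha> by (simp add: a_def)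
    also have "Gamma (a + 1 / 2) = ((\<alpha> + 1) / 2) * Gamma ((\<alpha> + 1) / 2)"
      using Gamma_plus1[of "(\<alpha> + 1) / 2"] npos[of "(\<alpha> + 1) / 2"] \<alpha> by (simp add: a_def add_divide_distrib algebra_simps)
    finally show ?thesis by (simp add: cos_integral_def)
  qed
  with J show ?thesis by simp
qed

lemma integral_cos_power:
  assumes \<alpha>: "0 < \<alpha>"
  shows "integral {0..2 * pi} (\<lambda>s. max 0 (cos s) powr (\<alpha> + 1)) = cos_integral \<alpha>"
proof -
  define \<Phi> where "\<Phi> = (\<lambda>s. max 0 (cos s) powr (\<alpha> + 1))"
  have cont: "continuous_on UNIV \<Phi>" unfolding \<Phi>_def using \<alpha> by (intro continuous_intros continuous_on_powr') auto
  have int: "\<Phi> integrable_on {x..y}" for x y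
    by (intro integrable_continuous_real continuous_on_subset[OF cont]) auto
  have "integral {0..2 * pi} \<Phi> = integral {0..2 * pi} (\<lambda>x. \<Phi> (x + pi / 2))"
    by (rule integral_periodic_shift[OF cont, symmetric]) (auto simp: \<Phi>_def)
  also have "\<dots> = integral {pi / 2..5 * pi / 2} \<Phi>"
    using integral_shift_real[OF continuous_on_subset[OF cont], of 0 "pi / 2" "2 * pi"] by (simp add: field_simps)
  also have "\<dots> = integral {pi / 2..3 * pi / 2} \<Phi> + integral {3 * pi / 2..5 * pi / 2} \<Phi>"
    by (intro Henstock_Kurzweil_Integration.integral_combine[symmetric] int) auto
  also have "integral {pi / 2..3 * pi / 2} \<Phi> = integral {pi / 2..3 * pi / 2} (\<lambda>_. 0)"
  proof (rule integral_cong)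
    fix s assume "s \<in> {pi / 2..3 * pi / 2}"
    then have "cos (s - pi) \<ge> 0" by (intro cos_ge_zero) auto
    then show "\<Phi> s = 0" by (simp add: \<Phi>_def cos_diff)
  qed
  also have "integral {3 * pi / 2..5 * pi / 2} \<Phi> = cos_integral \<alpha>"
    using has_integral_cos_power[OF \<alpha>] by (simp add: \<Phi>_def integral_unique)
  finally show ?thesis by (simp add: \<Phi>_def)
qed

text \<open>The function \<open>f\<close> of the amplitude equation at a single site.\<close>

definition amp :: "real \<Rightarrow> real \<Rightarrow> real \<Rightarrow> complex \<Rightarrow> complex" where
  "amp \<alpha> km kp c = of_real (omega0 \<alpha> km kp) * c * of_real (norm c powr (\<alpha> - 1))"

text \<open>
  The displacement \<open>x\<^sub>n\<close> at time \<open>s\<close> of an oscillator with amplitude \<open>c\<close>.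
\<close>

definition osc :: "real \<Rightarrow> complex \<Rightarrow> real" where
  "osc s c = sqrt 2 * Re (c * cis s)"

lemma osc_diff: "osc s (a - b) = osc s a - osc s b"
  by (simp add: osc_def algebra_simps)

lemma abs_osc_le: "\<bar>osc s c\<bar> \<le> sqrt 2 * norm c"
  using abs_Re_le_cmod[of "c * cis s"] by (simp add: osc_def abs_mult norm_mult)

text \<open>
  The case of a unit real amplitude. The imaginary part is the integral of the derivative of \<open>s \<mapsto> V_alpha (cos s)\<close> and
  vanishes by periodicity. In the real part the two half periods contribute the same cosine integral, weighted by \<open>kp\<close>
  and \<open>km\<close>.
\<close>

lemma has_integral_averaged_force:
  fixes \<alpha> km kp :: real
  assumes \<alpha>: "0 < \<alpha>"
  defines "G \<equiv> \<lambda>x. cis (- x) * of_real (half_powers \<alpha> (- km) kp (cos x))"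
  shows "(G has_integral of_real ((km + kp) * cos_integral \<alpha>)) {0..2 * pi}"
proof -
  define \<Phi> where "\<Phi> = (\<lambda>s::real. max 0 (cos s) powr (\<alpha> + 1))"
  have cont: "continuous_on UNIV \<Phi>" unfolding \<Phi>_def using \<alpha> by (intro continuous_intros continuous_on_powr') auto
  have c1: "continuous_on {0..2 * pi} \<Phi>" "continuous_on {0..2 * pi} (\<lambda>x. \<Phi> (x + pi))"
    by (intro continuous_on_subset[OF cont] continuous_on_compose2[OF cont] continuous_intros; simp)+
  have R: "((\<lambda>x. km * \<Phi> (x + pi) + kp * \<Phi> x) has_integral (km * cos_integral \<alpha> + kp * cos_integral \<alpha>)) {0..2 * pi}"
  proof (intro has_integral_add has_integral_mult_right)
    show "(\<Phi> has_integral cos_integral \<alpha>) {0..2 * pi}"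
      using integral_cos_power[OF \<alpha>] c1 by (simp add: \<Phi>_def has_integral_iff integrable_continuous_real)
    have "integral {0..2 * pi} (\<lambda>x. \<Phi> (x + pi)) = integral {0..2 * pi} \<Phi>"
      by (rule integral_periodic_shift[OF cont]) (auto simp: \<Phi>_def)
    then show "((\<lambda>x. \<Phi> (x + pi)) has_integral cos_integral \<alpha>) {0..2 * pi}"
      using integral_cos_power[OF \<alpha>] c1 by (simp add: \<Phi>_def has_integral_iff integrable_continuous_real)
  qed
  have I: "((\<lambda>x. half_powers \<alpha> (- km) kp (cos x) * (- sin x)) has_integral
      (half_powers (\<alpha> + 1) (km / (\<alpha> + 1)) (kp / (\<alpha> + 1)) (cos (2 * pi))
        - half_powers (\<alpha> + 1) (km / (\<alpha> + 1)) (kp / (\<alpha> + 1)) (cos 0))) {0..2 * pi}"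
  proof (rule fundamental_theorem_of_calculus)
    fix x :: real
    have "((\<lambda>x. half_powers (\<alpha> + 1) (km / (\<alpha> + 1)) (kp / (\<alpha> + 1)) (cos x)) has_real_derivative
        half_powers (\<alpha> + 1 - 1) (- (km / (\<alpha> + 1)) * (\<alpha> + 1)) (kp / (\<alpha> + 1) * (\<alpha> + 1)) (cos x) * (- sin x)) (at x within {0..2 * pi})"
      using \<alpha> by (intro DERIV_chain2[OF has_real_derivative_half_powers])
        (auto intro!: derivative_eq_intros)
    then show "((\<lambda>x. half_powers (\<alpha> + 1) (km / (\<alpha> + 1)) (kp / (\<alpha> + 1)) (cos x)) has_vector_derivative
        half_powers \<alpha> (- km) kp (cos x) * (- sin x)) (at x within {0..2 * pi})"
      using \<alpha> by (simp add: has_real_derivative_iff_has_vector_derivative)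
  qed auto
  have "((\<lambda>x. complex_of_real (km * \<Phi> (x + pi) + kp * \<Phi> x) + \<i> * complex_of_real (half_powers \<alpha> (- km) kp (cos x) * (- sin x)))
      has_integral (of_real (km * cos_integral \<alpha> + kp * cos_integral \<alpha>) + \<i> * of_real 0)) {0..2 * pi}"
    using I by (intro has_integral_add has_integral_mult_right has_integral_of_real R) simp
  moreover have "complex_of_real (km * \<Phi> (x + pi) + kp * \<Phi> x) + \<i> * complex_of_real (half_powers \<alpha> (- km) kp (cos x) * (- sin x)) = G x" for x
  proof (rule complex_eqI)
    have "cos x * half_powers \<alpha> (- km) kp (cos x) = km * max 0 (- cos x) powr (\<alpha> + 1) + kp * max 0 (cos x) powr (\<alpha> + 1)"
      using \<alpha> by (cases "cos x \<le> 0") (auto simp: half_powers_def max_def powr_add)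
    then show "Re (complex_of_real (km * \<Phi> (x + pi) + kp * \<Phi> x) + \<i> * complex_of_real (half_powers \<alpha> (- km) kp (cos x) * (- sin x))) = Re (G x)"
      by (simp add: G_def \<Phi>_def)
  qed (simp add: G_def)
  ultimately show ?thesis by (simp add: algebra_simps)
qed

text \<open>
  The mean value of the force of \<open>V_alpha\<close> in amplitude coordinates is \<open>f\<close>. For \<open>c = \<rho> cis \<theta>\<close> homogeneity extracts
  \<open>(\<surd>2 \<rho>)\<^sup>\<alpha>\<close> and a shift of time by \<open>\<theta>\<close> extracts \<open>cis \<theta>\<close>.
\<close>

lemma has_integral_averaged_oscillation:
  assumes \<alpha>: "0 < \<alpha>"
  shows "((\<lambda>s. cis (- s) * of_real (half_powers \<alpha> (- km) kp (osc s c) / sqrt 2))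
    has_integral of_real (2 * pi) * amp \<alpha> km kp c) {0..2 * pi}"
proof (cases "c = 0")
  case True
  then show ?thesis by (simp add: amp_def osc_def)
next
  case False
  define G where "G = (\<lambda>x. cis (- x) * of_real (half_powers \<alpha> (- km) kp (cos x)))"
  define \<theta> where "\<theta> = Arg2pi c"
  define \<rho> where "\<rho> = norm c"
  have c: "c = of_real \<rho> * cis \<theta>" and \<theta>: "0 \<le> \<theta>" "\<theta> \<le> 2 * pi"
    using Arg2pi[of c] by (auto simp: \<rho>_def \<theta>_def is_Arg_def cis_conv_exp)
  have \<rho>: "\<rho> > 0" using False by (simp add: \<rho>_def)
  have cont: "continuous_on UNIV G" unfolding G_def using \<alpha> by (intro continuous_intros)
  have "integral {0..2 * pi} (\<lambda>x. G (x + \<theta>)) = integral {0..2 * pi} G"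
    by (rule integral_periodic_shift[OF cont _ \<theta>]) (simp add: G_def complex_eq_iff cos_diff sin_diff)
  also have "\<dots> = of_real ((km + kp) * cos_integral \<alpha>)"
    using has_integral_averaged_force[OF \<alpha>, of km kp] by (simp add: G_def integral_unique)
  finally have "((\<lambda>x. G (x + \<theta>)) has_integral of_real ((km + kp) * cos_integral \<alpha>)) {0..2 * pi}"
    by (simp add: has_integral_iff integrable_continuous_real continuous_on_compose2[OF cont] continuous_intros)
  from has_integral_mult_right[OF this, of "cis \<theta> * of_real ((sqrt 2 * \<rho>) powr \<alpha> / sqrt 2)"]
  have "((\<lambda>x. cis \<theta> * of_real ((sqrt 2 * \<rho>) powr \<alpha> / sqrt 2) * G (x + \<theta>)) has_integral
      cis \<theta> * of_real ((sqrt 2 * \<rho>) powr \<alpha> / sqrt 2) * of_real ((km + kp) * cos_integral \<alpha>)) {0..2 * pi}" .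
  moreover have "cis \<theta> * of_real ((sqrt 2 * \<rho>) powr \<alpha> / sqrt 2) * G (x + \<theta>)
      = cis (- x) * of_real (half_powers \<alpha> (- km) kp (osc x c) / sqrt 2)" for x
  proof -
    have "osc x c = (sqrt 2 * \<rho>) * cos (x + \<theta>)"
      by (simp add: osc_def c cos_add algebra_simps)
    then have "half_powers \<alpha> (- km) kp (osc x c) = (sqrt 2 * \<rho>) powr \<alpha> * half_powers \<alpha> (- km) kp (cos (x + \<theta>))"
      using \<rho> by (simp add: half_powers_mult)
    moreover have "cis \<theta> * cis (- (x + \<theta>)) = cis (- x)" by (simp add: cis_mult)
    ultimately show ?thesis by (simp add: G_def algebra_simps)
  qed
  moreover have "cis \<theta> * of_real ((sqrt 2 * \<rho>) powr \<alpha> / sqrt 2) * of_real ((km + kp) * cos_integral \<alpha>)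
      = of_real (2 * pi) * amp \<alpha> km kp c"
  proof -
    define X where "X = \<alpha> * Gamma (\<alpha> / 2) / ((\<alpha> + 1) * Gamma ((\<alpha> + 1) / 2))"
    have s2: "sqrt 2 = 2 powr (1 / 2)" by (simp add: powr_half_sqrt)
    have pp: "pi = sqrt pi * sqrt pi" by simp
    have e1: "(sqrt 2 * \<rho>) powr \<alpha> / sqrt 2 = 2 powr ((\<alpha> - 1) / 2) * \<rho> powr \<alpha>"
      using \<rho> by (simp add: powr_mult s2 powr_powr powr_diff diff_divide_distrib)
    have e2: "2 powr ((\<alpha> - 1) / 2) = 2 * 2 powr ((\<alpha> - 3) / 2)"
      by (simp add: powr_mult_base field_simps)
    have om: "omega0 \<alpha> km kp = (km + kp) * 2 powr ((\<alpha> - 3) / 2) * (X / sqrt pi)"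
      by (simp add: omega0_def X_def)
    have "(sqrt 2 * \<rho>) powr \<alpha> / sqrt 2 * ((km + kp) * cos_integral \<alpha>)
        = 2 * (sqrt pi * sqrt pi) * omega0 \<alpha> km kp * \<rho> powr \<alpha>"
    proof -
      have *: "2 * P * q * (m * (r * X)) = 2 * (r * r) * (m * P * (X / r)) * q" if "r \<noteq> 0" for P q m r :: real
        using that by (simp add: field_simps)
      show ?thesis unfolding e1 e2 om cos_integral_def X_def[symmetric] by (rule *) simp
    qed
    also have "\<rho> powr \<alpha> = \<rho> * \<rho> powr (\<alpha> - 1)" using \<rho> by (simp add: powr_mult_base)
    finally have e: "(sqrt 2 * \<rho>) powr \<alpha> / sqrt 2 * ((km + kp) * cos_integral \<alpha>)
        = 2 * pi * omega0 \<alpha> km kp * (\<rho> * \<rho> powr (\<alpha> - 1))" by simp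
    have "cis \<theta> * of_real ((sqrt 2 * \<rho>) powr \<alpha> / sqrt 2) * of_real ((km + kp) * cos_integral \<alpha>)
        = cis \<theta> * of_real ((sqrt 2 * \<rho>) powr \<alpha> / sqrt 2 * ((km + kp) * cos_integral \<alpha>))"
      by (simp only: of_real_mult mult.assoc)
    also have "\<dots> = of_real (2 * pi) * amp \<alpha> km kp c"
      unfolding e amp_def \<rho>_def[symmetric] by (subst c) (simp add: algebra_simps)
    finally show ?thesis .
  qed
  ultimately show ?thesis by simp
qed

lemma half_powers_lipschitz:
  assumes \<alpha>: "1 < \<alpha>" and x: "\<bar>x\<bar> \<le> R" and y: "\<bar>y\<bar> \<le> R"
  shows "\<bar>half_powers \<alpha> a b x - half_powers \<alpha> a b y\<bar> \<le> (\<bar>a\<bar> + \<bar>b\<bar>) * \<alpha> * R powr (\<alpha> - 1) * \<bar>x - y\<bar>"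
proof (rule deriv_power_lipschitz[OF has_real_derivative_half_powers[OF \<alpha>] _ _ _ order_refl x y])
  show "\<bar>half_powers (\<alpha> - 1) (- a * \<alpha>) (b * \<alpha>) x\<bar> \<le> (\<bar>a\<bar> + \<bar>b\<bar>) * \<alpha> * \<bar>x\<bar> powr (\<alpha> - 1)" for x
    using abs_half_powers_le[of "\<alpha> - 1" "- a * \<alpha>" "b * \<alpha>" x] \<alpha> by (simp add: abs_mult algebra_simps)
qed (use \<alpha> in auto)

text \<open>
  The Lipschitz constant on the ball of radius \<open>R\<close> is \<open>lip_amp \<alpha> km kp * R powr (\<alpha> - 1)\<close>, for the force in amplitude
  coordinates and consequently for its mean value.
\<close>

definition lip_amp :: "real \<Rightarrow> real \<Rightarrow> real \<Rightarrow> real" where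
  "lip_amp \<alpha> km kp = (\<bar>km\<bar> + \<bar>kp\<bar>) * \<alpha> * sqrt 2 powr (\<alpha> - 1)"

lemma oscillation_lipschitz:
  assumes \<alpha>: "1 < \<alpha>" and c: "norm c \<le> R" and d: "norm d \<le> R"
  shows "norm (cis (- s) * of_real (half_powers \<alpha> (- km) kp (osc s c) / sqrt 2)
      - cis (- s) * of_real (half_powers \<alpha> (- km) kp (osc s d) / sqrt 2)) \<le> lip_amp \<alpha> km kp * R powr (\<alpha> - 1) * norm (c - d)"
proof -
  have R: "0 \<le> R" using c norm_ge_zero order_trans by blast
  have "norm (cis (- s) * of_real (half_powers \<alpha> (- km) kp (osc s c) / sqrt 2)
      - cis (- s) * of_real (half_powers \<alpha> (- km) kp (osc s d) / sqrt 2))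
    = norm (cis (- s) * of_real ((half_powers \<alpha> (- km) kp (osc s c) - half_powers \<alpha> (- km) kp (osc s d)) / sqrt 2))"
    by (simp add: algebra_simps diff_divide_distrib)
  also have "\<dots> = \<bar>half_powers \<alpha> (- km) kp (osc s c) - half_powers \<alpha> (- km) kp (osc s d)\<bar> / sqrt 2"
    unfolding norm_mult norm_cis norm_of_real by simp
  also have "\<dots> \<le> ((\<bar>- km\<bar> + \<bar>kp\<bar>) * \<alpha> * (sqrt 2 * R) powr (\<alpha> - 1) * \<bar>osc s c - osc s d\<bar>) / sqrt 2"
    using \<alpha> c d abs_osc_le[of s c] abs_osc_le[of s d]
    by (intro divide_right_mono half_powers_lipschitz) (auto elim!: order_trans)
  also have "\<dots> \<le> ((\<bar>- km\<bar> + \<bar>kp\<bar>) * \<alpha> * (sqrt 2 * R) powr (\<alpha> - 1) * (sqrt 2 * norm (c - d))) / sqrt 2"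
    using \<alpha> abs_osc_le[of s "c - d"] by (intro divide_right_mono mult_left_mono) (auto simp: osc_diff)
  also have "\<dots> = lip_amp \<alpha> km kp * R powr (\<alpha> - 1) * norm (c - d)"
    using R by (simp add: lip_amp_def powr_mult)
  finally show ?thesis .
qed

lemma amp_lipschitz:
  assumes \<alpha>: "1 < \<alpha>" and c: "norm c \<le> R" and d: "norm d \<le> R"
  shows "norm (amp \<alpha> km kp c - amp \<alpha> km kp d) \<le> lip_amp \<alpha> km kp * R powr (\<alpha> - 1) * norm (c - d)"
proof -
  have "0 < \<alpha>" using \<alpha> by simp
  note I = has_integral_averaged_oscillation[OF this, of km kp]
  have "norm (of_real (2 * pi) * amp \<alpha> km kp c - of_real (2 * pi) * amp \<alpha> km kp d)
      \<le> (lip_amp \<alpha> km kp * R powr (\<alpha> - 1) * norm (c - d)) * measure lborel (cbox 0 (2 * pi))"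
    using has_integral_diff[OF I[of c] I[of d]] oscillation_lipschitz[OF \<alpha> c d] \<alpha>
    by (intro has_integral_bound[where f = "\<lambda>s. cis (- s) * of_real (half_powers \<alpha> (- km) kp (osc s c) / sqrt 2)
      - cis (- s) * of_real (half_powers \<alpha> (- km) kp (osc s d) / sqrt 2)"]) (auto simp: lip_amp_def)
  also have "norm (of_real (2 * pi) * amp \<alpha> km kp c - of_real (2 * pi) * amp \<alpha> km kp d)
      = 2 * pi * norm (amp \<alpha> km kp c - amp \<alpha> km kp d)"
    by (simp add: right_diff_distrib[symmetric] norm_mult)
  finally show ?thesis by (simp add: algebra_simps)
qed

lemma amp_0 [simp]: "amp \<alpha> km kp 0 = 0"
  by (simp add: amp_def)

section \<open>The amplitude equation\<close>

definition amp_lattice :: "(complex \<Rightarrow> complex) \<Rightarrow> (int \<Rightarrow> complex) \<Rightarrow> int \<Rightarrow> complex" where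
  "amp_lattice f A n = (f (A (n + 1) - A n) - f (A n - A (n - 1))) / \<i>"

lemma amplitude_field_eq: "amplitude_field \<alpha> km kp = amp_lattice (amp \<alpha> km kp)"
  by (simp add: fun_eq_iff amplitude_field_def amplitude_f_def amp_lattice_def amp_def delta_plus_def delta_minus_def)

lemma nn_lipschitz_on_amp_lattice:
  assumes f: "\<And>c d. c \<in> S \<Longrightarrow> d \<in> S \<Longrightarrow> norm (f c - f d) \<le> K * norm (c - d)" and K: "0 \<le> K"
    and S: "\<And>a b. a \<in> B \<Longrightarrow> b \<in> B \<Longrightarrow> a - b \<in> S"
  shows "nn_lipschitz_on B (2 * K) (amp_lattice f)"
  unfolding nn_lipschitz_on_def
proof (intro conjI allI impI)
  fix u v :: "int \<Rightarrow> complex" and n :: int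
  assume u: "\<forall>n. u n \<in> B" and v: "\<forall>n. v n \<in> B"
  have d: "norm (f (u i - u j) - f (v i - v j)) \<le> K * (norm (u i - v i) + norm (u j - v j))" for i j
  proof -
    have "norm (f (u i - u j) - f (v i - v j)) \<le> K * norm ((u i - u j) - (v i - v j))"
      using u v by (intro f S) auto
    also have "(u i - u j) - (v i - v j) = (u i - v i) - (u j - v j)" by simp
    also have "K * norm \<dots> \<le> K * (norm (u i - v i) + norm (u j - v j))"
      using K by (intro mult_left_mono norm_triangle_ineq4)
    finally show ?thesis .
  qed
  have "amp_lattice f u n - amp_lattice f v n
      = ((f (u (n + 1) - u n) - f (v (n + 1) - v n)) - (f (u n - u (n - 1)) - f (v n - v (n - 1)))) / \<i>"
    unfolding amp_lattice_def diff_divide_distrib[symmetric] by (simp add: algebra_simps)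
  then have "norm (amp_lattice f u n - amp_lattice f v n)
      \<le> norm (f (u (n + 1) - u n) - f (v (n + 1) - v n)) + norm (f (u n - u (n - 1)) - f (v n - v (n - 1)))"
    by (simp only: norm_divide norm_ii div_by_1 norm_triangle_ineq4)
  also have "\<dots> \<le> K * (norm (u (n + 1) - v (n + 1)) + norm (u n - v n)) + K * (norm (u n - v n) + norm (u (n - 1) - v (n - 1)))"
    by (intro add_mono d)
  also have "\<dots> \<le> 2 * K * (norm (u (n - 1) - v (n - 1)) + norm (u n - v n) + norm (u (n + 1) - v (n + 1)))"
    using K by (simp add: algebra_simps)
  finally show "norm (amp_lattice f u n - amp_lattice f v n)
      \<le> 2 * K * (norm (u (n - 1) - v (n - 1)) + norm (u n - v n) + norm (u (n + 1) - v (n + 1)))" .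
qed (use K in simp)

lemma lip_amp_nonneg: "1 < \<alpha> \<Longrightarrow> 0 \<le> lip_amp \<alpha> km kp"
  by (simp add: lip_amp_def)

lemma lip_amp_pos: "1 < \<alpha> \<Longrightarrow> (km, kp) \<noteq> (0, 0) \<Longrightarrow> 0 < lip_amp \<alpha> km kp"
  by (auto simp: lip_amp_def intro!: mult_pos_pos)

lemma nn_lipschitz_on_amplitude_field:
  assumes \<alpha>: "1 < \<alpha>"
  shows "\<exists>c. nn_lipschitz_on (cball 0 R) c (amplitude_field \<alpha> km kp)"
  unfolding amplitude_field_eq
proof (rule exI, rule nn_lipschitz_on_amp_lattice)
  show "norm (amp \<alpha> km kp c - amp \<alpha> km kp d) \<le> lip_amp \<alpha> km kp * (R + R) powr (\<alpha> - 1) * norm (c - d)"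
    if "c \<in> cball 0 (R + R)" "d \<in> cball 0 (R + R)" for c d
    using that by (intro amp_lipschitz \<alpha>) auto
  show "a - b \<in> cball 0 (R + R)" if "a \<in> cball 0 R" "b \<in> cball 0 R" for a b :: complex
    using that norm_triangle_ineq4[of a b] by auto
qed (simp add: lip_amp_nonneg \<alpha>)

text \<open>
  Projection to a ball: it does not increase distances, so composition with it makes a locally Lipschitz
  function globally Lipschitz with the constant of the ball.
\<close>

definition cutoff :: "real \<Rightarrow> 'a::euclidean_space \<Rightarrow> 'a" where
  "cutoff R = closest_point (cball 0 R)"

lemma norm_cutoff: "0 \<le> R \<Longrightarrow> norm (cutoff R x) \<le> R"
  using closest_point_in_set[of "cball 0 R" x] by (auto simp: cutoff_def)

lemma cutoff_lipschitz: "0 \<le> R \<Longrightarrow> norm (cutoff R x - cutoff R y) \<le> norm (x - y)"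
  using closest_point_lipschitz[of "cball 0 R" x y] by (simp add: cutoff_def dist_norm)

lemma cutoff_eq: "norm x \<le> R \<Longrightarrow> cutoff R x = x"
  by (simp add: cutoff_def closest_point_self)

lemma cutoff_0: "0 \<le> R \<Longrightarrow> cutoff R 0 = 0"
  by (simp add: cutoff_eq)

lemma sum_norm_powr_le:
  assumes c: "lp_le (ereal q) c M" and q: "1 \<le> q" "q \<le> r" and S: "finite S"
  shows "(\<Sum>n\<in>S. norm (c n) powr r) \<le> M powr r"
proof -
  have M: "0 \<le> M" using lp_le_nonneg[OF _ c] q by simp
  have cM: "norm (c n) \<le> M" for n using lp_le_component[OF _ c] q by simp
  have "(\<Sum>n\<in>S. norm (c n) powr r) \<le> (\<Sum>n\<in>S. M powr (r - q) * norm (c n) powr q)"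
  proof (rule sum_mono)
    fix n
    have "norm (c n) powr r = norm (c n) powr (r - q) * norm (c n) powr q"
      by (simp flip: powr_add)
    also have "\<dots> \<le> M powr (r - q) * norm (c n) powr q"
      using q cM by (intro mult_right_mono powr_mono2) auto
    finally show "norm (c n) powr r \<le> M powr (r - q) * norm (c n) powr q" .
  qed
  also have "\<dots> = M powr (r - q) * (\<Sum>n\<in>S. norm (c n) powr q)" by (simp add: sum_distrib_left)
  also have "\<dots> \<le> M powr (r - q) * M powr q"
    using c S q M by (intro mult_left_mono) (auto simp: lp_le_finite_iff)
  also have "\<dots> = M powr r" by (simp flip: powr_add)
  finally show ?thesis .
qed

lemma sum_int_telescope:
  fixes b :: "int \<Rightarrow> real"
  shows "(\<Sum>n=- int N..int N. b n - b (n - 1)) = b (int N) - b (- int N - 1)"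
proof (induction N)
  case (Suc N)
  have "(\<Sum>n=- int (Suc N)..int (Suc N). b n - b (n - 1))
      = (\<Sum>n\<in>insert (- int N - 1) (insert (int N + 1) {- int N..int N}). b n - b (n - 1))"
    by (rule sum.cong) auto
  also have "\<dots> = (b (- int N - 1) - b (- int N - 2)) + ((b (int N + 1) - b (int N)) + (b (int N) - b (- int N - 1)))"
  proof -
    have e: "- int N - 1 - 1 = - int N - 2" "int N + 1 - 1 = int N" by simp_all
    show ?thesis
      by (subst sum.insert, simp, simp, subst sum.insert, simp, simp, unfold Suc e, rule refl)
  qed
  also have "\<dots> = b (int (Suc N)) - b (- int (Suc N) - 1)"
  proof -
    have e: "- int (Suc N) - 1 = - int N - 2" by simp
    show ?thesis unfolding e by (simp add: add.commute)
  qed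
  finally show ?case .
qed simp

text \<open>
  Where \<open>c\<close> vanishes the norm is not differentiable. Writing \<open>|c|\<^sup>\<alpha>\<^sup>+\<^sup>1\<close> as the power
  \<open>(\<alpha> + 1) / 2 > 1\<close> of the smooth function \<open>c \<bullet> c\<close> avoids a case distinction.
\<close>

lemma has_real_derivative_norm_powr:
  fixes c :: "real \<Rightarrow> complex"
  assumes \<alpha>: "1 < \<alpha>" and c: "(c has_vector_derivative c') (at t within S)"
  shows "((\<lambda>s. norm (c s) powr (\<alpha> + 1)) has_real_derivative
    (\<alpha> + 1) * ((of_real (norm (c t) powr (\<alpha> - 1)) * c t) \<bullet> c')) (at t within S)"
proof -
  have eq: "norm z powr (\<alpha> + 1) = half_powers ((\<alpha> + 1) / 2) 0 1 (z \<bullet> z)" for z :: complex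
  proof -
    have "z \<bullet> z = norm z powr 2" by (simp add: dot_square_norm)
    then have "(z \<bullet> z) powr ((\<alpha> + 1) / 2) = norm z powr (2 * ((\<alpha> + 1) / 2))" by (simp only: powr_powr)
    also have "2 * ((\<alpha> + 1) / 2) = \<alpha> + 1" by simp
    finally show ?thesis by (simp add: half_powers_def max_def)
  qed
  have d: "((\<lambda>s. c s \<bullet> c s) has_real_derivative 2 * (c t \<bullet> c')) (at t within S)"
    using has_derivative_inner[OF c[unfolded has_vector_derivative_def] c[unfolded has_vector_derivative_def]]
    unfolding has_field_derivative_def
    by (rule has_derivative_eq_rhs) (auto simp: fun_eq_iff inner_commute algebra_simps)
  have "((\<lambda>s. half_powers ((\<alpha> + 1) / 2) 0 1 (c s \<bullet> c s)) has_real_derivative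
      half_powers ((\<alpha> + 1) / 2 - 1) (- 0 * ((\<alpha> + 1) / 2)) (1 * ((\<alpha> + 1) / 2)) (c t \<bullet> c t) * (2 * (c t \<bullet> c'))) (at t within S)"
    using \<alpha> by (intro DERIV_chain2[OF has_real_derivative_half_powers d]) auto
  also have "half_powers ((\<alpha> + 1) / 2 - 1) (- 0 * ((\<alpha> + 1) / 2)) (1 * ((\<alpha> + 1) / 2)) (c t \<bullet> c t) * (2 * (c t \<bullet> c'))
      = (\<alpha> + 1) * (norm (c t) powr (\<alpha> - 1) * (c t \<bullet> c'))"
  proof -
    have "c t \<bullet> c t = norm (c t) powr 2" by (simp add: dot_square_norm)
    then have "(c t \<bullet> c t) powr ((\<alpha> + 1) / 2 - 1) = norm (c t) powr (2 * ((\<alpha> + 1) / 2 - 1))" by (simp only: powr_powr)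
    also have "2 * ((\<alpha> + 1) / 2 - 1) = \<alpha> - 1" by (simp add: field_simps)
    finally show ?thesis by (simp add: half_powers_def max_def)
  qed
  also have "norm (c t) powr (\<alpha> - 1) * (c t \<bullet> c') = (of_real (norm (c t) powr (\<alpha> - 1)) * c t) \<bullet> c'"
    by (simp add: inner_complex_def algebra_simps)
  finally show ?thesis by (simp only: eq)
qed

text \<open>
  Conservation of \<open>\<Sum>\<^sub>n |c\<^sub>n|\<^sup>1\<^sup>+\<^sup>\<alpha>\<close>, where \<open>c = \<delta>\<^sup>-A\<close>. With \<open>g = |c|\<^sup>\<alpha>\<^sup>-\<^sup>1 c\<close> one has
  \<open>A\<^sub>n' = -\<i> \<omega>\<^sub>0 (g\<^sub>n\<^sub>+\<^sub>1 - g\<^sub>n)\<close>, which is orthogonal to \<open>g\<^sub>n\<^sub>+\<^sub>1 - g\<^sub>n\<close>; the energy at a site therefore changes by the difference of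
  the fluxes \<open>b\<^sub>n = g\<^sub>n\<^sub>+\<^sub>1 \<bullet> A\<^sub>n'\<close> and a finite sum changes by boundary terms only. The fluxes are summable over the
  sites because \<open>2 \<alpha> \<ge> 1 + \<alpha> \<ge> q\<close>, so the boundary terms tend to zero.
\<close>

lemma energy_bound:
  fixes u :: "real \<Rightarrow> int \<Rightarrow> complex"
  assumes \<alpha>: "1 < \<alpha>" and q: "1 \<le> q" "q \<le> 1 + \<alpha>" and u0: "lp_le (ereal q) u0 N"
    and B: "\<And>t. t \<in> {0..\<tau>} \<Longrightarrow> lp_le (ereal q) (u t) B"
    and cont: "\<And>n. continuous_on {0..\<tau>} (\<lambda>s. u s n)"
    and u: "\<And>t n. t \<in> {0..\<tau>} \<Longrightarrow> u t n = u0 n + integral {0..t} (\<lambda>s. amp_lattice (amp \<alpha> km kp) (u s) n)"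
    and t: "t \<in> {0..\<tau>}"
  shows "norm (u t m - u t (m - 1)) \<le> 2 * N"
proof -
  have p: "(1::ereal) \<le> ereal q" using q by simp
  have N: "0 \<le> N" using lp_le_nonneg[OF p u0] .
  have B0: "0 \<le> B" using lp_le_nonneg[OF p B[OF t]] .
  define \<omega> where "\<omega> = omega0 \<alpha> km kp"
  define c where "c = (\<lambda>t n. u t n - u t (n - 1))"
  define g where "g = (\<lambda>t n. of_real (norm (c t n) powr (\<alpha> - 1)) * c t n)"
  define v where "v = (\<lambda>t n. amp_lattice (amp \<alpha> km kp) (u t) n)"
  define b where "b = (\<lambda>t n. g t (n + 1) \<bullet> v t n)"
  have v_eq: "v t n = of_real \<omega> * (g t (n + 1) - g t n) / \<i>" for t n
    by (simp add: v_def amp_lattice_def amp_def g_def c_def \<omega>_def algebra_simps diff_divide_distrib)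
  have contc: "continuous_on {0..\<tau>} (\<lambda>s. c s n)" for n unfolding c_def by (intro continuous_intros cont)
  have contg: "continuous_on {0..\<tau>} (\<lambda>s. g s n)" for n unfolding g_def
    using \<alpha> by (intro continuous_intros contc continuous_on_powr') auto
  have contv: "continuous_on {0..\<tau>} (\<lambda>s. v s n)" for n unfolding v_eq by (intro continuous_intros contg) auto
  have contb: "continuous_on {0..\<tau>} (\<lambda>s. b s n)" for n unfolding b_def by (intro continuous_intros contg contv)
  have sub: "{0..t} \<subseteq> {0..\<tau>}" using t by (auto intro: order_trans)
  have du: "((\<lambda>s. u s n) has_vector_derivative v s n) (at s within {0..t})" if s: "s \<in> {0..t}" for s n
  proof (rule has_vector_derivative_transform[OF s])
    have "((\<lambda>s. integral {0..s} (\<lambda>s. v s n)) has_vector_derivative v s n) (at s within {0..t})"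
      by (intro integral_has_vector_derivative continuous_on_subset[OF contv sub] s)
    then show "((\<lambda>s. u0 n + integral {0..s} (\<lambda>s. v s n)) has_vector_derivative v s n) (at s within {0..t})"
      by (auto intro!: derivative_eq_intros)
    show "u s n = u0 n + integral {0..s} (\<lambda>s. v s n)" if "s \<in> {0..t}" for s
      using that sub by (auto simp: v_def intro!: u)
  qed
  \<comment> \<open>\<open>v s n\<close> is \<open>-\<i> \<omega>\<close> times a difference of \<open>g\<close>, hence orthogonal to it in the real inner product.\<close>
  have flux: "g s n \<bullet> (v s n - v s (n - 1)) = b s n - b s (n - 1)" for s n
  proof -
    have "(g s (n + 1) - g s n) \<bullet> v s n = 0"
      unfolding v_eq by (simp add: inner_complex_def divide_complex_def algebra_simps)
    then show ?thesis by (simp add: b_def inner_diff_left inner_diff_right)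
  qed
  define E where "E = (\<lambda>K s. \<Sum>n=- int K..int K. norm (c s n) powr (\<alpha> + 1))"
  have energy: "((\<lambda>s. (\<alpha> + 1) * (b s (int K) - b s (- int K - 1))) has_integral (E K t - E K 0)) {0..t}" for K
  proof (rule fundamental_theorem_of_calculus)
    fix s assume s: "s \<in> {0..t}"
    have "(E K has_real_derivative (\<Sum>n=- int K..int K. (\<alpha> + 1) * (g s n \<bullet> (v s n - v s (n - 1))))) (at s within {0..t})"
      unfolding E_def g_def c_def
      by (intro DERIV_sum has_real_derivative_norm_powr[OF \<alpha>] has_vector_derivative_diff du s)
    also have "(\<Sum>n=- int K..int K. (\<alpha> + 1) * (g s n \<bullet> (v s n - v s (n - 1)))) = (\<alpha> + 1) * (b s (int K) - b s (- int K - 1))"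
      unfolding flux sum_distrib_left[symmetric] sum_int_telescope ..
    finally show "(E K has_vector_derivative (\<alpha> + 1) * (b s (int K) - b s (- int K - 1))) (at s within {0..t})"
      by (simp add: has_real_derivative_iff_has_vector_derivative)
  qed (use t in auto)
  define \<beta> where "\<beta> = (\<lambda>n. integral {0..t} (\<lambda>s. \<bar>b s n\<bar>))"
  have ib: "(\<lambda>s. \<bar>b s n\<bar>) integrable_on {0..t}" for n
    by (intro integrable_continuous_real continuous_on_subset[OF _ sub] continuous_intros contb)
  have \<beta>0: "0 \<le> \<beta> n" for n unfolding \<beta>_def by (intro integral_nonneg ib) auto
  define C where "C = 4 * \<bar>\<omega>\<bar> * (2 * B) powr (2 * \<alpha>)"
  have sumb: "(\<Sum>n\<in>S. \<bar>b s n\<bar>) \<le> C" if s: "s \<in> {0..t}" and S: "finite S" for s S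
  proof -
    have cB: "lp_le (ereal q) (c s) (2 * B)"
      unfolding c_def using lp_le_diff[OF p B lp_le_shift[OF p B, of s "-1"], of s] s sub by auto
    have gn: "(norm (g s n))\<^sup>2 = norm (c s n) powr (2 * \<alpha>)" for n
    proof -
      have "norm (g s n) = norm (c s n) * norm (c s n) powr (\<alpha> - 1)"
        by (simp add: g_def norm_mult)
      also have "\<dots> = norm (c s n) powr \<alpha>" by (simp add: powr_mult_base)
      finally show ?thesis by (simp add: powr_powr mult.commute flip: powr_numeral)
    qed
    have "\<bar>b s n\<bar> \<le> 2 * \<bar>\<omega>\<bar> * (norm (c s (n + 1)) powr (2 * \<alpha>) + norm (c s n) powr (2 * \<alpha>))" for n
    proof -
      have "\<bar>b s n\<bar> \<le> norm (g s (n + 1)) * norm (v s n)" unfolding b_def by (rule Cauchy_Schwarz_ineq2)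
      also have "\<dots> \<le> norm (g s (n + 1)) * (\<bar>\<omega>\<bar> * (norm (g s (n + 1)) + norm (g s n)))"
        unfolding v_eq by (intro mult_left_mono) (auto simp: norm_mult norm_divide intro!: mult_left_mono norm_triangle_ineq4)
      also have "\<dots> = \<bar>\<omega>\<bar> * (norm (g s (n + 1)) * norm (g s (n + 1)) + norm (g s (n + 1)) * norm (g s n))"
        by (simp add: algebra_simps)
      also have "\<dots> \<le> \<bar>\<omega>\<bar> * (2 * ((norm (g s (n + 1)))\<^sup>2 + (norm (g s n))\<^sup>2))"
      proof (intro mult_left_mono)
        have "x * x + x * y \<le> 2 * (x\<^sup>2 + y\<^sup>2)" for x y :: real
        proof -
          have "0 \<le> x * x - 2 * (x * y) + y * y"
            using zero_le_power2[of "x - y"] by (simp add: power2_eq_square algebra_simps)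
          moreover have "0 \<le> x * x" "0 \<le> y * y" by simp_all
          moreover have "a + c \<le> 2 * (a + b)" if "0 \<le> a - 2 * c + b" "0 \<le> a" "0 \<le> b" for a b c :: real
            using that by simp
          ultimately show ?thesis unfolding power2_eq_square by blast
        qed
        then show "norm (g s (n + 1)) * norm (g s (n + 1)) + norm (g s (n + 1)) * norm (g s n)
            \<le> 2 * ((norm (g s (n + 1)))\<^sup>2 + (norm (g s n))\<^sup>2)" .
      qed auto
      finally show ?thesis by (simp add: gn algebra_simps)
    qed
    then have "(\<Sum>n\<in>S. \<bar>b s n\<bar>)
        \<le> (\<Sum>n\<in>S. 2 * \<bar>\<omega>\<bar> * (norm (c s (n + 1)) powr (2 * \<alpha>) + norm (c s n) powr (2 * \<alpha>)))"
      by (intro sum_mono)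
    also have "\<dots> = 2 * \<bar>\<omega>\<bar> * ((\<Sum>n\<in>S. norm (c s (n + 1)) powr (2 * \<alpha>)) + (\<Sum>n\<in>S. norm (c s n) powr (2 * \<alpha>)))"
      unfolding sum_distrib_left[symmetric] sum.distrib ..
    also have "\<dots> \<le> 2 * \<bar>\<omega>\<bar> * ((2 * B) powr (2 * \<alpha>) + (2 * B) powr (2 * \<alpha>))"
      using q \<alpha> S by (intro mult_left_mono add_mono sum_norm_powr_le[OF _ q(1)] cB lp_le_shift[OF p cB]) auto
    finally show ?thesis by (simp add: C_def)
  qed
  have sum\<beta>: "(\<Sum>n\<in>S. \<beta> n) \<le> t * C" if S: "finite S" for S
  proof -
    have "(\<Sum>n\<in>S. \<beta> n) = integral {0..t} (\<lambda>s. \<Sum>n\<in>S. \<bar>b s n\<bar>)"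
      unfolding \<beta>_def by (rule integral_sum[symmetric]) (use S ib in auto)
    also have "\<dots> \<le> integral {0..t} (\<lambda>s. C)"
      using S by (intro integral_le integrable_sum ib sumb) auto
    finally show ?thesis using t by (simp add: mult.commute)
  qed
  \<comment> \<open>The integrated fluxes have bounded partial sums, hence tend to zero in both directions.\<close>
  have null: "(\<lambda>K. \<beta> (h K)) \<longlonglongrightarrow> 0" if h: "inj h" for h :: "nat \<Rightarrow> int"
  proof (rule summable_LIMSEQ_zero, rule summableI_nonneg_bounded)
    fix n
    have "(\<Sum>K<n. \<beta> (h K)) = (\<Sum>k\<in>h ` {..<n}. \<beta> k)"
      using h by (subst sum.reindex) (auto intro: inj_on_subset)
    also have "\<dots> \<le> t * C" by (rule sum\<beta>) simp
    finally show "(\<Sum>K<n. \<beta> (h K)) \<le> t * C" .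
  qed (rule \<beta>0)
  have E0: "E K 0 \<le> (2 * N) powr (\<alpha> + 1)" for K
  proof -
    have "u 0 n = u0 n" for n using u[of 0 n] t by simp
    then have "lp_le (ereal q) (c 0) (2 * N)"
      unfolding c_def using lp_le_diff[OF p u0 lp_le_shift[OF p u0, of "-1"]] by simp
    then show ?thesis unfolding E_def using q by (intro sum_norm_powr_le[OF _ q(1)]) auto
  qed
  have EK: "E K t \<le> (2 * N) powr (\<alpha> + 1) + (\<alpha> + 1) * (\<beta> (int K) + \<beta> (- int K - 1))" for K
  proof -
    have "E K t - E K 0 = integral {0..t} (\<lambda>s. (\<alpha> + 1) * (b s (int K) - b s (- int K - 1)))"
      by (rule integral_unique[OF energy, symmetric])
    also have "\<dots> \<le> integral {0..t} (\<lambda>s. (\<alpha> + 1) * (\<bar>b s (int K)\<bar> + \<bar>b s (- int K - 1)\<bar>))"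
    proof (rule integral_le)
      show "(\<lambda>s. (\<alpha> + 1) * (b s (int K) - b s (- int K - 1))) integrable_on {0..t}"
        using energy[of K] by blast
      show "(\<lambda>s. (\<alpha> + 1) * (\<bar>b s (int K)\<bar> + \<bar>b s (- int K - 1)\<bar>)) integrable_on {0..t}"
        by (intro integrable_continuous_real continuous_on_subset[OF _ sub] continuous_intros contb)
    qed (use \<alpha> in \<open>auto intro!: mult_left_mono\<close>)
    also have "\<dots> = (\<alpha> + 1) * (\<beta> (int K) + \<beta> (- int K - 1))"
      unfolding \<beta>_def by (simp add: integral_add ib)
    finally show ?thesis using E0[of K] by simp
  qed
  have "norm (c t m) powr (\<alpha> + 1) \<le> (2 * N) powr (\<alpha> + 1)"
  proof (rule LIMSEQ_le_const)
    have "(\<lambda>K. (2 * N) powr (\<alpha> + 1) + (\<alpha> + 1) * (\<beta> (int K) + \<beta> (- int K - 1)))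
        \<longlonglongrightarrow> (2 * N) powr (\<alpha> + 1) + (\<alpha> + 1) * (0 + 0)"
      by (intro tendsto_intros null) (auto simp: inj_on_def)
    then show "(\<lambda>K. (2 * N) powr (\<alpha> + 1) + (\<alpha> + 1) * (\<beta> (int K) + \<beta> (- int K - 1))) \<longlonglongrightarrow> (2 * N) powr (\<alpha> + 1)"
      by simp
    show "\<exists>K0. \<forall>K\<ge>K0. norm (c t m) powr (\<alpha> + 1) \<le> (2 * N) powr (\<alpha> + 1) + (\<alpha> + 1) * (\<beta> (int K) + \<beta> (- int K - 1))"
    proof (intro exI allI impI)
      fix K assume "K \<ge> nat \<bar>m\<bar>"
      then have "norm (c t m) powr (\<alpha> + 1) \<le> E K t"
        unfolding E_def by (intro member_le_sum) auto
      also note EK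
      finally show "norm (c t m) powr (\<alpha> + 1) \<le> (2 * N) powr (\<alpha> + 1) + (\<alpha> + 1) * (\<beta> (int K) + \<beta> (- int K - 1))" .
    qed
  qed
  then have "norm (c t m) \<le> 2 * N"
    using powr_less_mono2[of "\<alpha> + 1" "2 * N" "norm (c t m)"] N \<alpha> by fastforce
  then show ?thesis by (simp add: c_def)
qed

lemma cutoff_amplitude:
  assumes \<alpha>: "1 < \<alpha>" and p: "1 \<le> p" and \<tau>: "0 \<le> \<tau>" and A0: "lp_le p A0 N" and R: "0 < R" and km: "(km, kp) \<noteq> (0, 0)"
  defines "K \<equiv> lip_amp \<alpha> km kp * R powr (\<alpha> - 1)"
  obtains A where "solves_ivp p (amp_lattice (amp \<alpha> km kp \<circ> cutoff R)) A0 \<tau> A"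
    "\<And>t. t \<in> {0..\<tau>} \<Longrightarrow> lp_le p (A t) (2 * N * exp (12 * K * t))"
    "\<And>n. continuous_on {0..\<tau>} (\<lambda>s. A s n)"
    "\<And>n. continuous_on {0..\<tau>} (\<lambda>s. amp_lattice (amp \<alpha> km kp \<circ> cutoff R) (A s) n)"
    "\<And>t n. t \<in> {0..\<tau>} \<Longrightarrow> A t n = A0 n + integral {0..t} (\<lambda>s. amp_lattice (amp \<alpha> km kp \<circ> cutoff R) (A s) n)"
    "nn_lipschitz_on UNIV (2 * K) (amp_lattice (amp \<alpha> km kp \<circ> cutoff R))"
proof -
  let ?\<Phi> = "amp_lattice (amp \<alpha> km kp \<circ> cutoff R)"
  have K: "0 < K" using lip_amp_pos[OF \<alpha> km] R by (simp add: K_def)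
  have \<Phi>: "nn_lipschitz_on UNIV (2 * K) ?\<Phi>"
  proof (rule nn_lipschitz_on_amp_lattice)
    fix c d :: complex
    have "norm (amp \<alpha> km kp (cutoff R c) - amp \<alpha> km kp (cutoff R d)) \<le> K * norm (cutoff R c - cutoff R d)"
      unfolding K_def using R by (intro amp_lipschitz \<alpha> norm_cutoff) auto
    also have "\<dots> \<le> K * norm (c - d)" using K R by (intro mult_left_mono cutoff_lipschitz) auto
    finally show "norm ((amp \<alpha> km kp \<circ> cutoff R) c - (amp \<alpha> km kp \<circ> cutoff R) d) \<le> K * norm (c - d)" by simp
  qed (use K in auto)
  have \<Phi>0: "?\<Phi> (\<lambda>_. 0) = (\<lambda>_. 0)" by (simp add: amp_lattice_def fun_eq_iff)
  from picard_existence[OF p \<tau> \<Phi> \<Phi>0 lp_leD(1)[OF A0]] obtain A where A: "solves_ivp p ?\<Phi> A0 \<tau> A" .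
  have loc: "\<exists>c. nn_lipschitz_on (cball 0 R) c ?\<Phi>" for R using nn_lipschitz_on_subset[OF \<Phi>] by blast
  have b: "lp_le p (A t) (2 * N * exp (12 * K * t))" if "t \<in> {0..\<tau>}" for t
    using solves_ivp_lp_le[OF p \<Phi> \<Phi>0 _ A0 A that] K by simp
  show ?thesis
    by (rule solves_ivpE[OF p loc A]) (rule that[OF A b _ _ _ \<Phi>])
qed

text \<open>
  The energy bound holds for the true equation only, that is as long as the cutoff is inactive, and it leaves a margin of a
  factor \<open>2\<close>. All differences move with speed at most \<open>2 \<Lambda>\<close>, uniformly in \<open>n\<close>. A time step \<open>h\<close> is therefore
  too short to use up the margin, and the bound propagates from step to step.
\<close>

lemma cutoff_amplitude_inactive:
  fixes A :: "real \<Rightarrow> int \<Rightarrow> complex"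
  assumes \<alpha>: "1 < \<alpha>" and q: "1 \<le> q" "q \<le> 1 + \<alpha>" and \<tau>: "0 \<le> \<tau>" and A0: "lp_le (ereal q) A0 N" and N: "0 < N"
    and R: "4 * N \<le> R"
    and cA: "\<And>n. continuous_on {0..\<tau>} (\<lambda>s. A s n)"
    and B: "\<And>t. t \<in> {0..\<tau>} \<Longrightarrow> lp_le (ereal q) (A t) B"
    and \<Phi>: "nn_lipschitz_on UNIV k (amp_lattice (amp \<alpha> km kp \<circ> cutoff R))"
    and A: "\<And>t n. t \<in> {0..\<tau>} \<Longrightarrow> A t n = A0 n + integral {0..t} (\<lambda>s. amp_lattice (amp \<alpha> km kp \<circ> cutoff R) (A s) n)"
    and t: "t \<in> {0..\<tau>}"
  shows "norm (A t n - A t (n - 1)) \<le> 2 * N"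
proof -
  let ?\<Phi> = "amp_lattice (amp \<alpha> km kp \<circ> cutoff R)"
  have p: "(1::ereal) \<le> ereal q" using q by simp
  have k: "0 \<le> k" using \<Phi> by (simp add: nn_lipschitz_on_def)
  have B0: "0 \<le> B" using lp_le_nonneg[OF p B[OF t]] .
  have cont: "continuous_on {0..\<tau>} (\<lambda>s. ?\<Phi> (A s) n)" for n
    by (rule nn_lipschitz_on_continuous_on[OF \<Phi> cA UNIV_I])
  have R0: "0 \<le> R" using N R by simp
  have \<Phi>0: "?\<Phi> (\<lambda>_. 0) = (\<lambda>_. 0)" using R0 by (simp add: amp_lattice_def fun_eq_iff cutoff_0)
  define \<Lambda> where "\<Lambda> = 3 * k * B + 1"
  have \<Lambda>: "0 < \<Lambda>" using k B0 by (simp add: \<Lambda>_def add_nonneg_pos)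
  have bnd: "lp_le (ereal q) (?\<Phi> (A s)) \<Lambda>" if "s \<in> {0..\<tau>}" for s
    using nn_lipschitz_on_lp_le[OF p \<Phi>, of "A s" "\<lambda>_. 0" B] B[OF that] \<Phi>0
    by (auto simp: \<Lambda>_def intro: lp_le_mono)
  have time_lip: "lp_le (ereal q) (\<lambda>n. A s n - A r n) (\<Lambda> * \<bar>s - r\<bar>)" if "r \<in> {0..\<tau>}" "s \<in> {0..\<tau>}" for r s
    by (rule lp_le_time_lipschitz[OF p, where v = "\<lambda>s. ?\<Phi> (A s)", OF cont bnd A that])
  have move: "norm (A s n - A s (n - 1)) \<le> norm (A r n - A r (n - 1)) + 2 * \<Lambda> * \<bar>s - r\<bar>"
    if "r \<in> {0..\<tau>}" "s \<in> {0..\<tau>}" for r s n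
  proof -
    have "norm (A s m - A r m) \<le> \<Lambda> * \<bar>s - r\<bar>" for m
      using lp_le_component[OF p time_lip[OF that]] .
    from this[of n] this[of "n - 1"]
    have "norm ((A s n - A r n) - (A s (n - 1) - A r (n - 1))) \<le> 2 * \<Lambda> * \<bar>s - r\<bar>"
      using norm_triangle_ineq4[of "A s n - A r n" "A s (n - 1) - A r (n - 1)"] by simp
    moreover have "A s n - A s (n - 1) = (A r n - A r (n - 1)) + ((A s n - A r n) - (A s (n - 1) - A r (n - 1)))"
      by simp
    ultimately show ?thesis
      using norm_triangle_ineq[of "A r n - A r (n - 1)" "(A s n - A r n) - (A s (n - 1) - A r (n - 1))"] by simp
  qed
  define h where "h = N / \<Lambda>"
  have h: "0 < h" and \<Lambda>h: "2 * \<Lambda> * h = 2 * N" using N \<Lambda> by (auto simp: h_def)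
  have steps: "norm (A s n - A s (n - 1)) \<le> 2 * N" if "s \<in> {0..\<tau>}" "s \<le> real j * h" for s j n
    using that
  proof (induction j arbitrary: s n)
    case 0
    then have "A s n = A0 n" for n using A[of s n] by simp
    then have "norm (A s n) \<le> N" for n using lp_le_component[OF p A0] by simp
    from this[of n] this[of "n - 1"] show ?case using norm_triangle_ineq4[of "A s n" "A s (n - 1)"] by simp
  next
    case (Suc j)
    have inside: "norm (A r n - A r (n - 1)) \<le> R" if r: "r \<in> {0..s}" for r n
    proof (cases "r \<le> real j * h")
      case True
      then have "norm (A r n - A r (n - 1)) \<le> 2 * N" using Suc.IH[of r n] r Suc.prems by simp
      then show ?thesis using R N by simp
    next
      case False
      have "norm (A r n - A r (n - 1)) \<le> norm (A (real j * h) n - A (real j * h) (n - 1)) + 2 * \<Lambda> * \<bar>r - real j * h\<bar>"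
        using False r h Suc.prems by (intro move) (auto intro: order_trans)
      also have "\<dots> \<le> 2 * N + 2 * \<Lambda> * h"
        using False r h Suc.prems \<Lambda> by (intro add_mono Suc.IH mult_left_mono) (auto simp: algebra_simps)
      finally show ?thesis using \<Lambda>h R by simp
    qed
    have true_field: "?\<Phi> (A r) n = amp_lattice (amp \<alpha> km kp) (A r) n" if "r \<in> {0..s}" for r n
      using inside[OF that, of n] inside[OF that, of "n + 1"] by (simp add: amp_lattice_def cutoff_eq)
    show ?case
    proof (rule energy_bound[OF \<alpha> q A0, where \<tau> = s])
      show "lp_le (ereal q) (A t) B" if "t \<in> {0..s}" for t using that Suc.prems by (intro B) auto
      show "continuous_on {0..s} (\<lambda>s. A s n)" for n using Suc.prems by (intro continuous_on_subset[OF cA]) auto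
      show "A t n = A0 n + integral {0..t} (\<lambda>s. amp_lattice (amp \<alpha> km kp) (A s) n)" if "t \<in> {0..s}" for t n
      proof -
        have "integral {0..t} (\<lambda>s. ?\<Phi> (A s) n) = integral {0..t} (\<lambda>s. amp_lattice (amp \<alpha> km kp) (A s) n)"
          using that by (intro integral_cong true_field) auto
        then show ?thesis using A[of t n] that Suc.prems by simp
      qed
    qed (use Suc.prems in auto)
  qed
  obtain j where "t / h \<le> real j" using real_arch_simple by blast
  then have "t \<le> real j * h" using h by (simp add: field_simps)
  then show ?thesis using steps[OF t] by blast
qed

lemma solves_ivp_cong:
  assumes u: "solves_ivp p \<Phi> u0 \<tau> u" and eq: "\<And>t. t \<in> {0..\<tau>} \<Longrightarrow> \<Phi> (u t) = \<Psi> (u t)"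
  shows "solves_ivp p \<Psi> u0 \<tau> u"
  using u eq by (auto simp: solves_ivp_def)

text \<open>
  The exponential rate in the a priori bound of the amplitude, in the slow time \<open>\<epsilon>\<^sup>\<alpha>\<^sup>-\<^sup>1 t\<close>, for a cutoff at \<open>8 \<epsilon>\<close>.
\<close>

definition amp_rate :: "real \<Rightarrow> real \<Rightarrow> real \<Rightarrow> real" where
  "amp_rate \<alpha> km kp = 12 * lip_amp \<alpha> km kp * 8 powr (\<alpha> - 1)"

text \<open>
  For large \<open>p\<close> the condition on \<open>T\<close> makes the exponential factor at most \<open>2\<close>, so that the differences of \<open>A\<close> stay below
  the cutoff \<open>8 e\<close>.
\<close>

lemma amplitude_exists:
  assumes \<alpha>: "1 < \<alpha>" and p: "1 \<le> p" and km: "(km, kp) \<noteq> (0, 0)" and T: "0 < T" and e: "0 < e"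
    and A0: "lp_le p A0 e" and time: "p \<le> ereal (1 + \<alpha>) \<or> amp_rate \<alpha> km kp * T \<le> ln 2"
  obtains A where "solves_ivp p (amplitude_field \<alpha> km kp) A0 (T * e powr (1 - \<alpha>)) A"
    "\<And>t. t \<in> {0..T * e powr (1 - \<alpha>)} \<Longrightarrow> lp_le p (A t) (2 * exp (amp_rate \<alpha> km kp * T) * e)"
proof -
  define R where "R = 8 * e"
  define \<tau> where "\<tau> = T * e powr (1 - \<alpha>)"
  define K where "K = lip_amp \<alpha> km kp * R powr (\<alpha> - 1)"
  have R: "0 < R" using e by (simp add: R_def)
  have \<tau>: "0 \<le> \<tau>" using T by (simp add: \<tau>_def)
  have K0: "0 \<le> K" using lip_amp_nonneg[OF \<alpha>] by (simp add: K_def)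
  have "12 * K * \<tau> = amp_rate \<alpha> km kp * T * (e powr (\<alpha> - 1) * e powr (1 - \<alpha>))"
    using e by (simp add: K_def R_def \<tau>_def amp_rate_def powr_mult algebra_simps)
  also have "e powr (\<alpha> - 1) * e powr (1 - \<alpha>) = 1" using e by (simp flip: powr_add)
  finally have rate: "12 * K * \<tau> = amp_rate \<alpha> km kp * T" by simp
  obtain A where A: "solves_ivp p (amp_lattice (amp \<alpha> km kp \<circ> cutoff R)) A0 \<tau> A"
    and Ab: "\<And>t. t \<in> {0..\<tau>} \<Longrightarrow> lp_le p (A t) (2 * e * exp (12 * K * t))"
    and cA: "\<And>n. continuous_on {0..\<tau>} (\<lambda>s. A s n)"
    and eA: "\<And>t n. t \<in> {0..\<tau>} \<Longrightarrow> A t n = A0 n + integral {0..t} (\<lambda>s. amp_lattice (amp \<alpha> km kp \<circ> cutoff R) (A s) n)"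
    and lip: "nn_lipschitz_on UNIV (2 * K) (amp_lattice (amp \<alpha> km kp \<circ> cutoff R))"
    using cutoff_amplitude[OF \<alpha> p \<tau> A0 R km] unfolding K_def by metis
  have bound: "lp_le p (A t) (2 * exp (amp_rate \<alpha> km kp * T) * e)" if t: "t \<in> {0..\<tau>}" for t
  proof (rule lp_le_mono[OF Ab[OF t]])
    have "12 * K * t \<le> 12 * K * \<tau>" using t K0 by (intro mult_left_mono) auto
    then have "exp (12 * K * t) \<le> exp (amp_rate \<alpha> km kp * T)" unfolding rate by simp
    then show "2 * e * exp (12 * K * t) \<le> 2 * exp (amp_rate \<alpha> km kp * T) * e" using e by simp
  qed
  have small: "norm (A t n - A t (n - 1)) \<le> R" if t: "t \<in> {0..\<tau>}" for t n
  proof (cases "p \<le> ereal (1 + \<alpha>)")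
    case True
    with p obtain q where q: "p = ereal q" "1 \<le> q" "q \<le> 1 + \<alpha>"
      by (elim lp_exponent_cases) auto
    have "norm (A t n - A t (n - 1)) \<le> 2 * e"
      using A0 bound lip q(1) by (intro cutoff_amplitude_inactive[OF \<alpha> q(2,3) \<tau> _ e _ cA _ _ eA t]) (auto simp: R_def e)
    then show ?thesis using e by (simp add: R_def)
  next
    case False
    with time have "amp_rate \<alpha> km kp * T \<le> ln 2" by blast
    then have "exp (amp_rate \<alpha> km kp * T) \<le> exp (ln 2)" by (simp only: exp_le_cancel_iff)
    then have "2 * exp (amp_rate \<alpha> km kp * T) * e \<le> 4 * e" using e by simp
    then have "norm (A t m) \<le> 4 * e" for m
      using lp_le_component[OF p bound[OF t], of m] by (rule order_trans[rotated])
    from this[of n] this[of "n - 1"] show ?thesis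
      using norm_triangle_ineq4[of "A t n" "A t (n - 1)"] by (simp add: R_def)
  qed
  have "solves_ivp p (amplitude_field \<alpha> km kp) A0 \<tau> A"
    unfolding amplitude_field_eq
  proof (rule solves_ivp_cong[OF A])
    show "amp_lattice (amp \<alpha> km kp \<circ> cutoff R) (A t) = amp_lattice (amp \<alpha> km kp) (A t)" if "t \<in> {0..\<tau>}" for t
    proof
      fix n show "amp_lattice (amp \<alpha> km kp \<circ> cutoff R) (A t) n = amp_lattice (amp \<alpha> km kp) (A t) n"
        using small[OF that, of n] small[OF that, of "n + 1"] by (simp add: amp_lattice_def cutoff_eq)
    qed
  qed
  then show ?thesis using bound that by (simp add: \<tau>_def)
qed

section \<open>Regularity of the amplitude\<close>

text \<open>
  The Wirtinger derivatives of \<open>f\<close> with respect to \<open>c\<close> and to its conjugate. In this form the derivative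
  of \<open>f\<close> acts on sequences by multiplication with bounded sequences, and its continuity is that of two
  functions of \<open>c\<close>.
\<close>

definition amp_dz :: "real \<Rightarrow> real \<Rightarrow> real \<Rightarrow> complex \<Rightarrow> complex" where
  "amp_dz \<alpha> km kp c = of_real (omega0 \<alpha> km kp * ((\<alpha> + 1) / 2) * norm c powr (\<alpha> - 1))"

definition amp_dzbar :: "real \<Rightarrow> real \<Rightarrow> real \<Rightarrow> complex \<Rightarrow> complex" where
  "amp_dzbar \<alpha> km kp c = of_real (omega0 \<alpha> km kp * ((\<alpha> - 1) / 2) * norm c powr (\<alpha> - 1)) * (sgn c)\<^sup>2"

lemma tendsto_norm_powr_0:
  "0 < q \<Longrightarrow> ((\<lambda>z::'a::real_normed_vector. K * norm z powr q) \<longlongrightarrow> 0) (at 0)"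
proof -
  assume q: "0 < q"
  have "((\<lambda>z::'a. K * norm z powr q) \<longlongrightarrow> K * norm (0::'a) powr q) (at 0)"
    using q by (intro tendsto_intros tendsto_powr') auto
  then show ?thesis by simp
qed

lemma continuous_on_amp_dz: "1 < \<alpha> \<Longrightarrow> continuous_on UNIV (amp_dz \<alpha> km kp)"
  unfolding amp_dz_def by (intro continuous_intros continuous_on_powr') auto

lemma continuous_on_amp_dzbar:
  assumes \<alpha>: "1 < \<alpha>"
  shows "continuous_on UNIV (amp_dzbar \<alpha> km kp)"
  unfolding continuous_on_eq_continuous_at[OF open_UNIV]
proof
  fix c :: complex
  show "isCont (amp_dzbar \<alpha> km kp) c"
  proof (cases "c = 0")
    case False
    then show ?thesis unfolding amp_dzbar_def using \<alpha>
      by (auto intro!: continuous_intros)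
  next
    case True
    have "(amp_dzbar \<alpha> km kp \<longlongrightarrow> 0) (at 0)"
    proof (rule Lim_null_comparison)
      show "((\<lambda>z::complex. \<bar>omega0 \<alpha> km kp * ((\<alpha> - 1) / 2)\<bar> * norm z powr (\<alpha> - 1)) \<longlongrightarrow> 0) (at 0)"
        using \<alpha> by (intro tendsto_norm_powr_0) simp
      show "\<forall>\<^sub>F z in at 0. norm (amp_dzbar \<alpha> km kp z) \<le> \<bar>omega0 \<alpha> km kp * ((\<alpha> - 1) / 2)\<bar> * norm z powr (\<alpha> - 1)"
        unfolding amp_dzbar_def norm_mult norm_of_real norm_power norm_sgn abs_mult
        by (intro always_eventually allI) simp
    qed
    then show ?thesis using True by (simp add: isCont_def amp_dzbar_def)
  qed
qed

lemma has_derivative_amp: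
  assumes \<alpha>: "1 < \<alpha>"
  shows "(amp \<alpha> km kp has_derivative (\<lambda>h. amp_dz \<alpha> km kp c * h + amp_dzbar \<alpha> km kp c * cnj h)) (at c)"
proof (cases "c = 0")
  case True
  have "((\<lambda>z. norm (amp \<alpha> km kp z) / norm z) \<longlongrightarrow> 0) (at 0)"
  proof (rule Lim_null_comparison)
    show "((\<lambda>z::complex. \<bar>omega0 \<alpha> km kp\<bar> * norm z powr (\<alpha> - 1)) \<longlongrightarrow> 0) (at 0)"
      using \<alpha> by (intro tendsto_norm_powr_0) simp
    show "\<forall>\<^sub>F z in at 0. norm (norm (amp \<alpha> km kp z) / norm z) \<le> \<bar>omega0 \<alpha> km kp\<bar> * norm z powr (\<alpha> - 1)"
      by (intro always_eventually allI) (auto simp: amp_def norm_mult)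
  qed
  then show ?thesis using True by (simp add: has_derivative_iff_norm amp_dz_def amp_dzbar_def)
next
  case False
  define w where "w = omega0 \<alpha> km kp"
  have s: "c = of_real (norm c) * sgn c" using False by (simp add: sgn_div_norm scaleR_conv_of_real)
  have "((\<lambda>z. of_real w * z * of_real (norm z powr (\<alpha> - 1))) has_derivative
      (\<lambda>h. of_real w * h * of_real (norm c powr (\<alpha> - 1))
        + of_real w * c * of_real ((\<alpha> - 1) * norm c powr (\<alpha> - 2) * (sgn c \<bullet> h)))) (at c)"
  proof -
    have n: "((\<lambda>z. norm z powr (\<alpha> - 1)) has_derivative (\<lambda>h. (\<alpha> - 1) * norm c powr (\<alpha> - 2) * (sgn c \<bullet> h))) (at c)"
    proof -
      have "((\<lambda>x. x powr (\<alpha> - 1)) has_real_derivative (\<alpha> - 1) * norm c powr (\<alpha> - 2)) (at (norm c))"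
        using False by (auto intro!: derivative_eq_intros simp: algebra_simps)
      from has_derivative_compose[OF has_derivative_norm[OF False] this[unfolded has_field_derivative_def]]
      show ?thesis by (simp add: inner_commute)
    qed
    have "((\<lambda>z. of_real (norm z powr (\<alpha> - 1)) :: complex) has_derivative
        (\<lambda>h. of_real ((\<alpha> - 1) * norm c powr (\<alpha> - 2) * (sgn c \<bullet> h)))) (at c)"
      by (rule has_derivative_of_real[OF n])
    from has_derivative_mult[OF has_derivative_mult_right[OF has_derivative_ident, of "of_real w"] this]
    show ?thesis by (rule has_derivative_eq_rhs) (auto simp: fun_eq_iff algebra_simps)
  qed
  also have "(\<lambda>z. of_real w * z * of_real (norm z powr (\<alpha> - 1))) = amp \<alpha> km kp"
    by (simp add: fun_eq_iff amp_def w_def)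
  also have "(\<lambda>h. of_real w * h * of_real (norm c powr (\<alpha> - 1))
        + of_real w * c * of_real ((\<alpha> - 1) * norm c powr (\<alpha> - 2) * (sgn c \<bullet> h)))
      = (\<lambda>h. amp_dz \<alpha> km kp c * h + amp_dzbar \<alpha> km kp c * cnj h)"
  proof
    fix h
    define r where "r = norm c powr (\<alpha> - 1)"
    define S where "S = sgn c"
    have r2: "norm c * norm c powr (\<alpha> - 2) = r" using powr_mult_base[of "norm c" "\<alpha> - 2"] by (simp add: r_def)
    have SS: "S * cnj S = 1" using False
      by (simp add: S_def complex_norm_square[symmetric] norm_sgn)
    have inn: "complex_of_real (S \<bullet> h) = (S * cnj h + cnj S * h) / 2"
      by (simp add: complex_eq_iff inner_complex_def)
    have "of_real w * c * of_real ((\<alpha> - 1) * norm c powr (\<alpha> - 2) * (S \<bullet> h))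
        = of_real w * of_real (\<alpha> - 1) * of_real (norm c * norm c powr (\<alpha> - 2)) * (S * of_real (S \<bullet> h))"
      by (subst s) (simp add: S_def algebra_simps)
    also have "S * of_real (S \<bullet> h) = (S\<^sup>2 * cnj h + h) / 2"
    proof -
      have "S * ((S * cnj h + cnj S * h) / 2) = (S\<^sup>2 * cnj h + (S * cnj S) * h) / 2"
        by (simp add: power2_eq_square algebra_simps)
      then show ?thesis unfolding inn SS by simp
    qed
    finally have "of_real w * h * of_real r + of_real w * c * of_real ((\<alpha> - 1) * norm c powr (\<alpha> - 2) * (S \<bullet> h))
        = of_real w * h * of_real r + of_real w * of_real (\<alpha> - 1) * of_real r * ((S\<^sup>2 * cnj h + h) / 2)"
      unfolding r2 by simp
    also have "\<dots> = of_real (w * ((\<alpha> + 1) / 2) * r) * h + of_real (w * ((\<alpha> - 1) / 2) * r) * S\<^sup>2 * cnj h"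
      by (simp add: field_simps)
    finally show "of_real w * h * of_real (norm c powr (\<alpha> - 1))
        + of_real w * c * of_real ((\<alpha> - 1) * norm c powr (\<alpha> - 2) * (sgn c \<bullet> h))
        = amp_dz \<alpha> km kp c * h + amp_dzbar \<alpha> km kp c * cnj h"
      by (simp add: r_def S_def amp_dz_def amp_dzbar_def w_def)
  qed
  finally show ?thesis .
qed

lemma lp_continuous_on_nearest_neighbour:
  fixes z :: "real \<Rightarrow> int \<Rightarrow> 'a::real_normed_vector" and w :: "real \<Rightarrow> int \<Rightarrow> 'b::real_normed_vector"
  assumes p: "1 \<le> p" and z: "lp_continuous_on p S z" and K: "0 \<le> K"
    and w: "\<And>s. s \<in> S \<Longrightarrow> w s \<in> lp p"
    and le: "\<And>s t n. s \<in> S \<Longrightarrow> t \<in> S \<Longrightarrow> norm (w s n - w t n)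
      \<le> K * (norm (z s (n - 1) - z t (n - 1)) + norm (z s n - z t n) + norm (z s (n + 1) - z t (n + 1)))"
  shows "lp_continuous_on p S w"
  unfolding lp_continuous_on_def
proof (intro conjI ballI)
  fix t assume t: "t \<in> S"
  show "((\<lambda>s. lp_norm p (\<lambda>n. w s n - w t n)) \<longlongrightarrow> 0) (at t within S)"
  proof (rule Lim_null_comparison)
    have "((\<lambda>s. 3 * K * lp_norm p (\<lambda>n. z s n - z t n)) \<longlongrightarrow> 3 * K * 0) (at t within S)"
      using z t by (intro tendsto_intros) (auto simp: lp_continuous_on_def)
    then show "((\<lambda>s. 3 * K * lp_norm p (\<lambda>n. z s n - z t n)) \<longlongrightarrow> 0) (at t within S)" by simp
    show "\<forall>\<^sub>F s in at t within S. norm (lp_norm p (\<lambda>n. w s n - w t n)) \<le> 3 * K * lp_norm p (\<lambda>n. z s n - z t n)"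
      unfolding eventually_at_filter
    proof (intro always_eventually allI impI)
      fix s assume s: "s \<in> S"
      have "lp_le p (\<lambda>n. w s n - w t n) (3 * K * lp_norm p (\<lambda>n. z s n - z t n))"
        using z s t by (intro lp_le_nearest_neighbour[OF p lp_le_lp_norm K le] lp_diff p) (auto simp: lp_continuous_on_def)
      then show "norm (lp_norm p (\<lambda>n. w s n - w t n)) \<le> 3 * K * lp_norm p (\<lambda>n. z s n - z t n)"
        using lp_norm_abs_le[OF p] by simp
    qed
  qed
qed (rule w)

lemma lp_continuous_on_add:
  assumes p: "1 \<le> p" and u: "lp_continuous_on p S u" and v: "lp_continuous_on p S v"
  shows "lp_continuous_on p S (\<lambda>t n. u t n + v t n)"
  unfolding lp_continuous_on_def
proof (intro conjI ballI)
  have uv: "u s \<in> lp p" "v s \<in> lp p" if "s \<in> S" for s using u v that by (auto simp: lp_continuous_on_def)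
  show "(\<lambda>n. u s n + v s n) \<in> lp p" if "s \<in> S" for s
    using lp_leD(1)[OF lp_le_add[OF p lp_le_lp_norm lp_le_lp_norm]] uv[OF that] .
  fix t assume t: "t \<in> S"
  show "((\<lambda>s. lp_norm p (\<lambda>n. u s n + v s n - (u t n + v t n))) \<longlongrightarrow> 0) (at t within S)"
  proof (rule Lim_null_comparison)
    have "((\<lambda>s. lp_norm p (\<lambda>n. u s n - u t n) + lp_norm p (\<lambda>n. v s n - v t n)) \<longlongrightarrow> 0 + 0) (at t within S)"
      using u v t by (intro tendsto_add) (auto simp: lp_continuous_on_def)
    then show "((\<lambda>s. lp_norm p (\<lambda>n. u s n - u t n) + lp_norm p (\<lambda>n. v s n - v t n)) \<longlongrightarrow> 0) (at t within S)" by simp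
    show "\<forall>\<^sub>F s in at t within S. norm (lp_norm p (\<lambda>n. u s n + v s n - (u t n + v t n)))
        \<le> lp_norm p (\<lambda>n. u s n - u t n) + lp_norm p (\<lambda>n. v s n - v t n)"
      unfolding eventually_at_filter
    proof (intro always_eventually allI impI)
      fix s assume s: "s \<in> S"
      have "lp_le p (\<lambda>n. (u s n - u t n) + (v s n - v t n)) (lp_norm p (\<lambda>n. u s n - u t n) + lp_norm p (\<lambda>n. v s n - v t n))"
        by (intro lp_le_add lp_le_lp_norm lp_diff p uv s t)
      then show "norm (lp_norm p (\<lambda>n. u s n + v s n - (u t n + v t n)))
        \<le> lp_norm p (\<lambda>n. u s n - u t n) + lp_norm p (\<lambda>n. v s n - v t n)"
        using lp_norm_abs_le[OF p] by (simp add: add_diff_add)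
    qed
  qed
qed

text \<open>
  Convergence in \<open>\<ell>\<^sub>p\<close> is uniform in \<open>n\<close>, and \<open>P\<close> is uniformly continuous on balls; hence the multipliers converge uniformly.
\<close>

lemma lp_continuous_on_mult:
  fixes c z :: "real \<Rightarrow> int \<Rightarrow> complex"
  assumes p: "1 \<le> p" and S: "compact S" and c: "lp_continuous_on p S c" and z: "lp_continuous_on p S z"
    and P: "continuous_on UNIV P"
  shows "lp_continuous_on p S (\<lambda>t n. P (c t n) * z t n)"
proof -
  obtain B where B: "\<And>s. s \<in> S \<Longrightarrow> lp_le p (c s) B" using lp_continuous_on_bounded[OF p c S] by blast
  have cB: "c s n \<in> cball 0 B" if "s \<in> S" for s n using lp_le_component[OF p B[OF that]] by simp
  have "bounded (P ` cball 0 B)"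
    by (intro compact_imp_bounded compact_continuous_image continuous_on_subset[OF P]) auto
  then obtain K where "\<forall>y\<in>P ` cball 0 B. norm y \<le> K" unfolding bounded_iff by blast
  then have K: "norm (P x) \<le> K" if "x \<in> cball 0 B" for x using that by blast
  have z_lp: "z s \<in> lp p" and c_lp: "c s \<in> lp p" if "s \<in> S" for s
    using c z that by (auto simp: lp_continuous_on_def)
  have Pz: "lp_le p (\<lambda>n. P (c s n) * w n) (max 0 K * M)" if "s \<in> S" "lp_le p w M" for s w M
    using K[OF cB[OF that(1)]]
    by (intro lp_le_cmult[OF p that(2)]) (auto simp: norm_mult le_max_iff_disj intro!: mult_right_mono)
  show ?thesis
    unfolding lp_continuous_on_def
  proof (intro conjI ballI)
    show "(\<lambda>n. P (c s n) * z s n) \<in> lp p" if "s \<in> S" for s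
      by (rule lp_leD(1)[OF Pz[OF that lp_le_lp_norm[OF z_lp[OF that]]]])
    fix t assume t: "t \<in> S"
    show "((\<lambda>s. lp_norm p (\<lambda>n. P (c s n) * z s n - P (c t n) * z t n)) \<longlongrightarrow> 0) (at t within S)"
    proof (rule tendstoI)
      fix e :: real assume e: "0 < e"
      define M where "M = lp_norm p (z t) + 1"
      have M: "0 < M" and zM: "lp_le p (z t) M"
        using lp_norm_nonneg[OF z_lp[OF t] p] z_lp[OF t] by (auto simp: M_def lp_le_def)
      have "uniformly_continuous_on (cball 0 B) P"
        by (intro compact_uniformly_continuous continuous_on_subset[OF P]) auto
      then obtain d where d: "d > 0"
        and dd: "\<And>x y. x \<in> cball 0 B \<Longrightarrow> y \<in> cball 0 B \<Longrightarrow> norm (x - y) < d \<Longrightarrow> norm (P x - P y) < e / (4 * M)"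
        using e M unfolding uniformly_continuous_on_def dist_norm
        by (metis (no_types, lifting) divide_pos_pos mult_pos_pos zero_less_numeral)
      have K1: "0 < max 0 K + 1" by simp
      have "((\<lambda>s. lp_norm p (\<lambda>n. c s n - c t n)) \<longlongrightarrow> 0) (at t within S)"
        "((\<lambda>s. lp_norm p (\<lambda>n. z s n - z t n)) \<longlongrightarrow> 0) (at t within S)"
        using c z t by (auto simp: lp_continuous_on_def)
      then have "\<forall>\<^sub>F s in at t within S. lp_norm p (\<lambda>n. c s n - c t n) < d"
        "\<forall>\<^sub>F s in at t within S. lp_norm p (\<lambda>n. z s n - z t n) < e / (4 * (max 0 K + 1))"
        using d e K1 by (auto intro!: order_tendstoD(2) divide_pos_pos)
      moreover have "\<forall>\<^sub>F s in at t within S. s \<in> S" by (simp add: eventually_at_filter)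
      ultimately show "\<forall>\<^sub>F s in at t within S. dist (lp_norm p (\<lambda>n. P (c s n) * z s n - P (c t n) * z t n)) 0 < e"
      proof eventually_elim
        case (elim s)
        have cd: "norm (c s n - c t n) < d" for n
          using norm_le_lp_norm[OF p lp_diff[OF p c_lp[OF elim(3)] c_lp[OF t]]] elim(1) by (rule order_le_less_trans)
        have "lp_le p (\<lambda>n. z s n - z t n) (e / (4 * (max 0 K + 1)))"
          using elim z_lp t by (auto simp: lp_le_def intro!: lp_diff p)
        from Pz[OF elim(3) this] have "lp_le p (\<lambda>n. P (c s n) * (z s n - z t n)) (max 0 K * (e / (4 * (max 0 K + 1))))" .
        moreover have "lp_le p (\<lambda>n. (P (c s n) - P (c t n)) * z t n) (e / (4 * M) * M)"
        proof (rule lp_le_cmult[OF p zM])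
          show "norm ((P (c s n) - P (c t n)) * z t n) \<le> e / (4 * M) * norm (z t n)" for n
            unfolding norm_mult
            by (intro mult_right_mono less_imp_le[OF dd[OF cB[OF elim(3)] cB[OF t] cd]]) simp
        qed (use e M in simp)
        ultimately have "lp_le p (\<lambda>n. P (c s n) * (z s n - z t n) + (P (c s n) - P (c t n)) * z t n)
            (max 0 K * (e / (4 * (max 0 K + 1))) + e / (4 * M) * M)"
          by (intro lp_le_add p)
        also have "(\<lambda>n. P (c s n) * (z s n - z t n) + (P (c s n) - P (c t n)) * z t n)
            = (\<lambda>n. P (c s n) * z s n - P (c t n) * z t n)" by (simp add: algebra_simps)
        finally have "\<bar>lp_norm p (\<lambda>n. P (c s n) * z s n - P (c t n) * z t n)\<bar>
            \<le> max 0 K * (e / (4 * (max 0 K + 1))) + e / (4 * M) * M"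
          by (rule lp_norm_abs_le[OF p])
        also have "max 0 K * (e / (4 * (max 0 K + 1))) \<le> (max 0 K + 1) * (e / (4 * (max 0 K + 1)))"
          using e by (intro mult_right_mono) auto
        also have "\<dots> = e / 4"
        proof -
          have "k * (e / (4 * k)) = e / 4" if "0 < k" for k using that by simp
          then show ?thesis using K1 .
        qed
        also have "e / (4 * M) * M = e / 4" using M by simp
        finally show ?case using e by simp
      qed
    qed
  qed
qed

text \<open>
  Differentiating the equation shows that the second derivative is \<open>-\<i> \<delta>\<^sup>+\<close> of \<open>f'(c) c'\<close>, a continuous curve in \<open>\<ell>\<^sub>p\<close>.
\<close>

lemma amplitude_C2:
  assumes \<alpha>: "1 < \<alpha>" and p: "1 \<le> p" and A: "solves_ivp p (amplitude_field \<alpha> km kp) A0 \<tau> A"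
  shows "lp_C2_on p {0..\<tau>} A"
proof -
  let ?f = "amp \<alpha> km kp"
  let ?\<Phi> = "amplitude_field \<alpha> km kp"
  let ?S = "{0..\<tau>}"
  have dA: "has_lp_derivative p A (?\<Phi> (A t)) t ?S" if "t \<in> ?S" for t using A that by (simp add: solves_ivp_def)
  have lA: "lp_continuous_on p ?S A" by (rule has_lp_derivative_imp_lp_continuous_on[OF p dA])
  obtain B where B: "\<And>s. s \<in> ?S \<Longrightarrow> lp_le p (A s) B" using lp_continuous_on_bounded[OF p lA] by auto
  have AB: "A s n \<in> cball 0 B" if "s \<in> ?S" for s n using lp_le_component[OF p B[OF that]] by simp
  obtain k where k: "nn_lipschitz_on (cball 0 B) k ?\<Phi>" using nn_lipschitz_on_amplitude_field[OF \<alpha>] by blast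
  define v where "v = (\<lambda>t. ?\<Phi> (A t))"
  define c where "c = (\<lambda>t n. A t n - A t (n - 1))"
  define z where "z = (\<lambda>t n. v t n - v t (n - 1))"
  define w where "w = (\<lambda>t n. amp_dz \<alpha> km kp (c t n) * z t n + amp_dzbar \<alpha> km kp (c t n) * cnj (z t n))"
  define a where "a = (\<lambda>t n. (w t (n + 1) - w t n) / \<i>)"
  have lv: "lp_continuous_on p ?S v"
  proof (rule lp_continuous_on_nearest_neighbour[OF p lA])
    show "0 \<le> k" using k by (simp add: nn_lipschitz_on_def)
    show "v s \<in> lp p" if "s \<in> ?S" for s using dA[OF that] by (simp add: v_def has_lp_derivative_def)
    show "norm (v s n - v t n) \<le> k * (norm (A s (n - 1) - A t (n - 1)) + norm (A s n - A t n) + norm (A s (n + 1) - A t (n + 1)))"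
      if "s \<in> ?S" "t \<in> ?S" for s t n
      using k AB[OF that(1)] AB[OF that(2)] unfolding nn_lipschitz_on_def v_def by blast
  qed
  have shift_diff: "lp_continuous_on p ?S (\<lambda>t n. y t n - y t (n - 1))" if y: "lp_continuous_on p ?S y" for y :: "real \<Rightarrow> int \<Rightarrow> complex"
  proof (rule lp_continuous_on_nearest_neighbour[OF p y, of 1])
    have y_lp: "y s \<in> lp p" if "s \<in> ?S" for s using y that by (simp add: lp_continuous_on_def)
    show "(\<lambda>n. y s n - y s (n - 1)) \<in> lp p" if "s \<in> ?S" for s
      using lp_leD(1)[OF lp_le_shift[OF p lp_le_lp_norm[OF y_lp[OF that]], of "-1"]] y_lp[OF that]
      by (intro lp_diff p) auto
    show "norm ((y s n - y s (n - 1)) - (y t n - y t (n - 1)))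
        \<le> 1 * (norm (y s (n - 1) - y t (n - 1)) + norm (y s n - y t n) + norm (y s (n + 1) - y t (n + 1)))" for s t n
    proof -
      have "(y s n - y s (n - 1)) - (y t n - y t (n - 1)) = (y s n - y t n) - (y s (n - 1) - y t (n - 1))" by simp
      then show ?thesis using norm_triangle_ineq4[of "y s n - y t n" "y s (n - 1) - y t (n - 1)"]
        norm_ge_zero[of "y s (n + 1) - y t (n + 1)"] by (simp only: mult_1)
    qed
  qed simp
  have lc: "lp_continuous_on p ?S c" and lz: "lp_continuous_on p ?S z"
    unfolding c_def z_def by (intro shift_diff lA lv)+
  have lcz: "lp_continuous_on p ?S (\<lambda>t n. cnj (z t n))"
  proof (rule lp_continuous_on_nearest_neighbour[OF p lz, of 1])
    show "(\<lambda>n. cnj (z s n)) \<in> lp p" if "s \<in> ?S" for s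
    proof -
      have "z s \<in> lp p" using lz that by (simp add: lp_continuous_on_def)
      from lp_le_dominated[OF p lp_le_lp_norm[OF this], of "\<lambda>n. cnj (z s n)"] show ?thesis
        by (auto dest: lp_leD)
    qed
  qed (auto simp flip: complex_cnj_diff)
  have lw: "lp_continuous_on p ?S w"
    unfolding w_def
    by (intro lp_continuous_on_add lp_continuous_on_mult p lc lz lcz continuous_on_amp_dz continuous_on_amp_dzbar \<alpha>) auto
  have la: "lp_continuous_on p ?S a"
  proof (rule lp_continuous_on_nearest_neighbour[OF p lw, of 1])
    have w_lp: "w s \<in> lp p" if "s \<in> ?S" for s using lw that by (simp add: lp_continuous_on_def)
    show "a s \<in> lp p" if "s \<in> ?S" for s
    proof -
      have "(\<lambda>n. w s (n + 1) - w s n) \<in> lp p"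
        using lp_leD(1)[OF lp_le_shift[OF p lp_le_lp_norm[OF w_lp[OF that]], of 1]] w_lp[OF that]
        by (intro lp_diff p)
      from lp_le_dominated[OF p lp_le_lp_norm[OF this], of "a s"]
      have "lp_le p (a s) (lp_norm p (\<lambda>n. w s (n + 1) - w s n))" by (simp only: a_def norm_divide) simp
      then show ?thesis by (rule lp_leD)
    qed
    show "norm (a s n - a t n) \<le> 1 * (norm (w s (n - 1) - w t (n - 1)) + norm (w s n - w t n) + norm (w s (n + 1) - w t (n + 1)))" for s t n
    proof -
      have "a s n - a t n = ((w s (n + 1) - w t (n + 1)) - (w s n - w t n)) / \<i>"
        by (simp add: a_def diff_divide_distrib algebra_simps)
      then have "norm (a s n - a t n) = norm ((w s (n + 1) - w t (n + 1)) - (w s n - w t n))"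
        by (simp only: norm_divide norm_ii div_by_1)
      then show ?thesis using norm_triangle_ineq4[of "w s (n + 1) - w t (n + 1)" "w s n - w t n"]
        norm_ge_zero[of "w s (n - 1) - w t (n - 1)"] by (simp only: mult_1)
    qed
  qed simp
  have dAc: "((\<lambda>s. A s n) has_vector_derivative v t n) (at t within ?S)" if "t \<in> ?S" for t n
    unfolding v_def by (rule has_lp_derivative_component[OF p dA[OF that] that])
  have df: "((\<lambda>s. ?f (c s n)) has_vector_derivative w t n) (at t within ?S)" if t: "t \<in> ?S" for t n
  proof -
    have "((\<lambda>s. c s n) has_vector_derivative z t n) (at t within ?S)"
      unfolding c_def z_def by (intro has_vector_derivative_diff dAc t)
    from vector_derivative_diff_chain_within[OF this has_derivative_at_withinI[OF has_derivative_amp[OF \<alpha>]]]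
    show ?thesis by (simp add: o_def w_def)
  qed
  have dv: "((\<lambda>s. v s n) has_vector_derivative a t n) (at t within ?S)" if t: "t \<in> ?S" for t n
  proof -
    have "v = (\<lambda>s n. (?f (c s (n + 1)) - ?f (c s n)) / \<i>)"
      by (simp add: fun_eq_iff v_def c_def amplitude_field_eq amp_lattice_def)
    then show ?thesis unfolding a_def
      using has_vector_derivative_divide[OF has_vector_derivative_diff[OF df[OF t, of "n + 1"] df[OF t, of n]], of \<i>] by simp
  qed
  have "has_lp_derivative p v (a t) t ?S" if t: "t \<in> ?S" for t
  proof (rule lp_fundamental_theorem_of_calculus[OF p la _ _ t])
    show "v 0 \<in> lp p" using dA[of 0] t by (auto simp: v_def has_lp_derivative_def)
    show "v t n = v 0 n + integral {0..t} (\<lambda>s. a s n)" if t: "t \<in> ?S" for t n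
    proof -
      have "((\<lambda>s. a s n) has_integral (v t n - v 0 n)) {0..t}"
        using t by (intro fundamental_theorem_of_calculus) (auto intro!: has_vector_derivative_within_subset[OF dv])
      then show ?thesis by (simp add: integral_unique)
    qed
  qed
  with dA la show ?thesis
    unfolding lp_C2_on_def by (intro exI[of _ v] exI[of _ a]) (simp add: v_def)
qed

section \<open>Averaging\<close>

text \<open>
  On each full period, \<open>E s (c s)\<close> may be replaced by its difference to \<open>E s (c a)\<close> with \<open>a\<close> the beginning of the
  period, as the latter integrates to zero; the difference is bounded by \<open>\<Lambda> \<kappa> T\<close>. This gives the term growing with
  \<open>t\<close>; the other term is the last, incomplete period.
\<close>

lemma lp_le_averaging:
  fixes E :: "real \<Rightarrow> complex \<Rightarrow> complex" and c :: "real \<Rightarrow> int \<Rightarrow> complex"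
  assumes p: "1 \<le> p" and T: "0 < T" and \<Lambda>: "0 \<le> \<Lambda>" and \<kappa>: "0 \<le> \<kappa>"
    and cont_E: "continuous_on UNIV (\<lambda>x. E (fst x) (snd x))"
    and per: "\<And>s z. E (s + T) z = E s z"
    and zero_mean: "\<And>z. ((\<lambda>s. E s z) has_integral 0) {0..T}"
    and E_0: "\<And>s. E s 0 = 0"
    and lip: "\<And>s y z. norm y \<le> R \<Longrightarrow> norm z \<le> R \<Longrightarrow> norm (E s y - E s z) \<le> \<Lambda> * norm (y - z)"
    and cont_c: "\<And>n. continuous_on {0..\<tau>} (\<lambda>s. c s n)"
    and M: "\<And>s. s \<in> {0..\<tau>} \<Longrightarrow> lp_le p (c s) M" and MR: "M \<le> R"
    and slow: "\<And>s t. s \<in> {0..\<tau>} \<Longrightarrow> t \<in> {0..\<tau>} \<Longrightarrow> lp_le p (\<lambda>n. c t n - c s n) (\<kappa> * \<bar>t - s\<bar>)"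
    and t: "t \<in> {0..\<tau>}"
  shows "lp_le p (\<lambda>n. integral {0..t} (\<lambda>s. E s (c s n))) (T * \<Lambda> * M + T * \<Lambda> * \<kappa> * t)"
proof -
  have cR: "norm (c s n) \<le> R" if "s \<in> {0..\<tau>}" for s n
    using lp_le_component[OF p M[OF that]] MR by (rule order_trans)
  have M0: "0 \<le> M" using lp_le_nonneg[OF p M[OF t]] .
  have cE: "continuous_on {0..\<tau>} (\<lambda>s. E s (c s n))" for n
  proof -
    have "continuous_on {0..\<tau>} (\<lambda>s. (s, c s n))" by (intro continuous_intros cont_c)
    from continuous_on_compose2[OF cont_E this] show ?thesis by simp
  qed
  have cEz: "continuous_on S (\<lambda>s. E s z)" for S z
  proof -
    have "continuous_on S (\<lambda>s. (s, z))" by (intro continuous_intros)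
    from continuous_on_compose2[OF cont_E this] show ?thesis by simp
  qed
  have iE: "(\<lambda>s. E s (c s n)) integrable_on {a..b}" if "0 \<le> a" "b \<le> \<tau>" for a b n
    using that by (intro integrable_continuous_real continuous_on_subset[OF cE]) auto
  have perk: "E (s + real k * T) z = E s z" for s z k
  proof (induction k)
    case (Suc k)
    have "E (s + real (Suc k) * T) z = E ((s + real k * T) + T) z" by (simp add: algebra_simps)
    then show ?case by (simp add: per Suc)
  qed simp
  have mean: "integral {real k * T..real (Suc k) * T} (\<lambda>s. E s z) = 0" for k z
  proof -
    have "integral {0..T} (\<lambda>s. E (s + real k * T) z) = integral {real k * T..real (Suc k) * T} (\<lambda>s. E s z)"
      using integral_shift_real[of 0 "real k * T" T "\<lambda>s. E s z"] by (simp add: cEz algebra_simps)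
    then show ?thesis using zero_mean[of z] by (simp add: perk integral_unique)
  qed
  have full: "lp_le p (\<lambda>n. integral {0..real k * T} (\<lambda>s. E s (c s n))) (T * \<Lambda> * \<kappa> * (real k * T))"
    if "real k * T \<le> \<tau>" for k
    using that
  proof (induction k)
    case 0
    then show ?case by (simp add: lp_0 p)
  next
    case (Suc k)
    define a b where "a = real k * T" and "b = real (Suc k) * T"
    have ab: "0 \<le> a" "a \<le> b" "b \<le> \<tau>" "b - a = T" using T Suc.prems by (auto simp: a_def b_def algebra_simps)
    have aS: "a \<in> {0..\<tau>}" using ab by auto
    have "lp_le p (\<lambda>n. integral {a..b} (\<lambda>s. E s (c s n) - E s (c a n))) ((b - a) * (\<Lambda> * (\<kappa> * T)))"
    proof (rule lp_le_integral_const[OF p ab(2)])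
      show "continuous_on {a..b} (\<lambda>s. E s (c s n) - E s (c a n))" for n
        using ab by (intro continuous_intros continuous_on_subset[OF cE] cEz) auto
      fix s assume s: "s \<in> {a..b}"
      have sS: "s \<in> {0..\<tau>}" using s ab by auto
      have "lp_le p (\<lambda>n. E s (c s n) - E s (c a n)) (\<Lambda> * (\<kappa> * \<bar>s - a\<bar>))"
        by (rule lp_le_cmult[OF p slow[OF aS sS] lip[OF cR[OF sS] cR[OF aS]] \<Lambda>])
      moreover have "\<Lambda> * (\<kappa> * \<bar>s - a\<bar>) \<le> \<Lambda> * (\<kappa> * T)"
        using s ab \<Lambda> \<kappa> by (intro mult_left_mono) auto
      ultimately show "lp_le p (\<lambda>n. E s (c s n) - E s (c a n)) (\<Lambda> * (\<kappa> * T))" by (rule lp_le_mono)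
    qed
    moreover have "integral {a..b} (\<lambda>s. E s (c s n) - E s (c a n)) = integral {a..b} (\<lambda>s. E s (c s n))" for n
    proof -
      have "integral {a..b} (\<lambda>s. E s (c a n)) = 0" unfolding a_def b_def by (rule mean)
      moreover have "(\<lambda>s. E s (c s n)) integrable_on {a..b}" using ab by (intro iE)
      moreover have "(\<lambda>s. E s (c a n)) integrable_on {a..b}" by (intro integrable_continuous_real cEz)
      ultimately show ?thesis by (simp add: integral_diff)
    qed
    ultimately have "lp_le p (\<lambda>n. integral {a..b} (\<lambda>s. E s (c s n))) (T * (\<Lambda> * (\<kappa> * T)))" using ab by simp
    moreover have "lp_le p (\<lambda>n. integral {0..a} (\<lambda>s. E s (c s n))) (T * \<Lambda> * \<kappa> * a)"
      unfolding a_def using ab by (intro Suc.IH) (simp add: a_def)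
    ultimately have "lp_le p (\<lambda>n. integral {0..a} (\<lambda>s. E s (c s n)) + integral {a..b} (\<lambda>s. E s (c s n)))
        (T * \<Lambda> * \<kappa> * a + T * (\<Lambda> * (\<kappa> * T)))" by (intro lp_le_add p)
    moreover have "integral {0..a} (\<lambda>s. E s (c s n)) + integral {a..b} (\<lambda>s. E s (c s n)) = integral {0..b} (\<lambda>s. E s (c s n))" for n
      using ab by (intro Henstock_Kurzweil_Integration.integral_combine iE) auto
    moreover have "T * \<Lambda> * \<kappa> * a + T * (\<Lambda> * (\<kappa> * T)) = T * \<Lambda> * \<kappa> * b"
    proof -
      have "b = a + T" using ab(4) by simp
      then show ?thesis by (simp only: algebra_simps)
    qed
    ultimately show ?case by (simp add: b_def)
  qed
  define k where "k = nat \<lfloor>t / T\<rfloor>"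
  define a where "a = real k * T"
  have "real k = of_int \<lfloor>t / T\<rfloor>" using t T by (simp add: k_def)
  then have "real k \<le> t / T" "t / T < real k + 1" by linarith+
  then have a: "0 \<le> a" "a \<le> t" "t - a \<le> T" using T by (auto simp: a_def field_simps)
  have "lp_le p (\<lambda>n. integral {a..t} (\<lambda>s. E s (c s n))) ((t - a) * (\<Lambda> * M))"
  proof (rule lp_le_integral_const[OF p a(2)])
    show "continuous_on {a..t} (\<lambda>s. E s (c s n))" for n
      using a t by (intro continuous_on_subset[OF cE]) auto
    fix s assume "s \<in> {a..t}"
    then have s: "s \<in> {0..\<tau>}" using a t by auto
    have "norm (0::complex) \<le> R" using M0 MR by simp
    from lip[OF cR[OF s] this] show "lp_le p (\<lambda>n. E s (c s n)) (\<Lambda> * M)"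
      by (intro lp_le_cmult[OF p M[OF s] _ \<Lambda>]) (simp add: E_0)
  qed
  moreover have "lp_le p (\<lambda>n. integral {0..a} (\<lambda>s. E s (c s n))) (T * \<Lambda> * \<kappa> * a)"
    unfolding a_def using a t by (intro full) (simp add: a_def)
  ultimately have "lp_le p (\<lambda>n. integral {0..a} (\<lambda>s. E s (c s n)) + integral {a..t} (\<lambda>s. E s (c s n)))
        (T * \<Lambda> * \<kappa> * a + (t - a) * (\<Lambda> * M))" by (intro lp_le_add p)
  moreover have "integral {0..a} (\<lambda>s. E s (c s n)) + integral {a..t} (\<lambda>s. E s (c s n)) = integral {0..t} (\<lambda>s. E s (c s n))" for n
    using a t by (intro Henstock_Kurzweil_Integration.integral_combine iE) auto
  moreover have "T * \<Lambda> * \<kappa> * a + (t - a) * (\<Lambda> * M) \<le> T * \<Lambda> * M + T * \<Lambda> * \<kappa> * t"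
  proof -
    have "(t - a) * (\<Lambda> * M) \<le> T * (\<Lambda> * M)" using a \<Lambda> M0 by (intro mult_right_mono) auto
    moreover have "T * \<Lambda> * \<kappa> * a \<le> T * \<Lambda> * \<kappa> * t" using a T \<Lambda> \<kappa> by (intro mult_left_mono) auto
    ultimately show ?thesis by (simp add: algebra_simps)
  qed
  ultimately show ?thesis by (auto intro: lp_le_mono)
qed

text \<open>The oscillating remainder: force of \<open>V_alpha\<close> in amplitude coordinates minus its mean value.\<close>

definition osc_error :: "real \<Rightarrow> real \<Rightarrow> real \<Rightarrow> real \<Rightarrow> complex \<Rightarrow> complex" where
  "osc_error \<alpha> km kp s c = cis (- s) * of_real (half_powers \<alpha> (- km) kp (osc s c) / sqrt 2) - amp \<alpha> km kp c"

lemma continuous_on_amp: "1 < \<alpha> \<Longrightarrow> continuous_on S (amp \<alpha> km kp)"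
  unfolding amp_def by (intro continuous_intros continuous_on_powr') auto

lemma lp_le_integral_osc_error:
  fixes c :: "real \<Rightarrow> int \<Rightarrow> complex" and \<alpha> km kp R :: real
  assumes \<alpha>: "1 < \<alpha>" and p: "1 \<le> p" and \<kappa>: "0 \<le> \<kappa>"
    and cont_c: "\<And>n. continuous_on {0..\<tau>} (\<lambda>s. c s n)"
    and M: "\<And>s. s \<in> {0..\<tau>} \<Longrightarrow> lp_le p (c s) M" and MR: "M \<le> R"
    and slow: "\<And>s t. s \<in> {0..\<tau>} \<Longrightarrow> t \<in> {0..\<tau>} \<Longrightarrow> lp_le p (\<lambda>n. c t n - c s n) (\<kappa> * \<bar>t - s\<bar>)"
    and t: "t \<in> {0..\<tau>}"
  defines "\<Lambda> \<equiv> 2 * (lip_amp \<alpha> km kp * R powr (\<alpha> - 1))"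
  shows "lp_le p (\<lambda>n. integral {0..t} (\<lambda>s. osc_error \<alpha> km kp s (c s n))) (2 * pi * \<Lambda> * M + 2 * pi * \<Lambda> * \<kappa> * t)"
proof (rule lp_le_averaging[OF p _ _ \<kappa> _ _ _ _ _ cont_c M MR slow t])
  have \<alpha>0: "0 < \<alpha>" using \<alpha> by simp
  show "continuous_on UNIV (\<lambda>x. osc_error \<alpha> km kp (fst x) (snd x))"
    unfolding osc_error_def osc_def using \<alpha>
    by (intro continuous_intros continuous_on_compose2[OF continuous_on_amp[OF \<alpha>]]) auto
  show "osc_error \<alpha> km kp (s + 2 * pi) z = osc_error \<alpha> km kp s z" for s z
  proof -
    have "cis (s + 2 * pi) = cis s" "cis (- (s + 2 * pi)) = cis (- s)"
      by (simp_all add: complex_eq_iff cos_diff sin_diff)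
    then show ?thesis by (simp only: osc_error_def osc_def)
  qed
  show "((\<lambda>s. osc_error \<alpha> km kp s z) has_integral 0) {0..2 * pi}" for z
  proof -
    have "((\<lambda>s::real. amp \<alpha> km kp z) has_integral of_real (2 * pi) * amp \<alpha> km kp z) {0..2 * pi}"
      using has_integral_const_real[of "amp \<alpha> km kp z" 0 "2 * pi"] by (simp add: scaleR_conv_of_real)
    from has_integral_diff[OF has_integral_averaged_oscillation[OF \<alpha>0, of km kp z] this] show ?thesis
      by (simp add: osc_error_def)
  qed
  show "osc_error \<alpha> km kp s 0 = 0" for s by (simp add: osc_error_def osc_def)
  show "norm (osc_error \<alpha> km kp s y - osc_error \<alpha> km kp s z) \<le> \<Lambda> * norm (y - z)"
    if "norm y \<le> R" "norm z \<le> R" for s y z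
    using norm_triangle_le_diff[OF add_mono[OF oscillation_lipschitz[OF \<alpha> that, of s km kp] amp_lipschitz[OF \<alpha> that, of km kp]]]
    by (simp add: osc_error_def \<Lambda>_def algebra_simps)
qed (use lip_amp_nonneg[OF \<alpha>] in \<open>auto simp: \<Lambda>_def\<close>)

section \<open>The lattice\<close>

text \<open>
  The lattice field with arbitrary forces, in order to allow forces that are cut off.
\<close>

definition lattice_rhs :: "(real \<Rightarrow> real) \<Rightarrow> (real \<Rightarrow> real) \<Rightarrow> (int \<Rightarrow> real \<times> real) \<Rightarrow> int \<Rightarrow> real \<times> real" where
  "lattice_rhs g h X n = (snd (X n), - fst (X n) +
     (g (fst (X (n + 1)) - fst (X n)) - g (fst (X n) - fst (X (n - 1))) - h (fst (X n))))"

lemma lattice_field_eq: "lattice_field V \<phi> = lattice_rhs (deriv V) (deriv \<phi>)"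
  by (simp add: fun_eq_iff lattice_field_def lattice_J_def lattice_G_def lattice_F_def lattice_rhs_def
      delta_plus_def delta_minus_def)

lemma abs_fst_le: "\<bar>fst z\<bar> \<le> norm z" and abs_snd_le: "\<bar>snd z\<bar> \<le> norm z" for z :: "real \<times> real"
  using norm_fst_le[of "fst z" "snd z"] norm_snd_le[of "snd z" "fst z"] by simp_all

lemma nn_lipschitz_on_lattice:
  assumes g: "\<And>x y. x \<in> S \<Longrightarrow> y \<in> S \<Longrightarrow> \<bar>g x - g y\<bar> \<le> K * \<bar>x - y\<bar>"
    and h: "\<And>x y. x \<in> S \<Longrightarrow> y \<in> S \<Longrightarrow> \<bar>h x - h y\<bar> \<le> K * \<bar>x - y\<bar>" and K: "0 \<le> K"
    and S: "\<And>a b. a \<in> B \<Longrightarrow> b \<in> B \<Longrightarrow> fst a - fst b \<in> S" "\<And>a. a \<in> B \<Longrightarrow> fst a \<in> S"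
  shows "nn_lipschitz_on B (2 + 3 * K) (lattice_rhs g h)"
  unfolding nn_lipschitz_on_def
proof (intro conjI allI impI)
  fix u v :: "int \<Rightarrow> real \<times> real" and n :: int
  assume u: "\<forall>n. u n \<in> B" and v: "\<forall>n. v n \<in> B"
  define d where "d = (\<lambda>m. norm (u m - v m))"
  have fs: "\<bar>fst (u m) - fst (v m)\<bar> \<le> d m" "\<bar>snd (u m) - snd (v m)\<bar> \<le> d m" for m
    using abs_fst_le[of "u m - v m"] abs_snd_le[of "u m - v m"] by (simp_all add: d_def)
  have d0: "0 \<le> d m" for m by (simp add: d_def)
  have gd: "\<bar>g (fst (u i) - fst (u j)) - g (fst (v i) - fst (v j))\<bar> \<le> K * (d i + d j)" for i j
  proof -
    have "\<bar>g (fst (u i) - fst (u j)) - g (fst (v i) - fst (v j))\<bar>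
        \<le> K * \<bar>(fst (u i) - fst (u j)) - (fst (v i) - fst (v j))\<bar>"
      using u v by (intro g S) auto
    also have "\<dots> \<le> K * (d i + d j)" using fs(1)[of i] fs(1)[of j] K by (intro mult_left_mono) auto
    finally show ?thesis .
  qed
  have hd: "\<bar>h (fst (u n)) - h (fst (v n))\<bar> \<le> K * d n"
    by (rule order_trans[OF h mult_left_mono[OF fs(1) K]]) (use u v S(2) in auto)
  define e where "e = g (fst (u (n + 1)) - fst (u n)) - g (fst (v (n + 1)) - fst (v n))"
  define e' where "e' = g (fst (u n) - fst (u (n - 1))) - g (fst (v n) - fst (v (n - 1)))"
  define e'' where "e'' = h (fst (u n)) - h (fst (v n))"
  have "lattice_rhs g h u n - lattice_rhs g h v n
      = (snd (u n) - snd (v n), - (fst (u n) - fst (v n)) + (e - e' - e''))"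
    by (simp add: lattice_rhs_def e_def e'_def e''_def)
  then have "norm (lattice_rhs g h u n - lattice_rhs g h v n)
      \<le> \<bar>snd (u n) - snd (v n)\<bar> + \<bar>- (fst (u n) - fst (v n)) + (e - e' - e'')\<bar>"
    using norm_Pair_le[of "snd (u n) - snd (v n)" "- (fst (u n) - fst (v n)) + (e - e' - e'')"] by simp
  also have "\<bar>- (fst (u n) - fst (v n)) + (e - e' - e'')\<bar> \<le> \<bar>fst (u n) - fst (v n)\<bar> + (\<bar>e\<bar> + \<bar>e'\<bar> + \<bar>e''\<bar>)"
    by simp
  also have "\<bar>snd (u n) - snd (v n)\<bar> + (\<bar>fst (u n) - fst (v n)\<bar> + (\<bar>e\<bar> + \<bar>e'\<bar> + \<bar>e''\<bar>))
      \<le> d n + (d n + (K * (d (n + 1) + d n) + K * (d n + d (n - 1)) + K * d n))"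
    using fs[of n] gd[of "n + 1" n] gd[of n "n - 1"] hd
    by (intro add_mono) (simp_all add: e_def e'_def e''_def)
  also have "\<dots> \<le> (2 + 3 * K) * (d (n - 1) + d n + d (n + 1))"
    using K d0[of n] d0[of "n - 1"] d0[of "n + 1"] by (simp add: algebra_simps)
  finally show "norm (lattice_rhs g h u n - lattice_rhs g h v n)
      \<le> (2 + 3 * K) * (norm (u (n - 1) - v (n - 1)) + norm (u n - v n) + norm (u (n + 1) - v (n + 1)))"
    by (simp add: d_def)
qed (use K in simp)

lemma C2_real_has_deriv:
  assumes "C2_real f"
  shows "(f has_real_derivative deriv f x) (at x)" "(deriv f has_real_derivative deriv (deriv f) x) (at x)"
  using assms by (auto simp: C2_real_def DERIV_deriv_iff_field_differentiable)

lemma C2_real_lipschitz: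
  assumes f: "C2_real f"
  obtains K where "0 \<le> K" "\<And>x y. x \<in> cball 0 R \<Longrightarrow> y \<in> cball 0 R \<Longrightarrow> \<bar>deriv f x - deriv f y\<bar> \<le> K * \<bar>x - y\<bar>"
proof -
  have "continuous_on (cball 0 R) (deriv (deriv f))"
    using f by (auto simp: C2_real_def intro: continuous_on_subset)
  then have "bounded (deriv (deriv f) ` cball 0 R)"
    by (intro compact_imp_bounded compact_continuous_image) auto
  then obtain K where "\<forall>y\<in>deriv (deriv f) ` cball 0 R. norm y \<le> K" unfolding bounded_iff by blast
  then have K: "norm (deriv (deriv f) x) \<le> max 0 K" if "x \<in> cball 0 R" for x
    using that by (auto simp: le_max_iff_disj)
  have "norm (deriv f x - deriv f y) \<le> max 0 K * norm (x - y)" if "x \<in> cball 0 R" "y \<in> cball 0 R" for x y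
    using that K by (intro field_differentiable_bound[of "cball 0 R" "deriv f" "deriv (deriv f)"])
      (auto intro: has_field_derivative_at_within C2_real_has_deriv[OF f])
  then show ?thesis using that[of "max 0 K"] by simp
qed

lemma nn_lipschitz_on_lattice_field:
  assumes V: "C2_real V" and \<phi>: "C2_real \<phi>"
  shows "\<exists>c. nn_lipschitz_on (cball 0 R) c (lattice_field V \<phi>)"
proof -
  obtain K where K: "0 \<le> K"
    "\<And>x y. x \<in> cball 0 (2 * R) \<Longrightarrow> y \<in> cball 0 (2 * R) \<Longrightarrow> \<bar>deriv V x - deriv V y\<bar> \<le> K * \<bar>x - y\<bar>"
    using C2_real_lipschitz[OF V] by blast
  obtain K' where K': "0 \<le> K'"
    "\<And>x y. x \<in> cball 0 (2 * R) \<Longrightarrow> y \<in> cball 0 (2 * R) \<Longrightarrow> \<bar>deriv \<phi> x - deriv \<phi> y\<bar> \<le> K' * \<bar>x - y\<bar>"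
    using C2_real_lipschitz[OF \<phi>] by blast
  have mono: "K * \<bar>x - y\<bar> \<le> (K + K') * \<bar>x - y\<bar>" "K' * \<bar>x - y\<bar> \<le> (K + K') * \<bar>x - y\<bar>" for x y :: real
    using K(1) K'(1) by (auto intro!: mult_right_mono)
  have fstR: "\<bar>fst a\<bar> \<le> R" if "a \<in> cball 0 R" for a :: "real \<times> real"
    using abs_fst_le[of a] that by simp
  have "nn_lipschitz_on (cball 0 R) (2 + 3 * (K + K')) (lattice_rhs (deriv V) (deriv \<phi>))"
  proof (rule nn_lipschitz_on_lattice)
    show "fst a - fst b \<in> cball 0 (2 * R)" if "a \<in> cball 0 R" "b \<in> cball 0 R" for a b :: "real \<times> real"
      using fstR[OF that(1)] fstR[OF that(2)] by simp
    show "fst a \<in> cball 0 (2 * R)" if "a \<in> cball 0 R" for a :: "real \<times> real"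
      using fstR[OF that] by simp
    show "\<bar>deriv V x - deriv V y\<bar> \<le> (K + K') * \<bar>x - y\<bar>" if "x \<in> cball 0 (2 * R)" "y \<in> cball 0 (2 * R)" for x y
      by (rule order_trans[OF K(2)[OF that] mono(1)])
    show "\<bar>deriv \<phi> x - deriv \<phi> y\<bar> \<le> (K + K') * \<bar>x - y\<bar>" if "x \<in> cball 0 (2 * R)" "y \<in> cball 0 (2 * R)" for x y
      by (rule order_trans[OF K'(2)[OF that] mono(2)])
  qed (use K K' in auto)
  then show ?thesis unfolding lattice_field_eq by blast
qed

text \<open>
  All that the proof uses about \<open>V\<close> and \<open>\<phi>\<close>: near the origin the full force has a Lipschitz constant of order \<open>R\<^sup>\<alpha>\<^sup>-\<^sup>1\<close>, and the
  forces not contained in the amplitude equation gain a further factor \<open>R\<^sup>\<eta>\<close>.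
\<close>

lemma nonlinearity_bounds:
  fixes V W \<phi> :: "real \<Rightarrow> real"
  assumes \<alpha>: "1 < \<alpha>" and \<eta>: "0 \<le> \<eta>" "\<eta> \<le> \<beta>" "\<eta> \<le> \<gamma>" and \<beta>: "0 < \<beta>" and \<gamma>: "0 < \<gamma>"
    and V: "C2_real V" and VW: "\<And>r. V r = V_alpha \<alpha> km kp r + W r"
    and W_O: "deriv (deriv W) \<in> O[at 0](\<lambda>r. \<bar>r\<bar> powr (\<alpha> - 1 + \<beta>))"
    and \<phi>: "C2_real \<phi>" and \<phi>_O: "deriv (deriv \<phi>) \<in> O[at 0](\<lambda>x. \<bar>x\<bar> powr (\<alpha> - 1 + \<gamma>))"
  obtains C r0 where "0 < C" "0 < r0" "r0 \<le> 1"
    "\<And>r. deriv V r = half_powers \<alpha> (- km) kp r + deriv W r"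
    "\<And>R x y. R \<le> r0 \<Longrightarrow> \<bar>x\<bar> \<le> R \<Longrightarrow> \<bar>y\<bar> \<le> R \<Longrightarrow> \<bar>deriv V x - deriv V y\<bar> \<le> C * R powr (\<alpha> - 1) * \<bar>x - y\<bar>"
    "\<And>R x y. R \<le> r0 \<Longrightarrow> \<bar>x\<bar> \<le> R \<Longrightarrow> \<bar>y\<bar> \<le> R \<Longrightarrow> \<bar>deriv W x - deriv W y\<bar> \<le> C * R powr (\<alpha> - 1 + \<eta>) * \<bar>x - y\<bar>"
    "\<And>R x y. R \<le> r0 \<Longrightarrow> \<bar>x\<bar> \<le> R \<Longrightarrow> \<bar>y\<bar> \<le> R \<Longrightarrow> \<bar>deriv \<phi> x - deriv \<phi> y\<bar> \<le> C * R powr (\<alpha> - 1 + \<eta>) * \<bar>x - y\<bar>"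
proof -
  have dV\<alpha>: "(V_alpha \<alpha> km kp has_real_derivative half_powers \<alpha> (- km) kp r) (at r)" for r
  proof -
    have "- (km / (1 + \<alpha>)) * (\<alpha> + 1) = - km" "kp / (1 + \<alpha>) * (\<alpha> + 1) = kp"
      using \<alpha> by (simp_all add: field_simps)
    then show ?thesis
      using has_real_derivative_half_powers[of "\<alpha> + 1" "km / (1 + \<alpha>)" "kp / (1 + \<alpha>)" r] \<alpha>
      by (simp only: V_alpha_eq) simp
  qed
  \<comment> \<open>\<open>W\<close> inherits its differentiability from \<open>V\<close> and \<open>V_alpha\<close>.\<close>
  have W_eq: "W = (\<lambda>r. V r - V_alpha \<alpha> km kp r)" using VW by (simp add: fun_eq_iff)
  have dW: "(W has_real_derivative deriv V r - half_powers \<alpha> (- km) kp r) (at r)" for r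
    unfolding W_eq by (intro derivative_intros C2_real_has_deriv[OF V] dV\<alpha>)
  have dW_eq: "deriv W = (\<lambda>r. deriv V r - half_powers \<alpha> (- km) kp r)"
    using DERIV_imp_deriv[OF dW] by (simp add: fun_eq_iff)
  have ddW: "(deriv W has_real_derivative deriv (deriv V) r - half_powers (\<alpha> - 1) (km * \<alpha>) (kp * \<alpha>) r) (at r)" for r
    unfolding dW_eq using has_real_derivative_half_powers[OF \<alpha>, of "- km" kp r]
    by (intro DERIV_diff C2_real_has_deriv[OF V]) simp
  have ddW_eq: "deriv (deriv W) = (\<lambda>r. deriv (deriv V) r - half_powers (\<alpha> - 1) (km * \<alpha>) (kp * \<alpha>) r)"
    using DERIV_imp_deriv[OF ddW] by (simp add: fun_eq_iff)
  have q\<beta>: "0 < \<alpha> - 1 + \<beta>" and q\<gamma>: "0 < \<alpha> - 1 + \<gamma>" using \<alpha> \<beta> \<gamma> by auto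
  have "continuous_on UNIV (deriv (deriv W))" unfolding ddW_eq
    using V \<alpha> by (intro continuous_intros) (auto simp: C2_real_def)
  then have "isCont (deriv (deriv W)) 0" by (simp add: continuous_on_eq_continuous_at)
  then obtain Cw rw where w: "0 < Cw" "0 < rw" "rw \<le> 1"
    "\<And>x. \<bar>x\<bar> \<le> rw \<Longrightarrow> \<bar>deriv (deriv W) x\<bar> \<le> Cw * \<bar>x\<bar> powr (\<alpha> - 1 + \<beta>)"
    using bigo_power_bound[OF W_O _ q\<beta>] by blast
  have "isCont (deriv (deriv \<phi>)) 0" using \<phi> by (simp add: C2_real_def continuous_on_eq_continuous_at)
  then obtain Cp rp where f: "0 < Cp" "0 < rp" "rp \<le> 1"
    "\<And>x. \<bar>x\<bar> \<le> rp \<Longrightarrow> \<bar>deriv (deriv \<phi>) x\<bar> \<le> Cp * \<bar>x\<bar> powr (\<alpha> - 1 + \<gamma>)"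
    using bigo_power_bound[OF \<phi>_O _ q\<gamma>] by blast
  define C0 where "C0 = (\<bar>km\<bar> + \<bar>kp\<bar>) * \<alpha>"
  define C where "C = C0 + Cw + Cp"
  define r0 where "r0 = min rw rp"
  have C0: "0 \<le> C0" using \<alpha> by (simp add: C0_def)
  have pow: "R powr a \<le> R powr b" if "0 \<le> R" "R \<le> r0" "0 \<le> b" "b \<le> a" for R a b
  proof (cases "R = 0")
    case False
    then show ?thesis using that w(3) by (intro powr_mono') (auto simp: r0_def)
  qed simp
  have weaken: "\<bar>z\<bar> \<le> D * R powr a * \<bar>x - y\<bar> \<Longrightarrow> \<bar>z\<bar> \<le> D * R powr b * \<bar>x - y\<bar>"
    if "0 \<le> R" "R \<le> r0" "0 \<le> b" "b \<le> a" "0 \<le> D" for z D R a b x y :: real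
    using mult_right_mono[OF mult_left_mono[OF pow[OF that(1-4)] that(5)], of "\<bar>x - y\<bar>"] by linarith
  have enlarge: "\<bar>z\<bar> \<le> D * P * \<bar>x - y\<bar> \<Longrightarrow> \<bar>z\<bar> \<le> C * P * \<bar>x - y\<bar>"
    if "D \<le> C" "0 \<le> P" for z D P x y :: real
    using mult_right_mono[OF mult_right_mono[OF that], of "\<bar>x - y\<bar>"] by linarith
  have R0: "0 \<le> R" if "\<bar>x\<bar> \<le> R" for R x :: real using that by linarith
  have W': "\<bar>deriv W x - deriv W y\<bar> \<le> Cw * R powr (\<alpha> - 1 + \<beta>) * \<bar>x - y\<bar>"
    if "R \<le> r0" "\<bar>x\<bar> \<le> R" "\<bar>y\<bar> \<le> R" for R x y
  proof (rule deriv_power_lipschitz[OF _ w(4)])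
    show "(deriv W has_real_derivative deriv (deriv W) r) (at r)" for r using ddW by (simp only: ddW_eq)
  qed (use that w(1) q\<beta> in \<open>auto simp: r0_def\<close>)
  have \<phi>': "\<bar>deriv \<phi> x - deriv \<phi> y\<bar> \<le> Cp * R powr (\<alpha> - 1 + \<gamma>) * \<bar>x - y\<bar>"
    if "R \<le> r0" "\<bar>x\<bar> \<le> R" "\<bar>y\<bar> \<le> R" for R x y
    by (rule deriv_power_lipschitz[OF C2_real_has_deriv(2)[OF \<phi>] f(4)])
      (use that f(1) q\<gamma> in \<open>auto simp: r0_def\<close>)
  show ?thesis
  proof (rule that[of C r0])
    show "0 < C" using C0 w f by (simp add: C_def)
    show "0 < r0" "r0 \<le> 1" using w f by (auto simp: r0_def)
    show "deriv V r = half_powers \<alpha> (- km) kp r + deriv W r" for r by (simp add: dW_eq)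
    fix R x y assume R: "R \<le> r0" and x: "\<bar>x\<bar> \<le> R" and y: "\<bar>y\<bar> \<le> R"
    have R0: "0 \<le> R" using x by linarith
    have "\<bar>deriv W x - deriv W y\<bar> \<le> Cw * R powr (\<alpha> - 1 + \<eta>) * \<bar>x - y\<bar>"
      using \<alpha> \<eta> w(1) by (intro weaken[OF R0 R _ _ _ W'[OF R x y]]) auto
    then show "\<bar>deriv W x - deriv W y\<bar> \<le> C * R powr (\<alpha> - 1 + \<eta>) * \<bar>x - y\<bar>"
      using C0 f(1) by (elim enlarge[rotated 2]) (auto simp: C_def)
    have "\<bar>deriv \<phi> x - deriv \<phi> y\<bar> \<le> Cp * R powr (\<alpha> - 1 + \<eta>) * \<bar>x - y\<bar>"
      using \<alpha> \<eta> f(1) by (intro weaken[OF R0 R _ _ _ \<phi>'[OF R x y]]) auto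
    then show "\<bar>deriv \<phi> x - deriv \<phi> y\<bar> \<le> C * R powr (\<alpha> - 1 + \<eta>) * \<bar>x - y\<bar>"
      using C0 w(1) by (elim enlarge[rotated 2]) (auto simp: C_def)
    have "\<bar>deriv W x - deriv W y\<bar> \<le> Cw * R powr (\<alpha> - 1) * \<bar>x - y\<bar>"
      using \<alpha> \<beta> w(1) by (intro weaken[OF R0 R _ _ _ W'[OF R x y]]) auto
    moreover have "\<bar>half_powers \<alpha> (- km) kp x - half_powers \<alpha> (- km) kp y\<bar> \<le> C0 * R powr (\<alpha> - 1) * \<bar>x - y\<bar>"
      using half_powers_lipschitz[OF \<alpha> x y, of "- km" kp] by (simp add: C0_def)
    ultimately have "\<bar>deriv V x - deriv V y\<bar> \<le> (C0 + Cw) * R powr (\<alpha> - 1) * \<bar>x - y\<bar>"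
      by (simp add: dW_eq algebra_simps)
    then show "\<bar>deriv V x - deriv V y\<bar> \<le> C * R powr (\<alpha> - 1) * \<bar>x - y\<bar>"
      using f(1) by (elim enlarge[rotated 2]) (auto simp: C_def)
  qed
qed

section \<open>The approximation theorem\<close>

text \<open>
  The inverse of the ansatz at time \<open>0\<close>.
\<close>

definition amp_coord :: "real \<times> real \<Rightarrow> complex" where
  "amp_coord z = Complex (fst z) (- snd z) / of_real (sqrt 2)"

lemma norm_amp_coord: "norm (amp_coord z) = norm z / sqrt 2"
  unfolding amp_coord_def norm_divide norm_of_real by (simp add: complex_norm norm_prod_def)

lemma amp_coord_diff: "amp_coord (z - w) = amp_coord z - amp_coord w"
  by (simp add: amp_coord_def complex_eq_iff diff_divide_distrib)

lemma amplitude_init_eq: "amplitude_init X n = amp_coord (X n)"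
  by (simp add: amplitude_init_def amp_coord_def complex_eq_iff)

lemma X_ansatz_eq: "X_ansatz A t n = (sqrt 2 * Re (A t n * cis t), - sqrt 2 * Im (A t n * cis t))"
proof -
  have z: "1 / complex_of_real (sqrt 2) * A t n * exp (\<i> * complex_of_real t) = A t n * cis t / of_real (sqrt 2)"
    by (simp add: cis_conv_exp)
  have r: "y / sqrt 2 + y / sqrt 2 = sqrt 2 * y" for y
    using real_div_sqrt[of 2] by (simp add: field_simps)
  have "Re (w / of_real (sqrt 2) * 1 + cnj (w / of_real (sqrt 2) * 1)) = sqrt 2 * Re w"
    "Re (w / of_real (sqrt 2) * \<i> + cnj (w / of_real (sqrt 2) * \<i>)) = - sqrt 2 * Im w" for w
    using r[of "Re w"] r[of "Im w"] by simp_all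
  then show ?thesis unfolding X_ansatz_def Let_def z by (simp only:)
qed

lemma amp_coord_ansatz: "amp_coord (X_ansatz A t n) = A t n * cis t"
  by (simp add: amp_coord_def X_ansatz_eq complex_eq_iff)

lemma osc_amp_coord: "osc t (cis (- t) * amp_coord z) = fst z"
proof -
  have "cis (- t) * amp_coord z * cis t = (cis (- t) * cis t) * amp_coord z" by (simp only: mult_ac)
  also have "\<dots> = amp_coord z" by (simp add: cis_mult)
  finally have e: "cis (- t) * amp_coord z * cis t = amp_coord z" .
  show ?thesis unfolding osc_def e by (simp add: amp_coord_def)
qed

lemma has_vector_derivative_cis_minus:
  "((\<lambda>s. cis (- s)) has_vector_derivative - \<i> * cis (- s)) (at s within S)"
proof -
  have e: "cis (- s) = exp (s *\<^sub>R (- \<i>))" for s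
    by (simp add: cis_conv_exp scaleR_conv_of_real algebra_simps)
  show ?thesis unfolding e
    using exp_scaleR_has_vector_derivative_right[of "- \<i>" s S] by (simp only: mult.commute)
qed

lemma bounded_linear_amp_coord: "bounded_linear amp_coord"
proof -
  have "linear amp_coord"
    by (rule linearI) (simp_all add: amp_coord_def complex_eq_iff add_divide_distrib diff_divide_distrib)
  then show ?thesis by (rule linear_conv_bounded_linear[THEN iffD1])
qed

text \<open>
  For \<open>D = a - A\<close>, where \<open>a\<close> are the amplitude coordinates of \<open>X\<close>, one has \<open>D' = v1 + v2 + v3\<close>: \<open>v1\<close> is the difference of the lattice forces at \<open>X\<close>
  and at the ansatz and is bounded by \<open>D\<close>; \<open>v2\<close> contains the forces \<open>w\<close> and \<open>h\<close> at the ansatz; \<open>v3\<close> is the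
  oscillating remainder, whose integral is small by averaging. The four terms in the bound come from \<open>D 0\<close>,
  \<open>v2\<close>, the incomplete last period and the slow motion of \<open>A\<close> during the full periods.
\<close>

lemma amplitude_approximation:
  fixes \<alpha> km kp R K \<delta> M :: real and g h w :: "real \<Rightarrow> real"
  assumes \<alpha>: "1 < \<alpha>" and p: "1 \<le> p" and K: "0 < K" and \<delta>: "0 \<le> \<delta>" "\<delta> \<le> K"
    and gK: "\<And>x y. \<bar>g x - g y\<bar> \<le> K * \<bar>x - y\<bar>"
    and h\<delta>: "\<And>x y. \<bar>h x - h y\<bar> \<le> \<delta> * \<bar>x - y\<bar>" and h0: "h 0 = 0"
    and gw: "\<And>x. \<bar>x\<bar> \<le> R \<Longrightarrow> g x = half_powers \<alpha> (- km) kp x + w x"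
    and w\<delta>: "\<And>x y. \<bar>x\<bar> \<le> R \<Longrightarrow> \<bar>y\<bar> \<le> R \<Longrightarrow> \<bar>w x - w y\<bar> \<le> \<delta> * \<bar>x - y\<bar>" and w0: "w 0 = 0"
    and A: "solves_ivp p (amplitude_field \<alpha> km kp) (amplitude_init Xs) \<tau> A"
    and AM: "\<And>t. t \<in> {0..\<tau>} \<Longrightarrow> lp_le p (A t) M" and MR: "3 * M \<le> R"
    and X: "solves_ivp p (lattice_rhs g h) X0 \<tau> X"
    and X0: "lp_le p (\<lambda>n. X0 n - Xs n) d0"
    and t: "t \<in> {0..\<tau>}"
  defines "L \<equiv> lip_amp \<alpha> km kp * R powr (\<alpha> - 1)"
  shows "lp_le p (\<lambda>n. X t n - X_ansatz A t n)
    (4 * (d0 + 9 * \<delta> * M * \<tau> + 16 * pi * L * M + 96 * pi * L\<^sup>2 * M * \<tau>) * exp (18 * K * t))"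
proof -
  let ?S = "{0..\<tau>}"
  let ?\<Phi> = "amplitude_field \<alpha> km kp"
  have M0: "0 \<le> M" using lp_le_nonneg[OF p AM[OF t]] .
  have R0: "0 \<le> R" using M0 MR by linarith
  have d0: "0 \<le> d0" using lp_le_nonneg[OF p X0] .
  have L0: "0 \<le> L" using lip_amp_nonneg[OF \<alpha>] by (simp add: L_def)
  have \<tau>: "0 \<le> \<tau>" using t by auto
  have AMn: "norm (A s n) \<le> M" if "s \<in> ?S" for s n using lp_le_component[OF p AM[OF that]] .
  have lipg: "nn_lipschitz_on UNIV (2 + 3 * K) (lattice_rhs g h)"
    by (rule nn_lipschitz_on_lattice[where S = UNIV, OF gK order_trans[OF h\<delta> mult_right_mono[OF \<delta>(2)]]])
      (use K in auto)
  have locg: "\<exists>c. nn_lipschitz_on (cball 0 r) c (lattice_rhs g h)" for r using nn_lipschitz_on_subset[OF lipg] by blast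
  obtain BX where BX: "\<And>t. t \<in> ?S \<Longrightarrow> lp_le p (X t) BX" and cX: "\<And>n. continuous_on ?S (\<lambda>s. X s n)"
    using solves_ivpE[OF p locg X] by metis
  have cA: "\<And>n. continuous_on ?S (\<lambda>s. A s n)" and c\<Phi>: "\<And>n. continuous_on ?S (\<lambda>s. ?\<Phi> (A s) n)"
    and eA: "\<And>t n. t \<in> ?S \<Longrightarrow> A t n = amplitude_init Xs n + integral {0..t} (\<lambda>s. ?\<Phi> (A s) n)"
    using solves_ivpE[OF p nn_lipschitz_on_amplitude_field[OF \<alpha>] A] by metis+
  define x where "x = (\<lambda>s n. fst (X s n))"
  define xA where "xA = (\<lambda>s n. osc s (A s n))"
  define c where "c = (\<lambda>s n. A s n - A s (n - 1))"
  define a where "a = (\<lambda>s n. cis (- s) * amp_coord (X s n))"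
  define D where "D = (\<lambda>s n. a s n - A s n)"
  define \<kappa> where "\<kappa> = (\<lambda>s. - \<i> * cis (- s) / of_real (sqrt 2))"
  define force where "force = (\<lambda>y (n::int). g (y (n + 1) - y n) - g (y n - y (n - 1)) - h (y n))"
  define v1 where "v1 = (\<lambda>s n. \<kappa> s * of_real (force (x s) n - force (xA s) n))"
  define v3 where "v3 = (\<lambda>s n. - \<i> * (osc_error \<alpha> km kp s (c s (n + 1)) - osc_error \<alpha> km kp s (c s n)))"
  define v2 where "v2 = (\<lambda>s n. \<kappa> s * of_real (force (xA s) n) - ?\<Phi> (A s) n - v3 s n)"
  have norm_\<kappa>: "norm (\<kappa> s) = 1 / sqrt 2" for s by (simp add: \<kappa>_def norm_mult norm_divide)
  have x_osc: "x s n = osc s (a s n)" for s n by (simp add: x_def a_def osc_amp_coord)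
  have cg: "continuous_on UNIV g" and ch: "continuous_on UNIV h"
  proof -
    have "K-lipschitz_on UNIV g" using gK K by (intro lipschitz_onI) (auto simp: dist_real_def)
    then show "continuous_on UNIV g" by (rule lipschitz_on_continuous_on)
    have "\<delta>-lipschitz_on UNIV h" using h\<delta> \<delta> by (intro lipschitz_onI) (auto simp: dist_real_def)
    then show "continuous_on UNIV h" by (rule lipschitz_on_continuous_on)
  qed
  have cx: "continuous_on ?S (\<lambda>s. x s n)" and cxA: "continuous_on ?S (\<lambda>s. xA s n)" and cc: "continuous_on ?S (\<lambda>s. c s n)" for n
    unfolding x_def xA_def c_def osc_def by (intro continuous_intros cX cA)+
  have cforce: "continuous_on ?S (\<lambda>s. force (y s) n)" if "\<And>n. continuous_on ?S (\<lambda>s. y s n)" for y n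
    unfolding force_def
    by (intro continuous_intros continuous_on_compose2[OF cg] continuous_on_compose2[OF ch] that subset_UNIV)
  have c\<kappa>: "continuous_on ?S \<kappa>" unfolding \<kappa>_def by (intro continuous_intros) simp
  have cE: "continuous_on ?S (\<lambda>s. osc_error \<alpha> km kp s (c s n))" for n
    unfolding osc_error_def osc_def using \<alpha>
    by (intro continuous_intros continuous_on_compose2[OF continuous_on_amp[OF \<alpha>]] cc) auto
  have cv1: "continuous_on ?S (\<lambda>s. v1 s n)" and cv3: "continuous_on ?S (\<lambda>s. v3 s n)" for n
    unfolding v1_def v3_def by (intro continuous_intros cforce c\<kappa> cx cxA cE)+
  have cv2: "continuous_on ?S (\<lambda>s. v2 s n)" for n
    unfolding v2_def by (intro continuous_intros cforce c\<kappa> cxA c\<Phi> cv3)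
  have D_eq: "D t n = (D 0 n + integral {0..t} (\<lambda>s. v2 s n) + integral {0..t} (\<lambda>s. v3 s n)) + integral {0..t} (\<lambda>s. v1 s n)"
    if t: "t \<in> ?S" for t n
  proof -
    have sub: "{0..t} \<subseteq> ?S" using t by auto
    have da: "((\<lambda>s. a s n) has_vector_derivative \<kappa> s * of_real (force (x s) n)) (at s within {0..t})"
      if s: "s \<in> {0..t}" for s
    proof -
      have sS: "s \<in> ?S" using s sub by auto
      have "((\<lambda>s. X s n) has_vector_derivative lattice_rhs g h (X s) n) (at s within ?S)"
        using X sS by (intro has_lp_derivative_component[OF p _ sS]) (simp add: solves_ivp_def)
      then have "((\<lambda>s. X s n) has_vector_derivative lattice_rhs g h (X s) n) (at s within {0..t})"
        by (rule has_vector_derivative_within_subset[OF _ sub])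
      from has_vector_derivative_mult[OF has_vector_derivative_cis_minus
          bounded_linear.has_vector_derivative[OF bounded_linear_amp_coord this]]
      have "((\<lambda>s. a s n) has_vector_derivative
          cis (- s) * amp_coord (lattice_rhs g h (X s) n) + - \<i> * cis (- s) * amp_coord (X s n)) (at s within {0..t})"
        by (simp add: a_def)
      moreover have "amp_coord (lattice_rhs g h (X s) n) = \<i> * amp_coord (X s n) - \<i> * of_real (force (x s) n) / of_real (sqrt 2)"
        by (simp add: amp_coord_def lattice_rhs_def force_def x_def complex_eq_iff diff_divide_distrib add_divide_distrib)
      ultimately show ?thesis by (simp add: \<kappa>_def algebra_simps)
    qed
    have Ia: "((\<lambda>s. \<kappa> s * of_real (force (x s) n)) has_integral (a t n - a 0 n)) {0..t}"
      using t by (intro fundamental_theorem_of_calculus da) auto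
    have IA: "((\<lambda>s. ?\<Phi> (A s) n) has_integral (A t n - A 0 n)) {0..t}"
    proof -
      have "(\<lambda>s. ?\<Phi> (A s) n) integrable_on {0..t}"
        by (intro integrable_continuous_real continuous_on_subset[OF c\<Phi> sub])
      then show ?thesis using eA[OF t, of n] eA[of 0 n] \<tau> by (simp add: has_integral_iff)
    qed
    have e: "(a t n - a 0 n) - (A t n - A 0 n) = D t n - D 0 n" by (simp add: D_def)
    from has_integral_diff[OF Ia IA]
    have "((\<lambda>s. \<kappa> s * of_real (force (x s) n) - ?\<Phi> (A s) n) has_integral (D t n - D 0 n)) {0..t}"
      unfolding e .
    then have "D t n - D 0 n = integral {0..t} (\<lambda>s. v2 s n + v3 s n + v1 s n)"
      by (simp add: integral_unique v1_def v2_def algebra_simps)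
    also have "\<dots> = integral {0..t} (\<lambda>s. v2 s n) + integral {0..t} (\<lambda>s. v3 s n) + integral {0..t} (\<lambda>s. v1 s n)"
      by (simp add: integral_add integrable_add integrable_continuous_real continuous_on_subset[OF _ sub] cv1 cv2 cv3)
    finally show ?thesis by (simp add: algebra_simps)
  qed
  have v1_le: "lp_le p (v1 s) (9 * K * m)" if s: "s \<in> ?S" and m: "lp_le p (D s) m" for s m
  proof -
    have "lp_le p (v1 s) (3 * (3 * K) * m)"
    proof (rule lp_le_nearest_neighbour[OF p m])
      fix n
      have dx: "\<bar>x s i - xA s i\<bar> \<le> sqrt 2 * norm (D s i)" for i
        using abs_osc_le[of s "D s i"] by (simp add: x_osc xA_def D_def osc_diff)
      have dg: "\<bar>g (x s i - x s j) - g (xA s i - xA s j)\<bar> \<le> sqrt 2 * (K * (norm (D s i) + norm (D s j)))" for i j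
      proof -
        have "\<bar>g (x s i - x s j) - g (xA s i - xA s j)\<bar> \<le> K * \<bar>(x s i - x s j) - (xA s i - xA s j)\<bar>" by (rule gK)
        also have "\<dots> \<le> K * (sqrt 2 * norm (D s i) + sqrt 2 * norm (D s j))"
          using dx[of i] dx[of j] K by (intro mult_left_mono) auto
        finally show ?thesis by (simp add: algebra_simps)
      qed
      have dh: "\<bar>h (x s n) - h (xA s n)\<bar> \<le> sqrt 2 * (K * norm (D s n))"
      proof -
        have "\<bar>h (x s n) - h (xA s n)\<bar> \<le> \<delta> * \<bar>x s n - xA s n\<bar>" by (rule h\<delta>)
        also have "\<dots> \<le> K * (sqrt 2 * norm (D s n))" using dx[of n] \<delta> by (intro mult_mono) auto
        finally show ?thesis by (simp add: algebra_simps)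
      qed
      have "\<bar>force (x s) n - force (xA s) n\<bar>
          \<le> \<bar>g (x s (n + 1) - x s n) - g (xA s (n + 1) - xA s n)\<bar> + \<bar>g (x s n - x s (n - 1)) - g (xA s n - xA s (n - 1))\<bar>
            + \<bar>h (x s n) - h (xA s n)\<bar>"
        unfolding force_def by simp
      also have "\<dots> \<le> sqrt 2 * (K * (norm (D s (n + 1)) + norm (D s n))) + sqrt 2 * (K * (norm (D s n) + norm (D s (n - 1))))
            + sqrt 2 * (K * norm (D s n))"
        by (intro add_mono dg dh)
      also have "\<dots> = sqrt 2 * (K * (norm (D s (n + 1)) + 3 * norm (D s n) + norm (D s (n - 1))))"
        by (simp add: algebra_simps)
      also have "\<dots> \<le> sqrt 2 * (K * (3 * (norm (D s (n - 1)) + norm (D s n) + norm (D s (n + 1)))))"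
        using K by (intro mult_left_mono) auto
      finally have "\<bar>force (x s) n - force (xA s) n\<bar> / sqrt 2 \<le> K * (3 * (norm (D s (n - 1)) + norm (D s n) + norm (D s (n + 1))))"
        by (simp add: pos_divide_le_eq mult.commute)
      moreover have "norm (v1 s n) = \<bar>force (x s) n - force (xA s) n\<bar> / sqrt 2"
        unfolding v1_def norm_mult norm_\<kappa> norm_of_real by simp
      ultimately show "norm (v1 s n) \<le> 3 * K * (norm (D s (n - 1)) + norm (D s n) + norm (D s (n + 1)))"
        by (simp add: algebra_simps)
    qed (use K in simp)
    then show ?thesis by simp
  qed
  have cR: "norm (c s n) \<le> 2 * M" if "s \<in> ?S" for s n
    using norm_triangle_ineq4[of "A s n" "A s (n - 1)"] AMn[OF that, of n] AMn[OF that, of "n - 1"] by (simp add: c_def)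
  have s2: "sqrt 2 \<le> 3 / 2" by (rule real_le_lsqrt) (auto simp: power2_eq_square)
  have oscR: "\<bar>osc s (c s n)\<bar> \<le> R" if "s \<in> ?S" for s n
  proof -
    have "\<bar>osc s (c s n)\<bar> \<le> sqrt 2 * norm (c s n)" by (rule abs_osc_le)
    also have "\<dots> \<le> 3 / 2 * (2 * M)" using s2 cR[OF that] M0 by (intro mult_mono) auto
    finally show ?thesis using MR by simp
  qed
  have v2_le: "lp_le p (v2 s) (9 * \<delta> * M)" if s: "s \<in> ?S" for s
  proof -
    have "lp_le p (v2 s) (3 * (3 * \<delta>) * M)"
    proof (rule lp_le_nearest_neighbour[OF p AM[OF s]])
      fix n
      have split: "g (xA s i - xA s (i - 1)) = half_powers \<alpha> (- km) kp (osc s (c s i)) + w (osc s (c s i))" for i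
        using gw[OF oscR[OF s]] by (simp add: xA_def c_def flip: osc_diff)
      have f1: "force (xA s) n = (half_powers \<alpha> (- km) kp (osc s (c s (n + 1))) + w (osc s (c s (n + 1))))
            - (half_powers \<alpha> (- km) kp (osc s (c s n)) + w (osc s (c s n))) - h (xA s n)"
        using split[of "n + 1"] split[of n] by (simp add: force_def)
      have f2: "?\<Phi> (A s) n = - \<i> * (amp \<alpha> km kp (c s (n + 1)) - amp \<alpha> km kp (c s n))"
        by (simp add: amplitude_field_eq amp_lattice_def c_def)
      have v2_eq: "v2 s n = \<kappa> s * of_real (w (osc s (c s (n + 1))) - w (osc s (c s n)) - h (xA s n))"
        unfolding v2_def f1 f2 v3_def osc_error_def \<kappa>_def
        by (simp add: algebra_simps diff_divide_distrib add_divide_distrib)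
      have wle: "\<bar>w (osc s (c s i))\<bar> \<le> sqrt 2 * (\<delta> * (norm (A s i) + norm (A s (i - 1))))" for i
      proof -
        have "\<bar>w (osc s (c s i)) - w 0\<bar> \<le> \<delta> * \<bar>osc s (c s i) - 0\<bar>"
          using oscR[OF s] R0 by (intro w\<delta>) auto
        also have "\<dots> \<le> \<delta> * (sqrt 2 * (norm (A s i) + norm (A s (i - 1))))"
        proof (intro mult_left_mono \<delta>)
          have "\<bar>osc s (c s i) - 0\<bar> \<le> sqrt 2 * norm (c s i)" using abs_osc_le[of s "c s i"] by simp
          also have "\<dots> \<le> sqrt 2 * (norm (A s i) + norm (A s (i - 1)))"
            unfolding c_def by (intro mult_left_mono norm_triangle_ineq4) simp
          finally show "\<bar>osc s (c s i) - 0\<bar> \<le> sqrt 2 * (norm (A s i) + norm (A s (i - 1)))" .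
        qed
        finally show ?thesis by (simp add: w0 algebra_simps)
      qed
      have hle: "\<bar>h (xA s n)\<bar> \<le> sqrt 2 * (\<delta> * norm (A s n))"
      proof -
        have "\<bar>h (xA s n) - h 0\<bar> \<le> \<delta> * \<bar>xA s n - 0\<bar>" by (rule h\<delta>)
        also have "\<dots> \<le> \<delta> * (sqrt 2 * norm (A s n))"
          using abs_osc_le[of s "A s n"] \<delta> by (intro mult_left_mono) (auto simp: xA_def)
        finally show ?thesis by (simp add: h0 algebra_simps)
      qed
      have "\<bar>w (osc s (c s (n + 1))) - w (osc s (c s n)) - h (xA s n)\<bar>
          \<le> \<bar>w (osc s (c s (n + 1)))\<bar> + \<bar>w (osc s (c s n))\<bar> + \<bar>h (xA s n)\<bar>" by simp
      also have "\<dots> \<le> sqrt 2 * (\<delta> * (norm (A s (n + 1)) + norm (A s (n + 1 - 1))))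
          + sqrt 2 * (\<delta> * (norm (A s n) + norm (A s (n - 1)))) + sqrt 2 * (\<delta> * norm (A s n))"
        by (intro add_mono wle hle)
      also have "\<dots> = sqrt 2 * (\<delta> * (norm (A s (n + 1)) + 3 * norm (A s n) + norm (A s (n - 1))))"
        by (simp add: algebra_simps)
      also have "\<dots> \<le> sqrt 2 * (\<delta> * (3 * (norm (A s (n - 1)) + norm (A s n) + norm (A s (n + 1)))))"
        using \<delta> by (intro mult_left_mono) auto
      finally have "\<bar>w (osc s (c s (n + 1))) - w (osc s (c s n)) - h (xA s n)\<bar> / sqrt 2
          \<le> \<delta> * (3 * (norm (A s (n - 1)) + norm (A s n) + norm (A s (n + 1))))"
        by (simp add: pos_divide_le_eq mult.commute)
      moreover have "norm (v2 s n) = \<bar>w (osc s (c s (n + 1))) - w (osc s (c s n)) - h (xA s n)\<bar> / sqrt 2"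
        unfolding v2_eq norm_mult norm_\<kappa> norm_of_real by simp
      ultimately show "norm (v2 s n) \<le> 3 * \<delta> * (norm (A s (n - 1)) + norm (A s n) + norm (A s (n + 1)))"
        by (simp add: algebra_simps)
    qed (use \<delta> in simp)
    then show ?thesis by simp
  qed
  have clp: "lp_le p (c s) (2 * M)" if "s \<in> ?S" for s
    unfolding c_def using lp_le_diff[OF p AM[OF that] lp_le_shift[OF p AM[OF that], of "-1"]] by simp
  have \<Phi>_le: "lp_le p (?\<Phi> (A s)) (6 * L * M)" if s: "s \<in> ?S" for s
  proof -
    have lip2: "nn_lipschitz_on (cball 0 (R / 2)) (2 * L) ?\<Phi>"
      unfolding amplitude_field_eq L_def
    proof (rule nn_lipschitz_on_amp_lattice)
      show "a - b \<in> cball 0 R" if "a \<in> cball 0 (R / 2)" "b \<in> cball 0 (R / 2)" for a b :: complex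
        using that norm_triangle_ineq4[of a b] by simp
    qed (use lip_amp_nonneg[OF \<alpha>] amp_lipschitz[OF \<alpha>] in auto)
    have inB: "A s n \<in> cball 0 (R / 2)" "(0::complex) \<in> cball 0 (R / 2)" for n
      using AMn[OF s, of n] MR M0 R0 by simp_all
    have "lp_le p (\<lambda>n. A s n - 0) M" using AM[OF s] by simp
    from nn_lipschitz_on_lp_le[OF p lip2 inB this]
    have "lp_le p (\<lambda>n. ?\<Phi> (A s) n - ?\<Phi> (\<lambda>_. 0) n) (3 * (2 * L) * M)" .
    moreover have "?\<Phi> (\<lambda>_. 0) n = 0" for n by (simp add: amplitude_field_eq amp_lattice_def)
    ultimately show ?thesis by simp
  qed
  have slowA: "lp_le p (\<lambda>n. A t n - A s n) (6 * L * M * \<bar>t - s\<bar>)" if "s \<in> ?S" "t \<in> ?S" for s t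
    by (rule lp_le_time_lipschitz[OF p, where v = "\<lambda>s. ?\<Phi> (A s)", OF c\<Phi> \<Phi>_le eA that])
  have slow: "lp_le p (\<lambda>n. c t n - c s n) (12 * L * M * \<bar>t - s\<bar>)" if "s \<in> ?S" "t \<in> ?S" for s t
  proof -
    have "lp_le p (\<lambda>n. (A t n - A s n) - (A t (n + -1) - A s (n + -1))) (6 * L * M * \<bar>t - s\<bar> + 6 * L * M * \<bar>t - s\<bar>)"
      by (rule lp_le_diff[OF p slowA[OF that] lp_le_shift[OF p slowA[OF that]]])
    moreover have "(A t n - A s n) - (A t (n + -1) - A s (n + -1)) = c t n - c s n" for n by (simp add: c_def)
    moreover have "6 * L * M * \<bar>t - s\<bar> + 6 * L * M * \<bar>t - s\<bar> = 12 * L * M * \<bar>t - s\<bar>" by simp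
    ultimately show ?thesis by (simp only:)
  qed
  have v3_le: "lp_le p (\<lambda>n. integral {0..t} (\<lambda>s. v3 s n)) (16 * pi * L * M + 96 * pi * L\<^sup>2 * M * \<tau>)"
    if t: "t \<in> ?S" for t
  proof -
    define J where "J = (\<lambda>n. integral {0..t} (\<lambda>s. osc_error \<alpha> km kp s (c s n)))"
    have J: "lp_le p J (2 * pi * (2 * L) * (2 * M) + 2 * pi * (2 * L) * (12 * L * M) * t)"
      unfolding J_def L_def
      by (rule lp_le_integral_osc_error[OF \<alpha> p _ cc clp _ slow[unfolded L_def] t])
        (use MR M0 lip_amp_nonneg[OF \<alpha>] in auto)
    have sub: "{0..t} \<subseteq> ?S" using t by auto
    have iE: "(\<lambda>s. osc_error \<alpha> km kp s (c s n)) integrable_on {0..t}" for n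
      by (intro integrable_continuous_real continuous_on_subset[OF cE sub])
    have v3J: "integral {0..t} (\<lambda>s. v3 s n) = - \<i> * (J (n + 1) - J n)" for n
      unfolding v3_def J_def by (simp only: integral_mult_right integral_diff[OF iE iE])
    have "lp_le p (\<lambda>n. J (n + 1) - J n)
        ((2 * pi * (2 * L) * (2 * M) + 2 * pi * (2 * L) * (12 * L * M) * t) + (2 * pi * (2 * L) * (2 * M) + 2 * pi * (2 * L) * (12 * L * M) * t))"
      by (rule lp_le_diff[OF p lp_le_shift[OF p J] J])
    then have "lp_le p (\<lambda>n. J (n + 1) - J n) (16 * pi * L * M + 96 * pi * L\<^sup>2 * M * t)"
      by (simp add: power2_eq_square algebra_simps)
    moreover have "96 * pi * L\<^sup>2 * M * t \<le> 96 * pi * L\<^sup>2 * M * \<tau>" using t M0 by (intro mult_left_mono) auto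
    ultimately have "lp_le p (\<lambda>n. J (n + 1) - J n) (16 * pi * L * M + 96 * pi * L\<^sup>2 * M * \<tau>)"
      by (rule_tac lp_le_mono) auto
    then show ?thesis unfolding v3J by (rule lp_le_dominated[OF p]) (simp add: norm_mult)
  qed
  have iv2_le: "lp_le p (\<lambda>n. integral {0..t} (\<lambda>s. v2 s n)) (9 * \<delta> * M * \<tau>)" if t: "t \<in> ?S" for t
  proof -
    have "lp_le p (\<lambda>n. integral {0..t} (\<lambda>s. v2 s n)) ((t - 0) * (9 * \<delta> * M))"
      using t by (intro lp_le_integral_const p v2_le continuous_on_subset[OF cv2]) auto
    moreover have "(9 * \<delta> * M) * (t - 0) \<le> (9 * \<delta> * M) * \<tau>" using t \<delta> M0 by (intro mult_left_mono) auto
    ultimately show ?thesis by (rule_tac lp_le_mono) (auto simp: mult.commute)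
  qed
  have D0: "lp_le p (D 0) d0"
  proof (rule lp_le_dominated[OF p X0])
    fix n
    have "X 0 = X0" "A 0 = amplitude_init Xs" using X A by (auto simp: solves_ivp_def)
    then have "D 0 n = amp_coord (X0 n - Xs n)" by (simp add: D_def a_def amplitude_init_eq amp_coord_diff)
    then have "norm (D 0 n) = norm (X0 n - Xs n) / sqrt 2" by (simp add: norm_amp_coord)
    also have "\<dots> \<le> norm (X0 n - Xs n)" by (simp add: divide_le_eq mult_le_cancel_left1)
    finally show "norm (D 0 n) \<le> norm (X0 n - Xs n)" .
  qed
  have BD: "lp_le p (D t) (BX + M)" if t: "t \<in> ?S" for t
  proof -
    have "lp_le p (a t) BX"
      by (rule lp_le_dominated[OF p BX[OF t]])
        (simp add: a_def norm_mult norm_amp_coord divide_le_eq mult_le_cancel_left1)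
    from lp_le_diff[OF p this AM[OF t]] show ?thesis by (simp add: D_def)
  qed
  have Dt: "lp_le p (D t) (2 * (d0 + 9 * \<delta> * M * \<tau> + (16 * pi * L * M + 96 * pi * L\<^sup>2 * M * \<tau>)) * exp (2 * (9 * K) * t))"
  proof (rule lp_gronwall[OF p _ D_eq _ cv1 BD v1_le t])
    show "lp_le p (\<lambda>n. D 0 n + integral {0..t} (\<lambda>s. v2 s n) + integral {0..t} (\<lambda>s. v3 s n))
        (d0 + 9 * \<delta> * M * \<tau> + (16 * pi * L * M + 96 * pi * L\<^sup>2 * M * \<tau>))" if "t \<in> ?S" for t
      by (intro lp_le_add p D0 iv2_le v3_le that)
  qed (use K in auto)
  have "lp_le p (\<lambda>n. X t n - X_ansatz A t n)
      (2 * (2 * (d0 + 9 * \<delta> * M * \<tau> + (16 * pi * L * M + 96 * pi * L\<^sup>2 * M * \<tau>)) * exp (2 * (9 * K) * t)))"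
  proof (rule lp_le_cmult[OF p Dt])
    fix n
    have "cis (- t) * amp_coord (X t n - X_ansatz A t n) = a t n - A t n * (cis t * cis (- t))"
      by (simp add: amp_coord_diff amp_coord_ansatz a_def algebra_simps)
    also have "cis t * cis (- t) = 1" by (simp add: cis_mult)
    finally have "norm (D t n) = norm (cis (- t) * amp_coord (X t n - X_ansatz A t n))" by (simp add: D_def)
    then have "norm (X t n - X_ansatz A t n) = sqrt 2 * norm (D t n)"
      by (simp add: norm_mult norm_amp_coord)
    also have "\<dots> \<le> 2 * norm (D t n)" using s2 by (intro mult_right_mono) auto
    finally show "norm (X t n - X_ansatz A t n) \<le> 2 * norm (D t n)" .
  qed simp
  then show ?thesis by (simp add: algebra_simps)
qed

text \<open>
  The powers of \<open>e\<close> in the bound of the approximation error. After insertion of the scalings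
  \<open>R = R1 e\<close>, \<open>M = M1 e\<close> and \<open>\<tau> = T e\<^sup>1\<^sup>-\<^sup>\<alpha>\<close> the exponent of Gronwall's lemma does not depend on \<open>e\<close>,
  and each error term is a multiple of \<open>e\<^sup>1\<^sup>+\<^sup>\<eta>\<close> or of \<open>e\<^sup>\<alpha> \<le> e\<^sup>1\<^sup>+\<^sup>\<eta>\<close>.
\<close>

lemma error_constant_le:
  assumes \<alpha>: "1 < \<alpha>" and \<eta>: "\<eta> \<le> \<alpha> - 1" and e: "0 < e" "e \<le> 1" and T: "0 < T"
    and nonneg: "0 \<le> C" "0 \<le> l" "0 < R1" "0 \<le> M1" "0 \<le> d"
    and t: "t \<le> T * e powr (1 - \<alpha>)"
  defines "R \<equiv> R1 * e" and "\<tau> \<equiv> T * e powr (1 - \<alpha>)"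
  defines "L \<equiv> l * R powr (\<alpha> - 1)"
  shows "4 * (d * e powr (1 + \<eta>) + 9 * (C * R powr (\<alpha> - 1 + \<eta>)) * (M1 * e) * \<tau>
      + 16 * pi * L * (M1 * e) + 96 * pi * L\<^sup>2 * (M1 * e) * \<tau>) * exp (18 * (C * R powr (\<alpha> - 1)) * t)
    \<le> 4 * (d + 9 * C * R1 powr (\<alpha> - 1 + \<eta>) * M1 * T + 16 * pi * (l * R1 powr (\<alpha> - 1)) * M1
      + 96 * pi * (l * R1 powr (\<alpha> - 1))\<^sup>2 * M1 * T) * exp (18 * C * R1 powr (\<alpha> - 1) * T) * e powr (1 + \<eta>)"
proof -
  define l1 where "l1 = l * R1 powr (\<alpha> - 1)"
  have l1: "0 \<le> l1" using nonneg by (simp add: l1_def)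
  have R: "R powr a = R1 powr a * e powr a" for a using nonneg e by (simp add: R_def powr_mult)
  have L: "L = l1 * e powr (\<alpha> - 1)" by (simp add: L_def l1_def R)
  have e_mult: "e * e powr a = e powr (1 + a)" for a using e by (simp add: powr_mult_base)
  have e_le: "e powr \<alpha> \<le> e powr (1 + \<eta>)" using e \<eta> by (intro powr_mono') auto
  have i1: "9 * (C * R powr (\<alpha> - 1 + \<eta>)) * (M1 * e) * \<tau> = 9 * C * R1 powr (\<alpha> - 1 + \<eta>) * M1 * T * e powr (1 + \<eta>)"
  proof -
    have "e powr (\<alpha> - 1 + \<eta>) * (e * e powr (1 - \<alpha>)) = e powr (1 + \<eta>)"
      unfolding e_mult powr_add[symmetric] by simp
    moreover have "9 * (C * R powr (\<alpha> - 1 + \<eta>)) * (M1 * e) * \<tau>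
        = 9 * C * R1 powr (\<alpha> - 1 + \<eta>) * M1 * T * (e powr (\<alpha> - 1 + \<eta>) * (e * e powr (1 - \<alpha>)))"
      by (simp add: R \<tau>_def)
    ultimately show ?thesis by simp
  qed
  have i2: "16 * pi * L * (M1 * e) \<le> 16 * pi * l1 * M1 * e powr (1 + \<eta>)"
  proof -
    have "16 * pi * L * (M1 * e) = 16 * pi * l1 * M1 * (e * e powr (\<alpha> - 1))" by (simp add: L)
    also have "\<dots> = 16 * pi * l1 * M1 * e powr \<alpha>" by (simp add: e_mult)
    also have "\<dots> \<le> 16 * pi * l1 * M1 * e powr (1 + \<eta>)" using e_le l1 nonneg by (intro mult_left_mono) auto
    finally show ?thesis .
  qed
  have i3: "96 * pi * L\<^sup>2 * (M1 * e) * \<tau> \<le> 96 * pi * l1\<^sup>2 * M1 * T * e powr (1 + \<eta>)"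
  proof -
    have "96 * pi * L\<^sup>2 * (M1 * e) * \<tau>
        = 96 * pi * l1\<^sup>2 * M1 * T * (e powr (\<alpha> - 1) * e powr (\<alpha> - 1) * (e * e powr (1 - \<alpha>)))"
      by (simp add: L \<tau>_def power2_eq_square)
    also have "e powr (\<alpha> - 1) * e powr (\<alpha> - 1) * (e * e powr (1 - \<alpha>)) = e powr \<alpha>"
      unfolding e_mult powr_add[symmetric] by simp
    also have "96 * pi * l1\<^sup>2 * M1 * T * e powr \<alpha> \<le> 96 * pi * l1\<^sup>2 * M1 * T * e powr (1 + \<eta>)"
      using e_le nonneg T by (intro mult_left_mono) auto
    finally show ?thesis .
  qed
  have sum: "d * e powr (1 + \<eta>) + 9 * (C * R powr (\<alpha> - 1 + \<eta>)) * (M1 * e) * \<tau>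
      + 16 * pi * L * (M1 * e) + 96 * pi * L\<^sup>2 * (M1 * e) * \<tau>
    \<le> (d + 9 * C * R1 powr (\<alpha> - 1 + \<eta>) * M1 * T + 16 * pi * l1 * M1 + 96 * pi * l1\<^sup>2 * M1 * T) * e powr (1 + \<eta>)"
    unfolding i1 distrib_right by (intro add_mono order_refl i2 i3)
  have ex: "18 * (C * R powr (\<alpha> - 1)) * t \<le> 18 * C * R1 powr (\<alpha> - 1) * T"
  proof -
    have "18 * (C * R powr (\<alpha> - 1)) * t \<le> 18 * (C * R powr (\<alpha> - 1)) * \<tau>"
      using t nonneg by (intro mult_left_mono) (auto simp: \<tau>_def)
    also have "\<dots> = 18 * C * R1 powr (\<alpha> - 1) * T * (e powr (\<alpha> - 1) * e powr (1 - \<alpha>))" by (simp add: R \<tau>_def)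
    also have "e powr (\<alpha> - 1) * e powr (1 - \<alpha>) = 1" using e by (simp flip: powr_add)
    finally show ?thesis by simp
  qed
  have "4 * (d * e powr (1 + \<eta>) + 9 * (C * R powr (\<alpha> - 1 + \<eta>)) * (M1 * e) * \<tau>
      + 16 * pi * L * (M1 * e) + 96 * pi * L\<^sup>2 * (M1 * e) * \<tau>) * exp (18 * (C * R powr (\<alpha> - 1)) * t)
    \<le> 4 * ((d + 9 * C * R1 powr (\<alpha> - 1 + \<eta>) * M1 * T + 16 * pi * l1 * M1 + 96 * pi * l1\<^sup>2 * M1 * T) * e powr (1 + \<eta>))
      * exp (18 * C * R1 powr (\<alpha> - 1) * T)"
    by (rule mult_mono) (use sum ex T l1 nonneg in auto)
  then show ?thesis unfolding l1_def[symmetric] by (simp only: mult_ac)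
qed

theorem theorem2p19:
  fixes \<alpha> \<beta> \<gamma> km kp \<eta> Ci :: real
    and V W \<phi> :: "real \<Rightarrow> real"
    and p :: ereal
  assumes alpha: "\<alpha> > 1" and k: "(km, kp) \<noteq> (0, 0)" and beta: "\<beta> > 0" and gamma: "\<gamma> > 0"
    and V_C2: "C2_real V"
    and V_split: "\<And>r. V r = V_alpha \<alpha> km kp r + W r"
    and W_0: "deriv W 0 = 0"
    and W_O: "deriv (deriv W) \<in> O[at 0](\<lambda>r. \<bar>r\<bar> powr (\<alpha> - 1 + \<beta>))"
    and phi_C2: "C2_real \<phi>"
    and phi_0: "deriv \<phi> 0 = 0"
    and phi_O: "deriv (deriv \<phi>) \<in> O[at 0](\<lambda>x. \<bar>x\<bar> powr (\<alpha> - 1 + \<gamma>))"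
    and p: "1 \<le> p"
    and eta: "\<eta> = min (\<alpha> - 1) (min \<beta> \<gamma>)"
    and Ci: "Ci > 0"
  shows "\<exists>Tm::ereal. 0 < Tm \<and> (p \<le> ereal (1 + \<alpha>) \<longrightarrow> Tm = \<infinity>) \<and>
    (\<forall>T::real. 0 < T \<and> ereal T < Tm \<longrightarrow>
      (\<exists>\<epsilon>T CT. \<epsilon>T > 0 \<and> CT \<ge> Ci \<and>
        (\<forall>Xs \<in> lp p. \<forall>\<epsilon>. \<epsilon> = lp_norm p Xs \<and> 0 < \<epsilon> \<and> \<epsilon> \<le> \<epsilon>T \<longrightarrow>
          (\<exists>A. lp_C2_on p {0..T * \<epsilon> powr (1 - \<alpha>)} A \<and>
            is_the_solution p (amplitude_field \<alpha> km kp) (amplitude_init Xs)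
              (T * \<epsilon> powr (1 - \<alpha>)) A \<and>
            (\<forall>X0 \<in> lp p. lp_norm p (\<lambda>n. X0 n - Xs n) \<le> Ci * \<epsilon> powr (1 + \<eta>) \<longrightarrow>
              (\<exists>X. is_the_solution p (lattice_field V \<phi>) X0 (T * \<epsilon> powr (1 - \<alpha>)) X \<and>
                (\<forall>t\<in>{0..T * \<epsilon> powr (1 - \<alpha>)}.
                  lp_norm p (\<lambda>n. X t n - X_ansatz A t n) \<le> CT * \<epsilon> powr (1 + \<eta>))))))))"
proof -
  have \<eta>0: "0 < \<eta>" and \<eta>: "\<eta> \<le> \<alpha> - 1" "\<eta> \<le> \<beta>" "\<eta> \<le> \<gamma>" using alpha beta gamma by (auto simp: eta)
  have rate: "0 < amp_rate \<alpha> km kp" using lip_amp_pos[OF alpha k] by (simp add: amp_rate_def)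
  have l0: "0 \<le> lip_amp \<alpha> km kp" by (rule lip_amp_nonneg[OF alpha])
  obtain C r0 where C: "0 < C" and r0: "0 < r0" "r0 \<le> 1"
    and split: "\<And>r. deriv V r = half_powers \<alpha> (- km) kp r + deriv W r"
    and lipV: "\<And>R x y. R \<le> r0 \<Longrightarrow> \<bar>x\<bar> \<le> R \<Longrightarrow> \<bar>y\<bar> \<le> R \<Longrightarrow> \<bar>deriv V x - deriv V y\<bar> \<le> C * R powr (\<alpha> - 1) * \<bar>x - y\<bar>"
    and lipW: "\<And>R x y. R \<le> r0 \<Longrightarrow> \<bar>x\<bar> \<le> R \<Longrightarrow> \<bar>y\<bar> \<le> R \<Longrightarrow> \<bar>deriv W x - deriv W y\<bar> \<le> C * R powr (\<alpha> - 1 + \<eta>) * \<bar>x - y\<bar>"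
    and lip\<phi>: "\<And>R x y. R \<le> r0 \<Longrightarrow> \<bar>x\<bar> \<le> R \<Longrightarrow> \<bar>y\<bar> \<le> R \<Longrightarrow> \<bar>deriv \<phi> x - deriv \<phi> y\<bar> \<le> C * R powr (\<alpha> - 1 + \<eta>) * \<bar>x - y\<bar>"
    using nonlinearity_bounds[OF alpha less_imp_le[OF \<eta>0] \<eta>(2,3) beta gamma V_C2 V_split W_O phi_C2 phi_O] by blast
  define Tm :: ereal where "Tm = (if p \<le> ereal (1 + \<alpha>) then \<infinity> else ereal (ln 2 / amp_rate \<alpha> km kp))"
  have main: "\<exists>\<epsilon>T CT. \<epsilon>T > 0 \<and> CT \<ge> Ci \<and>
        (\<forall>Xs \<in> lp p. \<forall>\<epsilon>. \<epsilon> = lp_norm p Xs \<and> 0 < \<epsilon> \<and> \<epsilon> \<le> \<epsilon>T \<longrightarrow>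
          (\<exists>A. lp_C2_on p {0..T * \<epsilon> powr (1 - \<alpha>)} A \<and>
            is_the_solution p (amplitude_field \<alpha> km kp) (amplitude_init Xs)
              (T * \<epsilon> powr (1 - \<alpha>)) A \<and>
            (\<forall>X0 \<in> lp p. lp_norm p (\<lambda>n. X0 n - Xs n) \<le> Ci * \<epsilon> powr (1 + \<eta>) \<longrightarrow>
              (\<exists>X. is_the_solution p (lattice_field V \<phi>) X0 (T * \<epsilon> powr (1 - \<alpha>)) X \<and>
                (\<forall>t\<in>{0..T * \<epsilon> powr (1 - \<alpha>)}.
                  lp_norm p (\<lambda>n. X t n - X_ansatz A t n) \<le> CT * \<epsilon> powr (1 + \<eta>))))))"
    if T: "0 < T" "ereal T < Tm" for T :: real
  proof -
    have time: "p \<le> ereal (1 + \<alpha>) \<or> amp_rate \<alpha> km kp * T \<le> ln 2"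
      using T(2) rate by (auto simp: Tm_def field_simps split: if_splits)
    define M1 where "M1 = 2 * exp (amp_rate \<alpha> km kp * T)"
    \<comment> \<open>\<open>M1 \<epsilon>\<close> bounds \<open>A\<close>. The factor \<open>8\<close> leaves room for a difference of two displacements: each has size at most
        \<open>\<surd>2 M1 \<epsilon>\<close> in the ansatz, plus an approximation error of at most \<open>2 M1 \<epsilon>\<close>.\<close>
    define R1 where "R1 = 8 * M1"
    have M1: "0 < M1" and R1: "0 < R1" by (simp_all add: M1_def R1_def)
    define S where "S = Ci + 9 * C * R1 powr (\<alpha> - 1 + \<eta>) * M1 * T + 16 * pi * (lip_amp \<alpha> km kp * R1 powr (\<alpha> - 1)) * M1
      + 96 * pi * (lip_amp \<alpha> km kp * R1 powr (\<alpha> - 1))\<^sup>2 * M1 * T"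
    define CT where "CT = 4 * S * exp (18 * C * R1 powr (\<alpha> - 1) * T)"
    have S: "Ci \<le> S" using C M1 T l0 by (simp add: S_def)
    have "1 \<le> exp (18 * C * R1 powr (\<alpha> - 1) * T)" using C T by simp
    then have "Ci * 1 \<le> (4 * S) * exp (18 * C * R1 powr (\<alpha> - 1) * T)"
      using S Ci by (intro mult_mono) auto
    then have CT: "Ci \<le> CT" by (simp add: CT_def)
    then have CT0: "0 < CT" using Ci by linarith
    \<comment> \<open>The second condition keeps the cutoff in the region of the local bounds; the third one makes the
        approximation error at most \<open>2 M1 \<epsilon>\<close>.\<close>
    define \<epsilon>T where "\<epsilon>T = min 1 (min (r0 / R1) ((2 * M1 / CT) powr (1 / \<eta>)))"
    have \<epsilon>T: "0 < \<epsilon>T" using r0 R1 M1 CT0 by (simp add: \<epsilon>T_def)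
    have solutions: "\<exists>A. lp_C2_on p {0..T * \<epsilon> powr (1 - \<alpha>)} A \<and>
            is_the_solution p (amplitude_field \<alpha> km kp) (amplitude_init Xs)
              (T * \<epsilon> powr (1 - \<alpha>)) A \<and>
            (\<forall>X0 \<in> lp p. lp_norm p (\<lambda>n. X0 n - Xs n) \<le> Ci * \<epsilon> powr (1 + \<eta>) \<longrightarrow>
              (\<exists>X. is_the_solution p (lattice_field V \<phi>) X0 (T * \<epsilon> powr (1 - \<alpha>)) X \<and>
                (\<forall>t\<in>{0..T * \<epsilon> powr (1 - \<alpha>)}.
                  lp_norm p (\<lambda>n. X t n - X_ansatz A t n) \<le> CT * \<epsilon> powr (1 + \<eta>))))"
      if Xs: "Xs \<in> lp p" and \<epsilon>: "\<epsilon> = lp_norm p Xs" "0 < \<epsilon>" "\<epsilon> \<le> \<epsilon>T" for Xs \<epsilon>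
    proof -
      define \<tau> where "\<tau> = T * \<epsilon> powr (1 - \<alpha>)"
      define R where "R = R1 * \<epsilon>"
      define K where "K = C * R powr (\<alpha> - 1)"
      define \<delta> where "\<delta> = C * R powr (\<alpha> - 1 + \<eta>)"
      have \<tau>: "0 \<le> \<tau>" using T by (simp add: \<tau>_def)
      have e1: "\<epsilon> \<le> 1" and eR: "\<epsilon> \<le> r0 / R1" and eCT: "\<epsilon> \<le> (2 * M1 / CT) powr (1 / \<eta>)"
        using \<epsilon>(3) by (auto simp: \<epsilon>T_def)
      have R: "0 < R" "R \<le> r0" using eR R1 \<epsilon>(2) by (auto simp: R_def field_simps)
      have K: "0 < K" using C R by (simp add: K_def)
      have \<delta>: "0 \<le> \<delta>" using C by (simp add: \<delta>_def)
      have \<delta>K: "\<delta> \<le> K" unfolding \<delta>_def K_def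
        using C R r0 \<eta>0 by (intro mult_left_mono powr_mono') auto
      have "\<epsilon> powr \<eta> \<le> ((2 * M1 / CT) powr (1 / \<eta>)) powr \<eta>"
        using eCT \<epsilon>(2) \<eta>0 by (intro powr_mono2) auto
      also have "\<dots> = 2 * M1 / CT" using \<eta>0 M1 CT0 by (simp add: powr_powr)
      finally have "CT * \<epsilon> powr \<eta> \<le> 2 * M1" using CT0 by (simp add: field_simps)
      then have "\<epsilon> * (CT * \<epsilon> powr \<eta>) \<le> \<epsilon> * (2 * M1)" using \<epsilon>(2) by (intro mult_left_mono) auto
      then have CT\<epsilon>: "CT * \<epsilon> powr (1 + \<eta>) \<le> 2 * (M1 * \<epsilon>)" using \<epsilon>(2) by (simp add: powr_add mult_ac)
      have "lp_le p Xs \<epsilon>" using Xs \<epsilon>(1) by (simp add: lp_le_def)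
      then have A0: "lp_le p (amplitude_init Xs) \<epsilon>"
        by (rule lp_le_dominated[OF p])
          (simp add: amplitude_init_eq norm_amp_coord divide_le_eq mult_le_cancel_left1)
      obtain A where A: "solves_ivp p (amplitude_field \<alpha> km kp) (amplitude_init Xs) \<tau> A"
        and AM: "\<And>t. t \<in> {0..\<tau>} \<Longrightarrow> lp_le p (A t) (M1 * \<epsilon>)"
        using amplitude_exists[OF alpha p k T(1) \<epsilon>(2) A0 time] unfolding \<tau>_def M1_def by metis
      have lattice: "\<exists>X. is_the_solution p (lattice_field V \<phi>) X0 \<tau> X \<and>
          (\<forall>t\<in>{0..\<tau>}. lp_norm p (\<lambda>n. X t n - X_ansatz A t n) \<le> CT * \<epsilon> powr (1 + \<eta>))"
        if X0: "X0 \<in> lp p" and close: "lp_norm p (\<lambda>n. X0 n - Xs n) \<le> Ci * \<epsilon> powr (1 + \<eta>)" for X0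
      proof -
        define g where "g = (\<lambda>x. deriv V (cutoff R x))"
        define h where "h = (\<lambda>x. deriv \<phi> (cutoff R x))"
        have cut: "\<bar>cutoff R x\<bar> \<le> R" "\<bar>cutoff R x - cutoff R y\<bar> \<le> \<bar>x - y\<bar>" for x y :: real
          using norm_cutoff[of R x] cutoff_lipschitz[of R x y] R(1) by simp_all
        have gK: "\<bar>g x - g y\<bar> \<le> K * \<bar>x - y\<bar>" for x y
          unfolding g_def K_def using C
          by (intro order_trans[OF lipV[OF R(2) cut(1) cut(1)]] mult_left_mono cut(2)) simp
        have h\<delta>: "\<bar>h x - h y\<bar> \<le> \<delta> * \<bar>x - y\<bar>" for x y
          unfolding h_def \<delta>_def using C
          by (intro order_trans[OF lip\<phi>[OF R(2) cut(1) cut(1)]] mult_left_mono cut(2)) simp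
        have g0: "g 0 = 0" and h0: "h 0 = 0"
          using R(1) split[of 0] by (simp_all add: g_def h_def cutoff_0 W_0 phi_0)
        have "nn_lipschitz_on UNIV (2 + 3 * K) (lattice_rhs g h)"
          by (rule nn_lipschitz_on_lattice[where S = UNIV, OF gK order_trans[OF h\<delta> mult_right_mono[OF \<delta>K]]])
            (use K in auto)
        moreover have "lattice_rhs g h (\<lambda>_. 0) = (\<lambda>_. 0)" by (simp add: fun_eq_iff lattice_rhs_def g0 h0 zero_prod_def)
        ultimately obtain X where X: "solves_ivp p (lattice_rhs g h) X0 \<tau> X"
          using picard_existence[OF p \<tau> _ _ X0] by blast
        have X0s: "lp_le p (\<lambda>n. X0 n - Xs n) (Ci * \<epsilon> powr (1 + \<eta>))"
          using close X0 Xs by (auto simp: lp_le_def intro: lp_diff p)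
        have approx: "lp_le p (\<lambda>n. X t n - X_ansatz A t n) (CT * \<epsilon> powr (1 + \<eta>))" if t: "t \<in> {0..\<tau>}" for t
        proof -
          have gw: "g x = half_powers \<alpha> (- km) kp x + deriv W x" if "\<bar>x\<bar> \<le> R" for x
            using that split by (simp add: g_def cutoff_eq)
          have w\<delta>: "\<bar>deriv W x - deriv W y\<bar> \<le> \<delta> * \<bar>x - y\<bar>" if "\<bar>x\<bar> \<le> R" "\<bar>y\<bar> \<le> R" for x y
            unfolding \<delta>_def by (rule lipW[OF R(2) that])
          have MR: "3 * (M1 * \<epsilon>) \<le> R" using M1 \<epsilon>(2) by (simp add: R_def R1_def)
          have "t \<le> T * \<epsilon> powr (1 - \<alpha>)" using t by (simp add: \<tau>_def)
          from error_constant_le[OF alpha \<eta>(1) \<epsilon>(2) e1 T(1) less_imp_le[OF C] l0 R1 less_imp_le[OF M1] less_imp_le[OF Ci] this]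
          have "4 * (Ci * \<epsilon> powr (1 + \<eta>) + 9 * \<delta> * (M1 * \<epsilon>) * \<tau> + 16 * pi * (lip_amp \<alpha> km kp * R powr (\<alpha> - 1)) * (M1 * \<epsilon>)
              + 96 * pi * (lip_amp \<alpha> km kp * R powr (\<alpha> - 1))\<^sup>2 * (M1 * \<epsilon>) * \<tau>) * exp (18 * K * t)
            \<le> CT * \<epsilon> powr (1 + \<eta>)"
            unfolding \<delta>_def K_def R_def \<tau>_def CT_def S_def .
          moreover have "lp_le p (\<lambda>n. X t n - X_ansatz A t n)
              (4 * (Ci * \<epsilon> powr (1 + \<eta>) + 9 * \<delta> * (M1 * \<epsilon>) * \<tau> + 16 * pi * (lip_amp \<alpha> km kp * R powr (\<alpha> - 1)) * (M1 * \<epsilon>)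
              + 96 * pi * (lip_amp \<alpha> km kp * R powr (\<alpha> - 1))\<^sup>2 * (M1 * \<epsilon>) * \<tau>) * exp (18 * K * t))"
            by (rule amplitude_approximation[where g = g and h = h and w = "deriv W" and \<tau> = \<tau>,
                OF alpha p K \<delta> \<delta>K gK h\<delta> h0 gw w\<delta> W_0 A AM MR X X0s t])
          ultimately show ?thesis by (rule lp_le_mono[rotated])
        qed
        \<comment> \<open>The estimate has been derived for the system with cutoff; it now shows that the cutoff is inactive.\<close>
        have inside: "\<bar>fst (X t n)\<bar> \<le> R" "\<bar>fst (X t (n + 1)) - fst (X t n)\<bar> \<le> R" if t: "t \<in> {0..\<tau>}" for t n
        proof -
          have s2: "sqrt 2 \<le> 3 / 2" by (rule real_le_lsqrt) (auto simp: power2_eq_square)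
          have near: "\<bar>fst (X t m) - osc t (A t m)\<bar> \<le> 2 * (M1 * \<epsilon>)" for m
          proof -
            have "\<bar>fst (X t m - X_ansatz A t m)\<bar> \<le> norm (X t m - X_ansatz A t m)" by (rule abs_fst_le)
            also have "\<dots> \<le> CT * \<epsilon> powr (1 + \<eta>)" by (rule lp_le_component[OF p approx[OF t]])
            finally show ?thesis using CT\<epsilon> by (simp add: X_ansatz_eq osc_def)
          qed
          have size: "\<bar>osc t (A t m)\<bar> \<le> 3 / 2 * (M1 * \<epsilon>)" for m
          proof -
            have "\<bar>osc t (A t m)\<bar> \<le> sqrt 2 * norm (A t m)" by (rule abs_osc_le)
            also have "\<dots> \<le> 3 / 2 * (M1 * \<epsilon>)"
              using s2 lp_le_component[OF p AM[OF t]] by (intro mult_mono) auto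
            finally show ?thesis .
          qed
          have pos: "0 < M1 * \<epsilon>" using M1 \<epsilon>(2) by simp
          have R8: "R = 8 * (M1 * \<epsilon>)" by (simp add: R_def R1_def)
          show "\<bar>fst (X t n)\<bar> \<le> R" using near[of n] size[of n] pos unfolding R8 by linarith
          show "\<bar>fst (X t (n + 1)) - fst (X t n)\<bar> \<le> R"
            using near[of n] size[of n] near[of "n + 1"] size[of "n + 1"] pos unfolding R8 by linarith
        qed
        have "solves_ivp p (lattice_field V \<phi>) X0 \<tau> X"
          unfolding lattice_field_eq
        proof (rule solves_ivp_cong[OF X])
          show "lattice_rhs g h (X t) = lattice_rhs (deriv V) (deriv \<phi>) (X t)" if t: "t \<in> {0..\<tau>}" for t
          proof
            fix n
            show "lattice_rhs g h (X t) n = lattice_rhs (deriv V) (deriv \<phi>) (X t) n"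
              using inside[OF t, of n] inside(2)[OF t, of "n - 1"] by (simp add: lattice_rhs_def g_def h_def cutoff_eq)
          qed
        qed
        then have "is_the_solution p (lattice_field V \<phi>) X0 \<tau> X"
          by (rule solves_ivp_is_the_solution[OF p nn_lipschitz_on_lattice_field[OF V_C2 phi_C2]])
        then show ?thesis by (intro exI[of _ X] conjI ballI lp_leD(2)[OF approx])
      qed
      show ?thesis
        unfolding \<tau>_def[symmetric]
        by (intro exI[of _ A] conjI ballI impI amplitude_C2[OF alpha p A] lattice
            solves_ivp_is_the_solution[OF p nn_lipschitz_on_amplitude_field[OF alpha] A])
    qed
    show ?thesis
      by (rule exI[of _ \<epsilon>T], rule exI[of _ CT], intro conjI \<epsilon>T CT ballI allI impI, elim conjE, rule solutions)
  qed
  have "0 < Tm" using rate by (simp add: Tm_def)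
  moreover have "p \<le> ereal (1 + \<alpha>) \<longrightarrow> Tm = \<infinity>" by (simp add: Tm_def)
  ultimately show ?thesis
    by (intro exI[of _ Tm] conjI allI impI main) simp_all
qed

end
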